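(* The property of being a $\gamma$-space is preserved by Cohen forcing: if $X$ is a $\gamma$-space in the ground model $M$, then $X$ is a $\gamma$-space in every forcing extension of $M$ obtained by adding any (nonzero, possibly finite) number of Cohen reals.
   Context: A cover of $X$ is a family $\mathcal U$ with $X=\bigcup\mathcal U$ such that $X$ is not contained in a single member. An open cover is an $\omega$-cover if every finite subset of $X$ lies in some member, and a $\gamma$-cover if it is infinite and every point of $X$ lies in all but finitely many members. $X$ is a $\gamma$-space if every open $\omega$-cover of $X$ contains a $\gamma$-cover. In the extension, $X$ carries the topology generated by the ground-model open sets. *)

theory Defs
  imports Main
begin

text \<open>
  Ground model and extension are transitive classes in a common universe. The universe is any type
  with a well-founded, extensional membership relation; nothing else is assumed about it, so it may
  be any transitive set containing both models. All notions below are relativised, in the usual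
  sense, to a class \<open>C\<close>: their quantifiers range over \<open>C\<close>.
\<close>

class set_universe =
  fixes mem :: "'a \<Rightarrow> 'a \<Rightarrow> bool"  (infix "\<epsilon>" 50)
  assumes mem_extensional: "(\<And>z. z \<epsilon> x \<longleftrightarrow> z \<epsilon> y) \<Longrightarrow> x = y"
    and mem_wf: "wf {(x, y). x \<epsilon> y}"

definition transitive_class :: "'u::set_universe set \<Rightarrow> bool" where
  "transitive_class C \<longleftrightarrow> (\<forall>x\<in>C. \<forall>y. y \<epsilon> x \<longrightarrow> y \<in> C)"

subsection \<open>Relativised set-theoretic vocabulary\<close>

definition is_empty :: "'u::set_universe set \<Rightarrow> 'u \<Rightarrow> bool" where
  "is_empty C x \<longleftrightarrow> (\<forall>z\<in>C. \<not> z \<epsilon> x)"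

definition subset_in :: "'u::set_universe set \<Rightarrow> 'u \<Rightarrow> 'u \<Rightarrow> bool" where
  "subset_in C x y \<longleftrightarrow> (\<forall>z\<in>C. z \<epsilon> x \<longrightarrow> z \<epsilon> y)"

definition is_upair :: "'u::set_universe set \<Rightarrow> 'u \<Rightarrow> 'u \<Rightarrow> 'u \<Rightarrow> bool" where
  "is_upair C x y z \<longleftrightarrow> (\<forall>w\<in>C. w \<epsilon> z \<longleftrightarrow> w = x \<or> w = y)"

text \<open>\<open>z\<close> is the Kuratowski pair \<open>{{x}, {x, y}}\<close>.\<close>

definition is_pair :: "'u::set_universe set \<Rightarrow> 'u \<Rightarrow> 'u \<Rightarrow> 'u \<Rightarrow> bool" where
  "is_pair C x y z \<longleftrightarrow>
     (\<exists>a\<in>C. \<exists>b\<in>C. is_upair C x x a \<and> is_upair C x y b \<and> is_upair C a b z)"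

definition is_union :: "'u::set_universe set \<Rightarrow> 'u \<Rightarrow> 'u \<Rightarrow> bool" where
  "is_union C a u \<longleftrightarrow> (\<forall>z\<in>C. z \<epsilon> u \<longleftrightarrow> (\<exists>y\<in>C. y \<epsilon> a \<and> z \<epsilon> y))"

definition is_inter :: "'u::set_universe set \<Rightarrow> 'u \<Rightarrow> 'u \<Rightarrow> 'u \<Rightarrow> bool" where
  "is_inter C x y u \<longleftrightarrow> (\<forall>z\<in>C. z \<epsilon> u \<longleftrightarrow> z \<epsilon> x \<and> z \<epsilon> y)"

definition is_power :: "'u::set_universe set \<Rightarrow> 'u \<Rightarrow> 'u \<Rightarrow> bool" where
  "is_power C a b \<longleftrightarrow> (\<forall>x\<in>C. x \<epsilon> b \<longleftrightarrow> subset_in C x a)"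

definition is_succ :: "'u::set_universe set \<Rightarrow> 'u \<Rightarrow> 'u \<Rightarrow> bool" where
  "is_succ C x y \<longleftrightarrow> (\<forall>z\<in>C. z \<epsilon> y \<longleftrightarrow> z \<epsilon> x \<or> z = x)"

definition is_transitive :: "'u::set_universe set \<Rightarrow> 'u \<Rightarrow> bool" where
  "is_transitive C x \<longleftrightarrow> (\<forall>y\<in>C. y \<epsilon> x \<longrightarrow> subset_in C y x)"

definition is_ordinal :: "'u::set_universe set \<Rightarrow> 'u \<Rightarrow> bool" where
  "is_ordinal C x \<longleftrightarrow> is_transitive C x \<and> (\<forall>y\<in>C. y \<epsilon> x \<longrightarrow> is_transitive C y)"

text \<open>A natural number is an ordinal \<open>n\<close> such that no \<open>k \<le> n\<close> is a nonzero limit.\<close>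

definition is_natural :: "'u::set_universe set \<Rightarrow> 'u \<Rightarrow> bool" where
  "is_natural C n \<longleftrightarrow> is_ordinal C n \<and>
     (\<forall>k\<in>C. k \<epsilon> n \<or> k = n \<longrightarrow> is_empty C k \<or> (\<exists>j\<in>C. is_succ C j k))"

definition maps_to :: "'u::set_universe set \<Rightarrow> 'u \<Rightarrow> 'u \<Rightarrow> 'u \<Rightarrow> bool" where
  "maps_to C f x y \<longleftrightarrow> (\<exists>z\<in>C. z \<epsilon> f \<and> is_pair C x y z)"

definition is_bijection :: "'u::set_universe set \<Rightarrow> 'u \<Rightarrow> 'u \<Rightarrow> 'u \<Rightarrow> bool" where
  "is_bijection C f a b \<longleftrightarrow>
     (\<forall>z\<in>C. z \<epsilon> f \<longrightarrow> (\<exists>x\<in>C. \<exists>y\<in>C. x \<epsilon> a \<and> y \<epsilon> b \<and> is_pair C x y z)) \<and>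
     (\<forall>x\<in>C. x \<epsilon> a \<longrightarrow> (\<exists>!y. y \<in> C \<and> y \<epsilon> b \<and> maps_to C f x y)) \<and>
     (\<forall>y\<in>C. y \<epsilon> b \<longrightarrow> (\<exists>!x. x \<in> C \<and> x \<epsilon> a \<and> maps_to C f x y))"

definition is_finite :: "'u::set_universe set \<Rightarrow> 'u \<Rightarrow> bool" where
  "is_finite C a \<longleftrightarrow> (\<exists>n\<in>C. is_natural C n \<and> (\<exists>f\<in>C. is_bijection C f n a))"

subsection \<open>Models of ZFC\<close>

text \<open>
  First-order formulas of set theory with de Bruijn indices. They are needed only for the two
  axiom schemes; an assignment \<open>env\<close> into \<open>C\<close> supplies the parameters.
\<close>

datatype formula =
    Member nat nat
  | Equal nat nat
  | Neg formula
  | Conj formula formula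
  | Forall formula

primrec sat :: "'u::set_universe set \<Rightarrow> (nat \<Rightarrow> 'u) \<Rightarrow> formula \<Rightarrow> bool" where
  "sat C env (Member i j) \<longleftrightarrow> env i \<epsilon> env j"
| "sat C env (Equal i j) \<longleftrightarrow> env i = env j"
| "sat C env (Neg \<phi>) \<longleftrightarrow> \<not> sat C env \<phi>"
| "sat C env (Conj \<phi> \<psi>) \<longleftrightarrow> sat C env \<phi> \<and> sat C env \<psi>"
| "sat C env (Forall \<phi>) \<longleftrightarrow> (\<forall>x\<in>C. sat C (case_nat x env) \<phi>)"

definition extensionality_ax :: "'u::set_universe set \<Rightarrow> bool" where
  "extensionality_ax C \<longleftrightarrow>
     (\<forall>x\<in>C. \<forall>y\<in>C. (\<forall>z\<in>C. z \<epsilon> x \<longleftrightarrow> z \<epsilon> y) \<longrightarrow> x = y)"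

definition foundation_ax :: "'u::set_universe set \<Rightarrow> bool" where
  "foundation_ax C \<longleftrightarrow>
     (\<forall>x\<in>C. (\<exists>y\<in>C. y \<epsilon> x) \<longrightarrow> (\<exists>y\<in>C. y \<epsilon> x \<and> \<not> (\<exists>z\<in>C. z \<epsilon> x \<and> z \<epsilon> y)))"

definition pairing_ax :: "'u::set_universe set \<Rightarrow> bool" where
  "pairing_ax C \<longleftrightarrow> (\<forall>x\<in>C. \<forall>y\<in>C. \<exists>z\<in>C. is_upair C x y z)"

definition union_ax :: "'u::set_universe set \<Rightarrow> bool" where
  "union_ax C \<longleftrightarrow> (\<forall>a\<in>C. \<exists>u\<in>C. is_union C a u)"

definition power_ax :: "'u::set_universe set \<Rightarrow> bool" where
  "power_ax C \<longleftrightarrow> (\<forall>a\<in>C. \<exists>b\<in>C. is_power C a b)"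

definition infinity_ax :: "'u::set_universe set \<Rightarrow> bool" where
  "infinity_ax C \<longleftrightarrow>
     (\<exists>a\<in>C. (\<exists>x\<in>C. is_empty C x \<and> x \<epsilon> a) \<and>
       (\<forall>x\<in>C. x \<epsilon> a \<longrightarrow> (\<exists>y\<in>C. is_succ C x y \<and> y \<epsilon> a)))"

definition choice_ax :: "'u::set_universe set \<Rightarrow> bool" where
  "choice_ax C \<longleftrightarrow>
     (\<forall>a\<in>C.
       (\<forall>x\<in>C. x \<epsilon> a \<longrightarrow> \<not> is_empty C x) \<and>
       (\<forall>x\<in>C. \<forall>y\<in>C. x \<epsilon> a \<and> y \<epsilon> a \<and> x \<noteq> y \<longrightarrow> \<not> (\<exists>z\<in>C. z \<epsilon> x \<and> z \<epsilon> y)) \<longrightarrow>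
       (\<exists>c\<in>C. \<forall>x\<in>C. x \<epsilon> a \<longrightarrow> (\<exists>!y. y \<in> C \<and> y \<epsilon> x \<and> y \<epsilon> c)))"

definition separation_ax :: "'u::set_universe set \<Rightarrow> bool" where
  "separation_ax C \<longleftrightarrow>
     (\<forall>\<phi> env. (\<forall>n. env n \<in> C) \<longrightarrow>
       (\<forall>a\<in>C. \<exists>b\<in>C. \<forall>x\<in>C. x \<epsilon> b \<longleftrightarrow> x \<epsilon> a \<and> sat C (case_nat x env) \<phi>))"

definition replacement_ax :: "'u::set_universe set \<Rightarrow> bool" where
  "replacement_ax C \<longleftrightarrow>
     (\<forall>\<phi> env. (\<forall>n. env n \<in> C) \<longrightarrow>
       (\<forall>a\<in>C.
         (\<forall>x\<in>C. x \<epsilon> a \<longrightarrow> (\<exists>!y. y \<in> C \<and> sat C (case_nat x (case_nat y env)) \<phi>)) \<longrightarrow>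
         (\<exists>b\<in>C. \<forall>y\<in>C. y \<epsilon> b \<longleftrightarrow>
           (\<exists>x\<in>C. x \<epsilon> a \<and> sat C (case_nat x (case_nat y env)) \<phi>))))"

definition transitive_model_ZFC :: "'u::set_universe set \<Rightarrow> bool" where
  "transitive_model_ZFC C \<longleftrightarrow> transitive_class C \<and>
     extensionality_ax C \<and> foundation_ax C \<and> pairing_ax C \<and> union_ax C \<and> power_ax C \<and>
     infinity_ax C \<and> choice_ax C \<and> separation_ax C \<and> replacement_ax C"

subsection \<open>Cohen forcing and generic extensions\<close>

text \<open>
  \<open>cohen_forcing M I\<close> is the poset \<open>Fn(I \<times> \<omega>, 2)\<close> of \<open>M\<close>: finite partial functions from
  \<open>I \<times> \<omega>\<close> to \<open>2 = {0, 1}\<close>, with \<open>q\<close> stronger than \<open>p\<close> iff \<open>p \<subseteq> q\<close>. It adds one Cohen real for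
  each element of \<open>I\<close>.
\<close>

definition cohen_forcing :: "'u::set_universe set \<Rightarrow> 'u \<Rightarrow> 'u set" where
  "cohen_forcing M I =
     {p \<in> M. is_finite M p \<and>
       (\<forall>z\<in>M. z \<epsilon> p \<longrightarrow>
         (\<exists>i\<in>M. \<exists>n\<in>M. \<exists>d\<in>M. \<exists>e\<in>M.
            i \<epsilon> I \<and> is_natural M n \<and> is_pair M i n d \<and>
            (is_empty M e \<or> (\<exists>c\<in>M. is_empty M c \<and> is_succ M c e)) \<and>
            is_pair M d e z)) \<and>
       (\<forall>d\<in>M. \<forall>e\<in>M. \<forall>e'\<in>M. maps_to M p d e \<and> maps_to M p d e' \<longrightarrow> e = e')}"

definition is_dense :: "'u::set_universe set \<Rightarrow> 'u set \<Rightarrow> 'u \<Rightarrow> bool" where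
  "is_dense M P D \<longleftrightarrow>
     (\<forall>p\<in>M. p \<epsilon> D \<longrightarrow> p \<in> P) \<and> (\<forall>p\<in>P. \<exists>q\<in>P. q \<epsilon> D \<and> subset_in M p q)"

definition generic_filter :: "'u::set_universe set \<Rightarrow> 'u set \<Rightarrow> 'u set \<Rightarrow> bool" where
  "generic_filter M P G \<longleftrightarrow> G \<subseteq> P \<and> G \<noteq> {} \<and>
     (\<forall>q\<in>G. \<forall>p\<in>P. subset_in M p q \<longrightarrow> p \<in> G) \<and>
     (\<forall>p\<in>G. \<forall>q\<in>G. \<exists>r\<in>G. subset_in M p r \<and> subset_in M q r) \<and>
     (\<forall>D\<in>M. is_dense M P D \<longrightarrow> (\<exists>p\<in>G. p \<epsilon> D))"

inductive_set names :: "'u::set_universe set \<Rightarrow> 'u set \<Rightarrow> 'u set"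
  for M :: "'u set" and P :: "'u set" where
  name: "t \<in> M \<Longrightarrow>
    (\<And>z. z \<epsilon> t \<Longrightarrow> \<exists>s p. s \<in> names M P \<and> p \<in> P \<and> is_pair M s p z) \<Longrightarrow> t \<in> names M P"

text \<open>
  \<open>N = M[G]\<close>. The evaluation of names \<open>val t = {val s | (s, p) \<in> t, p \<in> G}\<close> is uniquely
  determined by its recursion equation. Its existence says that the universe is
  large enough to contain \<open>M[G]\<close>.
\<close>

definition generic_extension ::
    "'u::set_universe set \<Rightarrow> 'u set \<Rightarrow> 'u set \<Rightarrow> 'u set \<Rightarrow> bool" where
  "generic_extension M P G N \<longleftrightarrow> generic_filter M P G \<and>
     (\<exists>val. (\<forall>t\<in>names M P. \<forall>y. y \<epsilon> val t \<longleftrightarrow>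
               (\<exists>s\<in>names M P. \<exists>p\<in>G. \<exists>z. z \<epsilon> t \<and> is_pair M s p z \<and> y = val s)) \<and>
            N = val ` names M P)"

text \<open>
  There is no separate inclusion of \<open>M\<close> in \<open>N\<close>: evaluating check names gives \<open>M \<subseteq> N\<close>, since
  sets of the universe with the same elements are equal.
\<close>

subsection \<open>Topology and covers\<close>

definition is_topology :: "'u::set_universe set \<Rightarrow> 'u \<Rightarrow> 'u \<Rightarrow> bool" where
  "is_topology C X T \<longleftrightarrow>
     (\<forall>U\<in>C. U \<epsilon> T \<longrightarrow> subset_in C U X) \<and>
     X \<epsilon> T \<and> (\<forall>U\<in>C. is_empty C U \<longrightarrow> U \<epsilon> T) \<and>
     (\<forall>U\<in>C. \<forall>V\<in>C. \<forall>W\<in>C. U \<epsilon> T \<and> V \<epsilon> T \<and> is_inter C U V W \<longrightarrow> W \<epsilon> T) \<and>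
     (\<forall>A\<in>C. \<forall>W\<in>C. subset_in C A T \<and> is_union C A W \<longrightarrow> W \<epsilon> T)"

text \<open>
  The open sets, in \<open>C\<close>, of the topology on \<open>X\<close> generated by \<open>B\<close>. It is only used for \<open>B\<close> closed
  under finite intersections and covering \<open>X\<close>, so that \<open>B\<close> is a base.
\<close>

definition generated_open :: "'u::set_universe set \<Rightarrow> 'u \<Rightarrow> 'u \<Rightarrow> 'u \<Rightarrow> bool" where
  "generated_open C X B U \<longleftrightarrow> subset_in C U X \<and>
     (\<forall>x\<in>C. x \<epsilon> U \<longrightarrow> (\<exists>V\<in>C. V \<epsilon> B \<and> x \<epsilon> V \<and> subset_in C V U))"

text \<open>In the following, \<open>opn\<close> is the predicate of being an open subset of \<open>X\<close>.\<close>

definition open_cover :: "'u::set_universe set \<Rightarrow> ('u \<Rightarrow> bool) \<Rightarrow> 'u \<Rightarrow> 'u \<Rightarrow> bool" where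
  "open_cover C opn X \<U> \<longleftrightarrow>
     (\<forall>U\<in>C. U \<epsilon> \<U> \<longrightarrow> opn U) \<and> is_union C \<U> X \<and> (\<forall>U\<in>C. U \<epsilon> \<U> \<longrightarrow> \<not> subset_in C X U)"

definition omega_cover :: "'u::set_universe set \<Rightarrow> ('u \<Rightarrow> bool) \<Rightarrow> 'u \<Rightarrow> 'u \<Rightarrow> bool" where
  "omega_cover C opn X \<U> \<longleftrightarrow> open_cover C opn X \<U> \<and>
     (\<forall>F\<in>C. is_finite C F \<and> subset_in C F X \<longrightarrow> (\<exists>U\<in>C. U \<epsilon> \<U> \<and> subset_in C F U))"

definition gamma_cover :: "'u::set_universe set \<Rightarrow> ('u \<Rightarrow> bool) \<Rightarrow> 'u \<Rightarrow> 'u \<Rightarrow> bool" where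
  "gamma_cover C opn X \<U> \<longleftrightarrow> open_cover C opn X \<U> \<and> \<not> is_finite C \<U> \<and>
     (\<forall>x\<in>C. x \<epsilon> X \<longrightarrow>
       (\<exists>F\<in>C. is_finite C F \<and> (\<forall>U\<in>C. U \<epsilon> F \<longleftrightarrow> U \<epsilon> \<U> \<and> \<not> x \<epsilon> U)))"

definition gamma_space :: "'u::set_universe set \<Rightarrow> ('u \<Rightarrow> bool) \<Rightarrow> 'u \<Rightarrow> bool" where
  "gamma_space C opn X \<longleftrightarrow>
     (\<forall>\<U>\<in>C. omega_cover C opn X \<U> \<longrightarrow>
       (\<exists>\<V>\<in>C. subset_in C \<V> \<U> \<and> gamma_cover C opn X \<V>))"

end

theory Submission
  imports Defs
begin

text \<open>
  Let \<open>u\<close> name an omega-cover in \<open>M[G]\<close>. A pair \<open>z = (s, r)\<close>, with \<open>s\<close> in the domain of \<open>u\<close> and \<open>r\<close>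
  forcing \<open>s \<in> u\<close>, determines in \<open>M\<close> the interior \<open>O z\<close> of the set of points that \<open>r\<close> forces into
  \<open>s\<close>. Some condition \<open>q0 \<in> G\<close> forces \<open>u\<close> to be an omega-cover, so that below every \<open>q \<le> q0\<close> the sets
  \<open>O (s, r)\<close> with \<open>r \<le> q\<close> capture every finite set of points. The selection principle for gamma
  spaces, applied in \<open>M\<close>, yields a set \<open>S\<close> of such pairs with two properties: each point lies in
  \<open>O z\<close> for all but finitely many \<open>z \<in> S\<close>, and for every \<open>p \<le> q0\<close> and every finite set \<open>F\<close> of points
  some \<open>(s, r) \<in> S\<close> has \<open>r\<close> compatible with \<open>p\<close> and \<open>F \<subseteq> O (s, r)\<close>. Since \<open>S\<close> consists of pairs of a
  name and a condition, \<open>S\<close> is itself a name, and its value is the desired gamma subcover.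
\<close>

text \<open>Passing to the interior loses nothing: every finite subset of a member \<open>U\<close>
  of the cover lies in one ground-model open \<open>W\<close> inside \<open>U\<close>, since
  ground-model open sets are closed under finite unions, and genericity yields a single condition in
  \<open>G\<close> forcing all of \<open>W\<close> into the name of \<open>U\<close>, however large
  \<open>W\<close> is. The sets \<open>O z\<close> may equal \<open>X\<close>, so they are shrunk
  into members of a fixed gamma sequence of proper open sets; this also spreads the indices over
  levels, so that a selected cover has finitely many on each.

  The obstacle is compatibility. \<open>Fn(I \<times> \<omega>, 2)\<close> may be uncountable, so
  its conditions cannot be treated one after another. Supports are finite, though: a condition
  supported in a set \<open>B\<close> of coordinates is compatible with \<open>p\<close> as soon as
  it extends the restriction of \<open>p\<close> to \<open>B\<close>. It suffices to serve the
  restrictions to a suitable countable \<open>B\<close>, of which only finitely many live on each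
  finite stage of \<open>B\<close>. Finite levels keep the stages finite. A finite intersection of
  sets \<open>O z\<close> then serves a whole stage at once, and a second selection runs over these
  intersections.\<close>

definition elts :: "'u::set_universe \<Rightarrow> 'u set" where
  "elts x = {z. z \<epsilon> x}"

lemma in_elts [simp]: "z \<in> elts x \<longleftrightarrow> z \<epsilon> x"
  by (simp add: elts_def)

lemma elts_inject [simp]: "elts x = elts y \<longleftrightarrow> x = y"
proof
  assume "elts x = elts y"
  then show "x = y" by (intro mem_extensional) (metis in_elts)
qed simp

lemma eps_induct [case_names step]:
  assumes "\<And>x. (\<And>y. y \<epsilon> x \<Longrightarrow> P y) \<Longrightarrow> P x"
  shows "P (x::'u::set_universe)"
  using mem_wf by (induction x rule: wf_induct_rule) (use assms in blast)

lemma not_eps_self: "\<not> x \<epsilon> (x::'u::set_universe)"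
  by (induction x rule: eps_induct) blast

text \<open>Unspecified unless some element of the universe has exactly the members
  \<open>S\<close>. Facts about \<open>elts (set_of S)\<close> are therefore guarded by an existence
  proof.\<close>

definition set_of :: "'u::set_universe set \<Rightarrow> 'u" where
  "set_of S = (THE a. elts a = S)"

lemma set_of_elts [simp]: "set_of (elts a) = a"
  unfolding set_of_def by (rule the_equality) auto

text \<open>One function serves all classes: by \<open>is_pair_iff\<close>, every class closed under
  finite sets computes it alike, so ground model and extension share their pairs.\<close>

definition pair :: "'u::set_universe \<Rightarrow> 'u \<Rightarrow> 'u" where
  "pair x y = set_of {set_of {x}, set_of {x, y}}"

primrec num :: "nat \<Rightarrow> 'u::set_universe" where
  "num 0 = set_of {}"
| "num (Suc n) = set_of (insert (num n) (elts (num n)))"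

text \<open>
  A class closed under finite sets computes pairs, natural numbers and finiteness correctly. This
  applies to the ground model and to the extension alike, so the extension need not be shown to
  satisfy any further axiom of set theory.
\<close>

locale fin_class =
  fixes C :: "'u::set_universe set"
  assumes trans: "x \<in> C \<Longrightarrow> y \<epsilon> x \<Longrightarrow> y \<in> C"
    and ex_empty: "\<exists>z\<in>C. elts z = {}"
    and ex_insert: "a \<in> C \<Longrightarrow> b \<in> C \<Longrightarrow> \<exists>c\<in>C. elts c = insert b (elts a)"
begin

lemma elts_subset: "x \<in> C \<Longrightarrow> elts x \<subseteq> C"
  using trans by auto

lemma ex_finite_set: "finite S \<Longrightarrow> S \<subseteq> C \<Longrightarrow> \<exists>c\<in>C. elts c = S"
proof (induction S rule: finite_induct)
  case empty
  show ?case by (rule ex_empty)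
next
  case (insert x F)
  then show ?case using ex_insert by (metis insert_subset)
qed

lemma finite_set_of: "finite S \<Longrightarrow> S \<subseteq> C \<Longrightarrow> elts (set_of S) = S \<and> set_of S \<in> C"
  using ex_finite_set by (metis set_of_elts)

lemma pair_closed [simp]: "x \<in> C \<Longrightarrow> y \<in> C \<Longrightarrow> pair x y \<in> C"
  by (simp add: pair_def finite_set_of)

lemma elts_pair: "x \<in> C \<Longrightarrow> y \<in> C \<Longrightarrow> elts (pair x y) = {set_of {x}, set_of {x, y}}"
  by (simp add: pair_def finite_set_of)

lemma pair_inject:
  assumes "x \<in> C" "y \<in> C" "x' \<in> C" "y' \<in> C"
  shows "pair x y = pair x' y' \<longleftrightarrow> x = x' \<and> y = y'"
proof
  assume "pair x y = pair x' y'"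
  then have *: "{set_of {x}, set_of {x, y}} = {set_of {x'}, set_of {x', y'}}"
    using assms by (metis elts_pair)
  have e: "elts (set_of {x}) = {x}" "elts (set_of {x, y}) = {x, y}"
     "elts (set_of {x'}) = {x'}" "elts (set_of {x', y'}) = {x', y'}"
    using assms by (simp_all add: finite_set_of)
  from * have "elts ` {set_of {x}, set_of {x, y}} = elts ` {set_of {x'}, set_of {x', y'}}"
    by simp
  then have "{{x}, {x, y}} = {{x'}, {x', y'}}" by (simp add: e)
  then show "x = x' \<and> y = y'" by (metis doubleton_eq_iff insert_absorb2)
qed simp

text \<open>The witness is \<open>{x, y}\<close>. A pair sits two membership steps above its
  components, so a transitive set that contains the pair contains both of them. Names are unwound in
  this way.\<close>

lemma pair_components:
  assumes "x \<in> C" "y \<in> C"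
  shows "\<exists>b. b \<epsilon> pair x y \<and> x \<epsilon> b \<and> y \<epsilon> b"
proof -
  have "set_of {x, y} \<in> elts (pair x y)" "elts (set_of {x, y}) = {x, y}"
    using assms by (simp_all add: elts_pair finite_set_of del: in_elts)
  then show ?thesis by (metis in_elts insertCI)
qed

lemma is_upair_iff: "x \<in> C \<Longrightarrow> y \<in> C \<Longrightarrow> z \<in> C \<Longrightarrow> is_upair C x y z \<longleftrightarrow> z = set_of {x, y}"
proof -
  assume a: "x \<in> C" "y \<in> C" "z \<in> C"
  then have "is_upair C x y z \<longleftrightarrow> elts z = {x, y}"
    unfolding is_upair_def using trans[OF a(3)] by auto
  also have "\<dots> \<longleftrightarrow> z = set_of {x, y}"
    using a finite_set_of[of "{x, y}"] set_of_elts[of z] by (metis empty_subsetI finite.simps insert_subset)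
  finally show ?thesis .
qed

lemma is_pair_iff: "x \<in> C \<Longrightarrow> y \<in> C \<Longrightarrow> z \<in> C \<Longrightarrow> is_pair C x y z \<longleftrightarrow> z = pair x y"
  using is_upair_iff[of x x] is_upair_iff[of x y] finite_set_of[of "{x, y}"] finite_set_of[of "{x}"]
    is_upair_iff[of "set_of {x}" "set_of {x, y}" z]
  by (simp add: is_pair_def pair_def)

lemma subset_in_iff: "x \<in> C \<Longrightarrow> subset_in C x y \<longleftrightarrow> elts x \<subseteq> elts y"
  unfolding subset_in_def using trans[of x] by auto

lemma is_empty_iff: "x \<in> C \<Longrightarrow> is_empty C x \<longleftrightarrow> elts x = {}"
  unfolding is_empty_def using trans[of x] by auto

lemma is_succ_iff: "x \<in> C \<Longrightarrow> y \<in> C \<Longrightarrow> is_succ C x y \<longleftrightarrow> elts y = insert x (elts x)"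
  unfolding is_succ_def using trans[of x] trans[of y] by (auto simp: set_eq_iff)

lemma is_union_iff: "a \<in> C \<Longrightarrow> elts u \<subseteq> C \<Longrightarrow> is_union C a u \<longleftrightarrow> elts u = (\<Union>y\<in>elts a. elts y)"
proof -
  assume a: "a \<in> C" "elts u \<subseteq> C"
  have "z \<in> C" if "y \<epsilon> a" "z \<epsilon> y" for y z using trans a(1) that by blast
  moreover have "y \<in> C" if "y \<epsilon> a" for y using trans a(1) that by blast
  ultimately show ?thesis using a(2) unfolding is_union_def set_eq_iff by (simp add: subset_iff Bex_def Ball_def) blast
qed

lemma is_inter_iff: "x \<in> C \<Longrightarrow> u \<in> C \<Longrightarrow> is_inter C x y u \<longleftrightarrow> elts u = elts x \<inter> elts y"
  unfolding is_inter_def using trans[of x] trans[of u] by auto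

lemma maps_to_iff: "f \<in> C \<Longrightarrow> x \<in> C \<Longrightarrow> y \<in> C \<Longrightarrow> maps_to C f x y \<longleftrightarrow> pair x y \<epsilon> f"
  unfolding maps_to_def using is_pair_iff pair_closed by auto

lemma num_closed_elts: "num n \<in> C \<and> elts (num n :: 'u) = num ` {..<n}"
proof (induction n)
  case 0
  then show ?case using ex_empty by simp (metis set_of_elts)
next
  case (Suc n)
  then have "num ` {..<Suc n} \<subseteq> C" using trans by (metis elts_subset insert_subset image_insert lessThan_Suc)
  then show ?case using Suc finite_set_of[of "num ` {..<Suc n}"]
    by (simp add: lessThan_Suc)
qed

lemma num_closed [simp]: "num n \<in> C"
  and elts_num: "elts (num n :: 'u) = num ` {..<n}"
  using num_closed_elts by auto

lemma eps_num: "(x::'u) \<epsilon> num n \<longleftrightarrow> (\<exists>m<n. x = num m)"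
  using elts_num[of n] by (auto simp: set_eq_iff)

lemma num_less: "m < n \<Longrightarrow> num m \<noteq> (num n :: 'u)"
  using eps_num not_eps_self by metis

lemma num_inject [simp]: "num m = (num n :: 'u) \<longleftrightarrow> m = n"
  by (metis num_less linorder_neqE_nat)

lemma num_eps_num [simp]: "(num m :: 'u) \<epsilon> num n \<longleftrightarrow> m < n"
  by (metis eps_num num_inject)

lemma is_ordinal_iff: "x \<in> C \<Longrightarrow> is_ordinal C x \<longleftrightarrow>
    (\<forall>y. y \<epsilon> x \<longrightarrow> (\<forall>z. z \<epsilon> y \<longrightarrow> z \<epsilon> x \<and> (\<forall>w. w \<epsilon> z \<longrightarrow> w \<epsilon> y)))"
proof -
  assume x: "x \<in> C"
  have 1: "y \<in> C" if "y \<epsilon> x" for y using trans x that by blast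
  have 2: "z \<in> C" if "y \<epsilon> x" "z \<epsilon> y" for y z using trans 1 that by blast
  have 3: "w \<in> C" if "y \<epsilon> x" "z \<epsilon> y" "w \<epsilon> z" for y z w using trans 2 that by blast
  show ?thesis
    unfolding is_ordinal_def is_transitive_def subset_in_def using 1 2 3 by meson
qed

text \<open>From left to right this is membership induction: a nonempty natural is the successor of
  some \<open>j\<close>, the defining conditions pass down to \<open>j\<close>, and \<open>j\<close>
  is a numeral by induction. Well-foundedness of the universe thus excludes nonstandard
  naturals.\<close>

lemma is_natural_iff: "n \<in> C \<Longrightarrow> is_natural C n \<longleftrightarrow> n \<in> range num"
proof
  assume "n \<in> C" and "n \<in> range num"
  then obtain m where m: "n = num m" by auto
  show "is_natural C n"
    unfolding is_natural_def
  proof (intro conjI ballI impI)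
    show "is_ordinal C n" using \<open>n \<in> C\<close> by (auto simp: is_ordinal_iff m eps_num)
    fix k assume "k \<in> C" "k \<epsilon> n \<or> k = n"
    then obtain l where l: "k = num l" by (auto simp: m eps_num)
    show "is_empty C k \<or> (\<exists>j\<in>C. is_succ C j k)"
    proof (cases l)
      case 0
      then show ?thesis using l \<open>k \<in> C\<close> by (auto simp: is_empty_def eps_num simp del: num.simps)
    next
      case (Suc l')
      then have "is_succ C (num l') k"
        by (auto simp: is_succ_iff l elts_num lessThan_Suc simp del: num.simps)
      then show ?thesis by auto
    qed
  qed
next
  assume "n \<in> C" and "is_natural C n"
  then show "n \<in> range num"
  proof (induction n rule: eps_induct)
    case (step n)
    then have ord: "is_ordinal C n" and *: "is_empty C n \<or> (\<exists>j\<in>C. is_succ C j n)"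
      unfolding is_natural_def by auto
    from * show ?case
    proof
      assume "is_empty C n"
      then have "elts n = elts (num 0)" using step.prems by (simp add: is_empty_iff elts_num del: num.simps)
      then show ?thesis by (simp del: num.simps)
    next
      assume "\<exists>j\<in>C. is_succ C j n"
      then obtain j where j: "j \<in> C" "is_succ C j n" by auto
      then have e: "elts n = insert j (elts j)" using step.prems by (simp add: is_succ_iff)
      have nj: "k \<epsilon> n \<longleftrightarrow> k = j \<or> k \<epsilon> j" for k using e by (auto simp: set_eq_iff)
      have ord': "y \<epsilon> n \<Longrightarrow> z \<epsilon> y \<Longrightarrow> w \<epsilon> z \<Longrightarrow> w \<epsilon> y" for y z w
        using ord is_ordinal_iff[OF step.prems(1)] by blast
      have "is_ordinal C j"
        unfolding is_ordinal_iff[OF j(1)] using ord'[of j] ord' nj by (metis (no_types))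
      moreover have "\<forall>k\<in>C. k \<epsilon> n \<or> k = n \<longrightarrow> is_empty C k \<or> (\<exists>j\<in>C. is_succ C j k)"
        using step.prems(2) unfolding is_natural_def by simp
      then have "\<forall>k\<in>C. k \<epsilon> j \<or> k = j \<longrightarrow> is_empty C k \<or> (\<exists>j\<in>C. is_succ C j k)"
        using nj by simp
      ultimately have "is_natural C j" unfolding is_natural_def by simp
      then obtain m where "j = num m" using step.IH[of j] j nj by auto
      then have "elts n = elts (num (Suc m))"
        using e by (simp add: elts_num lessThan_Suc del: num.simps)
      then show ?thesis by (simp del: num.simps)
    qed
  qed
qed

text \<open>Finiteness is absolute: a bijection in \<open>C\<close> starts from a genuine numeral,
  and conversely the graph of a HOL bijection is a finite set of pairs, hence an element of
  \<open>C\<close>.\<close>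

lemma is_finite_iff: "a \<in> C \<Longrightarrow> is_finite C a \<longleftrightarrow> finite (elts a)"
proof
  assume a: "a \<in> C" and "is_finite C a"
  then obtain n f where nf: "n \<in> C" "is_natural C n" "f \<in> C" "is_bijection C f n a"
    unfolding is_finite_def by auto
  then obtain m where m: "n = num m" using is_natural_iff by auto
  have uniq: "\<forall>x\<in>C. x \<epsilon> n \<longrightarrow> (\<exists>!y. y \<in> C \<and> y \<epsilon> a \<and> maps_to C f x y)"
    and sur: "\<forall>y\<in>C. y \<epsilon> a \<longrightarrow> (\<exists>!x. x \<in> C \<and> x \<epsilon> n \<and> maps_to C f x y)"
    using nf(4) unfolding is_bijection_def by simp_all
  have "\<exists>x. x \<in> elts n \<and> maps_to C f x y" if "y \<in> elts a" for y
    using bspec[OF sur trans[OF a, of y]] that by auto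
  then obtain g where g: "\<And>y. y \<in> elts a \<Longrightarrow> g y \<in> elts n \<and> maps_to C f (g y) y"
    by metis
  have "inj_on g (elts a)"
  proof (rule inj_onI)
    fix y z assume yz: "y \<in> elts a" "z \<in> elts a" "g y = g z"
    have "\<exists>!w. w \<in> C \<and> w \<epsilon> a \<and> maps_to C f (g y) w"
      using g[OF yz(1)] bspec[OF uniq trans[OF nf(1), of "g y"]] by simp
    then show "y = z" using g[OF yz(1)] g[OF yz(2)] yz trans[OF a] by auto
  qed
  moreover have "finite (g ` elts a)"
  proof (rule finite_subset)
    show "g ` elts a \<subseteq> elts n" using g by blast
    show "finite (elts n)" by (simp add: m elts_num)
  qed
  ultimately show "finite (elts a)" using finite_imageD by blast
next
  assume a: "a \<in> C" and "finite (elts a)"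
  then obtain h where h: "bij_betw h {0..<card (elts a)} (elts a)"
    using ex_bij_betw_nat_finite by blast
  define n where "n = card (elts a)"
  have hC: "h i \<in> C" if "i < n" for i
    using bij_betwE[OF h] that trans[OF a] by (auto simp: n_def)
  define S where "S = (\<lambda>i. pair (num i) (h i)) ` {0..<n}"
  have "S \<subseteq> C" "finite S" using hC by (auto simp: S_def)
  then obtain f where f: "f \<in> C" "elts f = S" using ex_finite_set by blast
  have eps_f: "z \<epsilon> f \<longleftrightarrow> (\<exists>i<n. z = pair (num i) (h i))" for z
    using f(2) by (auto simp: S_def set_eq_iff)
  have mt: "maps_to C f (num i) y \<longleftrightarrow> y = h i" if "i < n" "y \<in> C" for i y
    using that hC f(1) by (auto simp: maps_to_iff eps_f pair_inject)
  have surj: "y \<epsilon> a \<longleftrightarrow> (\<exists>i<n. y = h i)" for y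
    using bij_betw_imp_surj_on[OF h] by (auto simp: n_def set_eq_iff image_iff Bex_def)
  have inj: "h i = h j \<longleftrightarrow> i = j" if "i < n" "j < n" for i j
    using bij_betw_imp_inj_on[OF h] that by (auto simp: n_def inj_on_def)
  have "is_bijection C f (num n) a"
    unfolding is_bijection_def
  proof (intro conjI ballI impI)
    fix z assume "z \<in> C" "z \<epsilon> f"
    then obtain i where "i < n" "z = pair (num i) (h i)" by (auto simp: eps_f)
    then show "\<exists>x\<in>C. \<exists>y\<in>C. x \<epsilon> num n \<and> y \<epsilon> a \<and> is_pair C x y z"
      using hC surj by (intro bexI[of _ "num i"] bexI[of _ "h i"]) (auto simp: is_pair_iff)
  next
    fix x assume "x \<in> C" "x \<epsilon> num n"
    then obtain i where "i < n" "x = num i" by (auto simp: eps_num)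
    then show "\<exists>!y. y \<in> C \<and> y \<epsilon> a \<and> maps_to C f x y"
      using mt hC surj by (intro ex1I[of _ "h i"]) auto
  next
    fix y assume "y \<in> C" "y \<epsilon> a"
    then obtain i where i: "i < n" "y = h i" by (auto simp: surj)
    show "\<exists>!x. x \<in> C \<and> x \<epsilon> num n \<and> maps_to C f x y"
    proof (rule ex1I[of _ "num i"])
      show "num i \<in> C \<and> (num i :: 'u) \<epsilon> num n \<and> maps_to C f (num i) y" using i hC mt by auto
      fix x assume x: "x \<in> C \<and> x \<epsilon> num n \<and> maps_to C f x y"
      then obtain j where "j < n" "x = num j" by (auto simp: eps_num)
      then show "x = num i" using mt[of j y] x i hC inj by auto
    qed
  qed
  then show "is_finite C a" unfolding is_finite_def using f is_natural_iff[of "num n"] by auto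
qed

end

section \<open>Definability of predicates and functions over a class\<close>

primrec rename :: "(nat \<Rightarrow> nat) \<Rightarrow> formula \<Rightarrow> formula" where
  "rename f (Member i j) = Member (f i) (f j)"
| "rename f (Equal i j) = Equal (f i) (f j)"
| "rename f (Neg \<phi>) = Neg (rename f \<phi>)"
| "rename f (Conj \<phi> \<psi>) = Conj (rename f \<phi>) (rename f \<psi>)"
| "rename f (Forall \<phi>) = Forall (rename (case_nat 0 (Suc \<circ> f)) \<phi>)"

lemma sat_rename: "sat C env (rename f \<phi>) \<longleftrightarrow> sat C (env \<circ> f) \<phi>"
proof (induction \<phi> arbitrary: f env)
  case (Forall \<phi>)
  have "case_nat x env \<circ> case_nat 0 (Suc \<circ> f) = case_nat x (env \<circ> f)" for x
    by (auto simp: fun_eq_iff split: nat.splits)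
  then show ?case by (simp only: rename.simps sat.simps Forall)
qed auto

definition assign :: "(nat \<Rightarrow> nat + 'u) \<Rightarrow> (nat \<Rightarrow> 'u) \<Rightarrow> nat \<Rightarrow> 'u" where
  "assign g e n = (case g n of Inl i \<Rightarrow> e i | Inr c \<Rightarrow> c)"

text \<open>
  A predicate of environments is definable over \<open>C\<close> if a formula expresses it, where \<open>g\<close> tells
  which variables of the formula are read from the environment and which are parameters. The
  quantifier rule below is a higher-order pattern, so that definability of a HOL predicate can be
  proved by resolution along its syntax.
\<close>

definition dpred :: "'u::set_universe set \<Rightarrow> ((nat \<Rightarrow> 'u) \<Rightarrow> bool) \<Rightarrow> bool" where
  "dpred C R \<longleftrightarrow> (\<exists>\<phi> g. (\<forall>n c. g n = Inr c \<longrightarrow> c \<in> C) \<and>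
     (\<forall>e. range e \<subseteq> C \<longrightarrow> R e = sat C (assign g e) \<phi>))"

text \<open>The graph is definable, with the value in position 0. Closure under \<open>t\<close> is
  included because \<open>dpred_subst\<close> eliminates a term by a quantifier bounded by
  \<open>C\<close>, which finds the value only if it belongs to \<open>C\<close>.\<close>

definition dterm :: "'u::set_universe set \<Rightarrow> ((nat \<Rightarrow> 'u) \<Rightarrow> 'u) \<Rightarrow> bool" where
  "dterm C t \<longleftrightarrow> (\<forall>e. range e \<subseteq> C \<longrightarrow> t e \<in> C) \<and> dpred C (\<lambda>e. e 0 = t (\<lambda>n. e (Suc n)))"

lemma dpred_cong: "dpred C R \<Longrightarrow> (\<And>e. range e \<subseteq> C \<Longrightarrow> R' e = R e) \<Longrightarrow> dpred C R'"
  unfolding dpred_def by blast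

lemma dpred_not: "dpred C R \<Longrightarrow> dpred C (\<lambda>e. \<not> R e)"
  unfolding dpred_def by (metis sat.simps(3))

lemma dpred_conj:
  assumes "dpred C R" "dpred C S"
  shows "dpred C (\<lambda>e. R e \<and> S e)"
proof -
  obtain \<phi> g where 1: "\<forall>n c. g n = Inr c \<longrightarrow> c \<in> C"
    "\<forall>e. range e \<subseteq> C \<longrightarrow> R e = sat C (assign g e) \<phi>"
    using assms(1) unfolding dpred_def by auto
  obtain \<psi> h where 2: "\<forall>n c. h n = Inr c \<longrightarrow> c \<in> C"
    "\<forall>e. range e \<subseteq> C \<longrightarrow> S e = sat C (assign h e) \<psi>"
    using assms(2) unfolding dpred_def by auto
  \<comment> \<open>The two formulas may use the same variables for different purposes. Even
    variables are given to the first formula and odd ones to the second.\<close>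
  define k where "k n = (if even n then g (n div 2) else h (n div 2))" for n
  have "assign k e \<circ> (\<lambda>n. 2 * n) = assign g e" "assign k e \<circ> (\<lambda>n. 2 * n + 1) = assign h e" for e
    by (auto simp: fun_eq_iff assign_def k_def)
  then show ?thesis
    unfolding dpred_def using 1 2
    by (intro exI[of _ "Conj (rename (\<lambda>n. 2 * n) \<phi>) (rename (\<lambda>n. 2 * n + 1) \<psi>)"] exI[of _ k])
       (auto simp: sat_rename k_def simp del: One_nat_def)
qed

lemma dpred_all:
  assumes "dpred C (\<lambda>e. Q (\<lambda>n. e (Suc n)) (e 0))"
  shows "dpred C (\<lambda>e. \<forall>x\<in>C. Q e x)"
proof -
  obtain \<phi> g where 1: "\<forall>n c. g n = Inr c \<longrightarrow> c \<in> C"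
    "\<forall>e. range e \<subseteq> C \<longrightarrow> Q (\<lambda>n. e (Suc n)) (e 0) = sat C (assign g e) \<phi>"
    using assms unfolding dpred_def by auto
  \<comment> \<open>Variables that \<open>g\<close> reads from position 0 are sent by
    \<open>f\<close> to the bound variable, so their entry \<open>Inl (0 - 1)\<close> in
    \<open>h\<close> is never consulted. All other positions move down by one.\<close>
  define h where "h n = (case g n of Inl i \<Rightarrow> Inl (i - 1) | Inr c \<Rightarrow> Inr c)" for n
  define f where "f n = (if g n = Inl 0 then 0 else Suc n)" for n
  have *: "case_nat x (assign h e) \<circ> f = assign g (case_nat x e)" for x e
    by (auto simp: fun_eq_iff assign_def h_def f_def split: nat.splits sum.splits)
  have "Q e x = sat C (case_nat x (assign h e)) (rename f \<phi>)" if "range e \<subseteq> C" "x \<in> C" for e x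
  proof -
    have "range (case_nat x e) \<subseteq> C" using that by (fastforce split: nat.splits)
    then show ?thesis using 1(2) by (auto simp: sat_rename * dest!: spec[of _ "case_nat x e"])
  qed
  moreover have "\<forall>n c. h n = Inr c \<longrightarrow> c \<in> C" using 1(1) by (auto simp: h_def split: sum.splits)
  ultimately show ?thesis
    unfolding dpred_def by (intro exI[of _ "Forall (rename f \<phi>)"] exI[of _ h]) auto
qed

lemma dpred_rename:
  assumes "dpred C R"
  shows "dpred C (\<lambda>e. R (\<lambda>n. e (f n)))"
proof -
  obtain \<phi> g where 1: "\<forall>n c. g n = Inr c \<longrightarrow> c \<in> C"
    "\<forall>e. range e \<subseteq> C \<longrightarrow> R e = sat C (assign g e) \<phi>"
    using assms unfolding dpred_def by auto
  define h where "h n = map_sum f id (g n)" for n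
  have "assign h e = assign g (\<lambda>n. e (f n))" for e
    by (auto simp: fun_eq_iff assign_def h_def split: sum.splits)
  moreover have "\<forall>n c. h n = Inr c \<longrightarrow> c \<in> C"
    using 1(1) by (metis h_def id_apply map_sum_sel(2) obj_sumE sum.sel(2) map_sum.simps sum.distinct(1))
  ultimately show ?thesis
    unfolding dpred_def using 1(2) by (intro exI[of _ \<phi>] exI[of _ h]) (auto simp: image_subset_iff)
qed

lemma dpred_disj: "dpred C R \<Longrightarrow> dpred C S \<Longrightarrow> dpred C (\<lambda>e. R e \<or> S e)"
  using dpred_not[OF dpred_conj[OF dpred_not[of C R] dpred_not[of C S]]] by simp

lemma dpred_imp: "dpred C R \<Longrightarrow> dpred C S \<Longrightarrow> dpred C (\<lambda>e. R e \<longrightarrow> S e)"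
  by (erule dpred_cong[OF dpred_disj[OF dpred_not]]) auto

lemma dpred_iff: "dpred C R \<Longrightarrow> dpred C S \<Longrightarrow> dpred C (\<lambda>e. R e \<longleftrightarrow> S e)"
  by (rule dpred_cong[OF dpred_conj[OF dpred_imp[of C R S] dpred_imp[of C S R]]]) auto

lemma dpred_ex: "dpred C (\<lambda>e. Q (\<lambda>n. e (Suc n)) (e 0)) \<Longrightarrow> dpred C (\<lambda>e. \<exists>x\<in>C. Q e x)"
  using dpred_not[OF dpred_all[OF dpred_not]] by fastforce

lemma dpred_subst:
  assumes "dpred C R" "dterm C t"
  shows "dpred C (\<lambda>e. R (case_nat (t e) e))"
proof -
  have *: "case_nat (e 0) (\<lambda>n. e (Suc n)) = e" for e :: "nat \<Rightarrow> 'a"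
    by (auto simp: fun_eq_iff split: nat.splits)
  have "dpred C (\<lambda>e. \<exists>y\<in>C. y = t e \<and> R (case_nat y e))"
    using assms by (intro dpred_ex dpred_conj) (simp_all add: dterm_def *)
  then show ?thesis by (rule dpred_cong) (use assms(2) in \<open>auto simp: dterm_def\<close>)
qed

lemma dterm_rename: "dterm C t \<Longrightarrow> dterm C (\<lambda>e. t (\<lambda>n. e (f n)))"
  unfolding dterm_def
  using dpred_rename[of C "\<lambda>e. e 0 = t (\<lambda>n. e (Suc n))" "case_nat 0 (Suc \<circ> f)"]
  by (auto simp: image_subset_iff)

lemma dpred_subst1: "dpred C (\<lambda>e. R (e 0)) \<Longrightarrow> dterm C t \<Longrightarrow> dpred C (\<lambda>e. R (t e))"
  using dpred_subst[of C "\<lambda>e. R (e 0)" t] by simp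

lemma dpred_subst2:
  assumes "dpred C (\<lambda>e. R (e 0) (e 1))" "dterm C s" "dterm C t"
  shows "dpred C (\<lambda>e. R (s e) (t e))"
proof -
  have "dpred C (\<lambda>e. R (e 1) (e 0))"
    using dpred_rename[OF assms(1), of "\<lambda>n. if n = 0 then 1 else 0"] by simp
  from dpred_subst[OF this dterm_rename[OF assms(3), of Suc]]
  have "dpred C (\<lambda>e. R (e 0) (t (\<lambda>n. e (Suc n))))" by simp
  from dpred_subst[OF this assms(2)] show ?thesis by simp
qed

lemma dpred_subst3:
  assumes "dpred C (\<lambda>e. R (e 0) (e 1) (e 2))" "dterm C r" "dterm C s" "dterm C t"
  shows "dpred C (\<lambda>e. R (r e) (s e) (t e))"
proof -
  have "dpred C (\<lambda>e. R (e 2) (e 1) (e 0))"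
    using dpred_rename[OF assms(1), of "\<lambda>n. if n = 0 then 2 else if n = 1 then 1 else 0"] by simp
  from dpred_subst[OF this dterm_rename[OF assms(4), of "\<lambda>n. Suc (Suc n)"]]
  have "dpred C (\<lambda>e. R (e 1) (e 0) (t (\<lambda>n. e (Suc (Suc n)))))" by (simp add: numeral_2_eq_2)
  from dpred_subst[OF this dterm_rename[OF assms(3), of Suc]]
  have "dpred C (\<lambda>e. R (e 0) (s (\<lambda>n. e (Suc n))) (t (\<lambda>n. e (Suc n))))" by simp
  from dpred_subst[OF this assms(2)] show ?thesis by simp
qed

lemma dterm_var: "dterm C (\<lambda>e. e i)"
  unfolding dterm_def dpred_def
  by (auto intro!: exI[of _ "Equal 0 (Suc i)"] exI[of _ Inl] simp: assign_def)

lemma dterm_const: "c \<in> C \<Longrightarrow> dterm C (\<lambda>e. c)"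
  unfolding dterm_def dpred_def
  by (auto intro!: exI[of _ "Equal 0 1"] exI[of _ "\<lambda>n. if n = 0 then Inl 0 else Inr c"]
      simp: assign_def split: if_splits)

lemma dpred_mem: "dterm C s \<Longrightarrow> dterm C t \<Longrightarrow> dpred C (\<lambda>e. s e \<epsilon> t e)"
proof (rule dpred_subst2)
  show "dpred C (\<lambda>e. e 0 \<epsilon> e 1)"
    unfolding dpred_def by (auto intro!: exI[of _ "Member 0 1"] exI[of _ Inl] simp: assign_def)
qed

lemma dpred_eq: "dterm C s \<Longrightarrow> dterm C t \<Longrightarrow> dpred C (\<lambda>e. s e = t e)"
proof (rule dpred_subst2)
  show "dpred C (\<lambda>e. e 0 = e 1)"
    unfolding dpred_def by (auto intro!: exI[of _ "Equal 0 1"] exI[of _ Inl] simp: assign_def)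
qed

lemma dterm_subst1:
  assumes F: "dterm C (\<lambda>e. F (e 0))" and t: "dterm C t"
  shows "dterm C (\<lambda>e. F (t e))"
proof -
  have m: "F x \<in> C" if "x \<in> C" for x
    using F that unfolding dterm_def by (auto dest!: spec[of _ "\<lambda>_. x"])
  have "dpred C (\<lambda>e. e 0 = F (t (\<lambda>n. e (Suc n))))"
    using F dpred_subst2[OF _ dterm_var[of C 0] dterm_rename[OF t, of Suc], of "\<lambda>x y. x = F y"]
    unfolding dterm_def by simp
  then show ?thesis using m t unfolding dterm_def by auto
qed

lemma dterm_subst2:
  assumes F: "dterm C (\<lambda>e. F (e 0) (e 1))" and s: "dterm C s" and t: "dterm C t"
  shows "dterm C (\<lambda>e. F (s e) (t e))"
proof -
  have m: "F x y \<in> C" if "x \<in> C" "y \<in> C" for x y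
  proof -
    have "range (case_nat x (\<lambda>_. y)) \<subseteq> C" using that by (fastforce split: nat.splits)
    then show ?thesis using F unfolding dterm_def by (auto dest!: spec[of _ "case_nat x (\<lambda>_. y)"])
  qed
  have "dpred C (\<lambda>e. e 0 = F (e 1) (e 2))"
    using F unfolding dterm_def by (simp add: numeral_2_eq_2)
  from dpred_rename[OF this, of "\<lambda>n. if n = 0 then 2 else if n = 1 then 0 else 1"]
  have "dpred C (\<lambda>e. e 2 = F (e 0) (e 1))" by simp
  from dpred_subst[OF this dterm_rename[OF s, of "\<lambda>n. Suc (Suc n)"]]
  have "dpred C (\<lambda>e. e 1 = F (s (\<lambda>n. e (Suc (Suc n)))) (e 0))" by simp
  from dpred_subst[OF this dterm_rename[OF t, of Suc]]
  have "dpred C (\<lambda>e. e 0 = F (s (\<lambda>n. e (Suc n))) (t (\<lambda>n. e (Suc n))))" by simp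
  then show ?thesis using m s t unfolding dterm_def by auto
qed

lemma dpred_ex1:
  assumes "dpred C (\<lambda>e. Q (\<lambda>n. e (Suc n)) (e 0))"
  shows "dpred C (\<lambda>e. \<exists>!x. x \<in> C \<and> Q e x)"
proof -
  have "dpred C (\<lambda>e. \<exists>x\<in>C. Q e x \<and> (\<forall>y\<in>C. Q e y \<longrightarrow> y = x))"
    using dpred_rename[OF assms, of "case_nat 0 (Suc \<circ> Suc)"]
    by (intro dpred_ex dpred_conj assms dpred_all dpred_imp dpred_eq dterm_var) simp
  then show ?thesis by (rule dpred_cong) blast
qed

section \<open>The axioms of ZFC as closure properties of HOL sets\<close>

locale zfc =
  fixes M :: "'u::set_universe set"
  assumes ZFC: "transitive_model_ZFC M"
begin

lemma ZFC_axioms: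
  shows "transitive_class M" "pairing_ax M" "union_ax M" "power_ax M" "infinity_ax M"
    "choice_ax M" "separation_ax M" "replacement_ax M"
  using ZFC unfolding transitive_model_ZFC_def by simp_all

end

sublocale zfc \<subseteq> fin_class M
proof
  show trans: "x \<in> M \<Longrightarrow> y \<epsilon> x \<Longrightarrow> y \<in> M" for x y
    using ZFC_axioms(1) unfolding transitive_class_def by blast
  show "\<exists>z\<in>M. elts z = {}"
    using ZFC_axioms(5) trans unfolding infinity_ax_def is_empty_def elts_def by blast
  fix a b assume a: "a \<in> M" and b: "b \<in> M"
  have up: "\<exists>z\<in>M. elts z = {x, y}" if xy: "x \<in> M" "y \<in> M" for x y
  proof -
    obtain z where "z \<in> M" "is_upair M x y z"
      using ZFC_axioms(2) xy unfolding pairing_ax_def by blast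
    then have "w \<epsilon> z \<longleftrightarrow> w = x \<or> w = y" for w
      using xy trans[of z w] unfolding is_upair_def by blast
    then have "elts z = {x, y}" by (simp add: set_eq_iff)
    then show ?thesis using \<open>z \<in> M\<close> by blast
  qed
  obtain s where s: "s \<in> M" "elts s = {b, b}" using up b by blast
  obtain p where p: "p \<in> M" "elts p = {a, s}" using up a s(1) by blast
  obtain u where u: "u \<in> M" "is_union M p u"
    using ZFC_axioms(3) p unfolding union_ax_def by blast
  have ps: "y \<epsilon> p \<longleftrightarrow> y = a \<or> y = s" "y \<epsilon> s \<longleftrightarrow> y = b" for y
    using p(2) s(2) by (auto simp: set_eq_iff)
  have "z \<epsilon> u \<longleftrightarrow> z = b \<or> z \<epsilon> a" for z
    using u(2) s(1) a b trans[OF u(1), of z] trans[OF a, of z] unfolding is_union_def ps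
    by (metis ps(2))
  then have "elts u = insert b (elts a)" by (simp add: set_eq_iff)
  then show "\<exists>c\<in>M. elts c = insert b (elts a)" using u by blast
qed

context zfc
begin

definition small :: "'u set \<Rightarrow> bool" where
  "small S \<longleftrightarrow> (\<exists>b\<in>M. elts b = S)"

lemma small_elts [simp]: "b \<in> M \<Longrightarrow> small (elts b)"
  by (auto simp: small_def)

lemma smallE: "small S \<Longrightarrow> (\<And>b. b \<in> M \<Longrightarrow> S = elts b \<Longrightarrow> thesis) \<Longrightarrow> thesis"
  by (auto simp: small_def)

lemma small_set_of: "small S \<Longrightarrow> set_of S \<in> M \<and> elts (set_of S) = S"
  by (auto elim: smallE)

lemma small_subset: "small S \<Longrightarrow> x \<in> S \<Longrightarrow> x \<in> M"
  using trans by (auto elim!: smallE)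

lemma small_finite: "finite S \<Longrightarrow> S \<subseteq> M \<Longrightarrow> small S"
  using ex_finite_set small_def by auto

lemma small_sep:
  assumes "small A" "dpred M (\<lambda>e. Q (e 0))"
  shows "small {x \<in> A. Q x}"
proof -
  obtain a where a: "a \<in> M" "A = elts a" using assms(1) by (rule smallE)
  obtain \<phi> g where g: "\<And>n c. g n = Inr c \<Longrightarrow> c \<in> M"
    "\<And>e. range e \<subseteq> M \<Longrightarrow> Q (e 0) = sat M (assign g e) \<phi>"
    using assms(2) unfolding dpred_def by auto
  \<comment> \<open>The formula may read positions other than 0. Since \<open>Q\<close> depends on
    position 0 alone, all of them may hold \<open>x\<close>. Parameters keep their own slots, and
    \<open>a\<close> is a mere filler for the rest.\<close>
  define f where "f n = (case g n of Inl _ \<Rightarrow> 0 | Inr _ \<Rightarrow> Suc n)" for n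
  define env where "env n = (case g n of Inl _ \<Rightarrow> a | Inr c \<Rightarrow> c)" for n
  have env: "env n \<in> M" for n using a g(1) by (auto simp: env_def split: sum.splits)
  have "\<forall>a\<in>M. \<exists>b\<in>M. \<forall>x\<in>M. x \<epsilon> b \<longleftrightarrow> x \<epsilon> a \<and> sat M (case_nat x env) (rename f \<phi>)"
    using ZFC_axioms(7)[unfolded separation_ax_def, THEN spec, THEN spec, of env "rename f \<phi>"] env by simp
  then obtain b where b: "b \<in> M" "\<And>x. x \<in> M \<Longrightarrow> x \<epsilon> b \<longleftrightarrow> x \<epsilon> a \<and> sat M (case_nat x env) (rename f \<phi>)"
    using a(1) by blast
  have "case_nat x env \<circ> f = assign g (\<lambda>_. x)" for x
    by (auto simp: fun_eq_iff f_def env_def assign_def split: sum.splits nat.splits)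
  then have "x \<epsilon> b \<longleftrightarrow> x \<epsilon> a \<and> Q x" if "x \<in> M" for x
    using b(2)[OF that] g(2)[of "\<lambda>_. x"] that by (simp add: sat_rename)
  then have "x \<epsilon> b \<longleftrightarrow> x \<epsilon> a \<and> Q x" for x using trans[OF a(1), of x] trans[OF b(1), of x] by blast
  then have "elts b = {x \<in> A. Q x}" by (simp add: a set_eq_iff)
  then show ?thesis using b(1) by (auto simp: small_def)
qed

lemma small_replace:
  assumes "small A" "dpred M (\<lambda>e. R (e 0) (e 1))" "\<And>x. x \<in> A \<Longrightarrow> \<exists>!y. y \<in> M \<and> R x y"
  shows "small {y \<in> M. \<exists>x\<in>A. R x y}"
proof -
  obtain a where a: "a \<in> M" "A = elts a" using assms(1) by (rule smallE)
  obtain \<phi> g where g: "\<And>n c. g n = Inr c \<Longrightarrow> c \<in> M"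
    "\<And>e. range e \<subseteq> M \<Longrightarrow> R (e 0) (e 1) = sat M (assign g e) \<phi>"
    using assms(2) unfolding dpred_def by auto
  define f where "f n = (case g n of Inl i \<Rightarrow> if i = 0 then 0 else Suc 0 | Inr _ \<Rightarrow> Suc (Suc n))" for n
  define env where "env n = (case g n of Inl _ \<Rightarrow> a | Inr c \<Rightarrow> c)" for n
  have env: "env n \<in> M" for n using a g(1) by (auto simp: env_def split: sum.splits)
  have "case_nat x (case_nat y env) \<circ> f = assign g (case_nat x (\<lambda>_. y))" for x y
    by (auto simp: fun_eq_iff f_def env_def assign_def split: sum.splits nat.splits)
  moreover have "range (case_nat x (\<lambda>_. y)) \<subseteq> M" if "x \<in> M" "y \<in> M" for x y
    using that by (auto split: nat.splits)
  ultimately have R: "sat M (case_nat x (case_nat y env)) (rename f \<phi>) = R x y" if "x \<in> M" "y \<in> M" for x y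
    using g(2)[of "case_nat x (\<lambda>_. y)"] that by (simp add: sat_rename)
  have "\<exists>!y. y \<in> M \<and> sat M (case_nat x (case_nat y env)) (rename f \<phi>)" if "x \<in> M" "x \<epsilon> a" for x
    using assms(3)[of x] R[OF that(1)] that a by (metis in_elts)
  then have "\<exists>b\<in>M. \<forall>y\<in>M. y \<epsilon> b \<longleftrightarrow>
           (\<exists>x\<in>M. x \<epsilon> a \<and> sat M (case_nat x (case_nat y env)) (rename f \<phi>))"
    using ZFC_axioms(8)[unfolded replacement_ax_def, THEN spec, THEN spec, of env "rename f \<phi>"] env a(1)
    by simp
  then obtain b where b: "b \<in> M" "\<And>y. y \<in> M \<Longrightarrow> y \<epsilon> b \<longleftrightarrow>
           (\<exists>x\<in>M. x \<epsilon> a \<and> sat M (case_nat x (case_nat y env)) (rename f \<phi>))"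
    by blast
  have "x \<epsilon> a \<Longrightarrow> x \<in> M" "x \<epsilon> b \<Longrightarrow> x \<in> M" for x using trans a(1) b(1) by blast+
  then have "y \<epsilon> b \<longleftrightarrow> y \<in> M \<and> (\<exists>x. x \<epsilon> a \<and> R x y)" for y using b(2)[of y] R[of _ y] by blast
  then have "elts b = {y \<in> M. \<exists>x\<in>A. R x y}" by (simp add: a set_eq_iff Bex_def)
  then show ?thesis using b(1) by (auto simp: small_def)
qed

lemma small_image:
  assumes "small A" "dterm M (\<lambda>e. F (e 0))"
  shows "small (F ` A)"
proof -
  have m: "F x \<in> M" if "x \<in> M" for x
    using assms(2) that unfolding dterm_def by (auto dest!: spec[of _ "\<lambda>_. x"])
  have "dpred M (\<lambda>e. e 1 = F (e 0))"
    by (intro dpred_eq dterm_var dterm_subst1[OF assms(2)])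
  from small_replace[OF assms(1) this] have "small {y \<in> M. \<exists>x\<in>A. y = F x}"
    using m small_subset[OF assms(1)] by auto
  moreover have "{y \<in> M. \<exists>x\<in>A. y = F x} = F ` A"
    using m small_subset[OF assms(1)] by auto
  ultimately show ?thesis by simp
qed

lemma small_Union: "small A \<Longrightarrow> small (\<Union>x\<in>A. elts x)"
proof (erule smallE)
  fix a assume a: "a \<in> M" "A = elts a"
  then obtain u where u: "u \<in> M" "is_union M a u"
    using ZFC_axioms(3) unfolding union_ax_def by blast
  then show ?thesis using a is_union_iff[OF a(1) elts_subset[OF u(1)]] by (auto simp: small_def)
qed

lemma small_Pow: "small A \<Longrightarrow> small {b \<in> M. elts b \<subseteq> A}"
proof (erule smallE)
  fix a assume a: "a \<in> M" "A = elts a"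
  then obtain u where u: "u \<in> M" "is_power M a u"
    using ZFC_axioms(4) unfolding power_ax_def by blast
  have "elts u = {b \<in> M. elts b \<subseteq> A}"
    using u a trans[OF u(1)] by (auto simp: is_power_def subset_in_iff)
  then show ?thesis using u by (auto simp: small_def)
qed

lemma small_Un: "small A \<Longrightarrow> small B \<Longrightarrow> small (A \<union> B)"
proof -
  assume ab: "small A" "small B"
  then have "small {set_of A, set_of B}" using small_set_of by (intro small_finite) auto
  from small_Union[OF this] ab show ?thesis by (simp add: small_set_of)
qed

lemma dpred_in: "small S \<Longrightarrow> dterm M t \<Longrightarrow> dpred M (\<lambda>e. t e \<in> S)"
proof (erule smallE)
  fix b assume "dterm M t" "b \<in> M" "S = elts b"
  then show ?thesis using dpred_mem[of M t "\<lambda>_. b"] dterm_const[of b M] by simp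
qed

lemma dpred_all_elts:
  assumes "dterm M t" "dpred M (\<lambda>e. Q (\<lambda>n. e (Suc n)) (e 0))"
  shows "dpred M (\<lambda>e. \<forall>x\<in>elts (t e). Q e x)"
proof -
  have "dpred M (\<lambda>e. \<forall>x\<in>M. x \<epsilon> t e \<longrightarrow> Q e x)"
    by (intro dpred_all dpred_imp dpred_mem[OF dterm_var dterm_rename[OF assms(1), of Suc]] assms(2))
  then show ?thesis
  proof (rule dpred_cong)
    fix e :: "nat \<Rightarrow> 'u" assume "range e \<subseteq> M"
    then have "t e \<in> M" using assms(1) by (auto simp: dterm_def)
    then show "(\<forall>x\<in>elts (t e). Q e x) = (\<forall>x\<in>M. x \<epsilon> t e \<longrightarrow> Q e x)"
      using trans[of "t e"] by auto
  qed
qed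

lemma dpred_ex_elts:
  assumes "dterm M t" "dpred M (\<lambda>e. Q (\<lambda>n. e (Suc n)) (e 0))"
  shows "dpred M (\<lambda>e. \<exists>x\<in>elts (t e). Q e x)"
  using dpred_not[OF dpred_all_elts[OF assms(1) dpred_not[OF assms(2)]]] by simp

lemma dpred_all_small:
  assumes "small S" "dpred M (\<lambda>e. Q (\<lambda>n. e (Suc n)) (e 0))"
  shows "dpred M (\<lambda>e. \<forall>x\<in>S. Q e x)"
  using assms dpred_all_elts[OF dterm_const] by (auto elim!: smallE)

lemma dpred_ex_small:
  assumes "small S" "dpred M (\<lambda>e. Q (\<lambda>n. e (Suc n)) (e 0))"
  shows "dpred M (\<lambda>e. \<exists>x\<in>S. Q e x)"
  using assms dpred_ex_elts[OF dterm_const] by (auto elim!: smallE)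

lemma dpred_subset:
  assumes "dterm M s" "dterm M t"
  shows "dpred M (\<lambda>e. elts (s e) \<subseteq> elts (t e))"
  unfolding subset_iff Ball_def[symmetric]
  using dpred_all_elts[OF assms(1) dpred_mem[OF dterm_var[of M 0] dterm_rename[OF assms(2), of Suc]]]
  by (rule dpred_cong) auto

lemma dterm_pair:
  assumes "dterm M s" "dterm M t"
  shows "dterm M (\<lambda>e. pair (s e) (t e))"
proof -
  have "dpred M (\<lambda>e. is_pair M (e 1) (e 2) (e 0))"
    unfolding is_pair_def is_upair_def
    by (intro dpred_ex dpred_all dpred_conj dpred_iff dpred_disj dpred_eq dpred_mem dterm_var)
  then have "dpred M (\<lambda>e. e 0 = pair (e 1) (e 2))"
    by (rule dpred_cong) (simp add: is_pair_iff image_subset_iff)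
  then have "dterm M (\<lambda>e. pair (e 0) (e 1))"
    by (auto simp: dterm_def image_subset_iff numeral_2_eq_2)
  then show ?thesis by (rule dterm_subst2) fact+
qed

text \<open>Smallness gives \<open>set_of\<close> its meaning; extensionality then turns the graph
  into the first-order statement that two sets have the same elements. Set-valued functions such as
  \<open>adjoin\<close> and the closure step for coordinates are introduced in this way.\<close>

lemma dterm_Collect:
  assumes "\<And>e. range e \<subseteq> M \<Longrightarrow> small {x \<in> M. Q e x}"
    and "dpred M (\<lambda>e. Q (\<lambda>n. e (Suc n)) (e 0))"
  shows "dterm M (\<lambda>e. set_of {x \<in> M. Q e x})"
proof -
  have "dpred M (\<lambda>e. \<forall>x\<in>M. x \<epsilon> e 0 \<longleftrightarrow> Q (\<lambda>n. e (Suc n)) x)"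
    using dpred_rename[OF assms(2), of "case_nat 0 (\<lambda>n. Suc (Suc n))"]
    by (intro dpred_all dpred_iff dpred_mem dterm_var) simp
  then have "dpred M (\<lambda>e. e 0 = set_of {x \<in> M. Q (\<lambda>n. e (Suc n)) x})"
  proof (rule dpred_cong)
    fix e :: "nat \<Rightarrow> 'u" assume e: "range e \<subseteq> M"
    then have "range (\<lambda>n. e (Suc n)) \<subseteq> M" by auto
    then have "elts (set_of {x \<in> M. Q (\<lambda>n. e (Suc n)) x}) = {x \<in> M. Q (\<lambda>n. e (Suc n)) x}"
      using small_set_of[OF assms(1)] by auto
    moreover have "x \<epsilon> e 0 \<Longrightarrow> x \<in> M" for x using e trans by blast
    ultimately show "e 0 = set_of {x \<in> M. Q (\<lambda>n. e (Suc n)) x} \<longleftrightarrow>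
        (\<forall>x\<in>M. x \<epsilon> e 0 \<longleftrightarrow> Q (\<lambda>n. e (Suc n)) x)"
      unfolding elts_inject[symmetric] by auto
  qed
  then show ?thesis unfolding dterm_def using small_set_of[OF assms(1)] by auto
qed

text \<open>HOL finiteness is not first-order as it stands, but on \<open>M\<close> it agrees with
  the relativised \<open>is_finite\<close>, which is.\<close>

lemma dpred_finite: "dterm M t \<Longrightarrow> dpred M (\<lambda>e. finite (elts (t e)))"
proof (rule dpred_subst1)
  have "dpred M (\<lambda>e. is_finite M (e 0))"
    unfolding is_finite_def is_natural_def is_bijection_def is_ordinal_def is_transitive_def
      subset_in_def maps_to_def is_succ_def is_empty_def is_pair_def is_upair_def
    by (intro dpred_ex dpred_all dpred_conj dpred_iff dpred_disj dpred_imp dpred_not dpred_ex1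
         dpred_eq dpred_mem dterm_var)
  then show "dpred M (\<lambda>e. finite (elts (e 0)))"
    by (rule dpred_cong) (simp add: is_finite_iff image_subset_iff)
qed

lemmas dintros = dpred_ex_elts dpred_all_elts dpred_ex_small dpred_all_small dpred_ex dpred_all
  dpred_finite dpred_subset dpred_in dpred_mem dpred_eq
  dpred_conj dpred_disj dpred_imp dpred_iff dpred_not dterm_pair dterm_var dterm_const

definition product :: "'u set \<Rightarrow> 'u set \<Rightarrow> 'u set" where
  "product A B = {pair x y |x y. x \<in> A \<and> y \<in> B}"

lemma small_product:
  assumes "small A" "small B"
  shows "small (product A B)"
proof -
  have "small {b \<in> M. elts b \<subseteq> {b \<in> M. elts b \<subseteq> A \<union> B}}" (is "small ?P")
    using assms by (intro small_Pow small_Un)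
  then have "small {z \<in> ?P. \<exists>x\<in>A. \<exists>y\<in>B. z = pair x y}"
    by (rule small_sep) (intro dintros assms)
  moreover have "pair x y \<in> ?P" if "x \<in> A" "y \<in> B" for x y
  proof -
    have "x \<in> M" "y \<in> M" using that assms small_subset by auto
    then show ?thesis using that by (auto simp: elts_pair finite_set_of)
  qed
  then have "{z \<in> ?P. \<exists>x\<in>A. \<exists>y\<in>B. z = pair x y} = product A B"
    unfolding product_def by blast
  ultimately show ?thesis by simp
qed

end

declare num.simps [simp del]

context zfc
begin

lemma dterm_closed: "dterm M (\<lambda>e. F (e 0)) \<Longrightarrow> x \<in> M \<Longrightarrow> F x \<in> M"
  unfolding dterm_def by (auto dest!: spec[of _ "\<lambda>_. x"])

lemma dterm1I: "(\<And>x. x \<in> M \<Longrightarrow> F x \<in> M) \<Longrightarrow> dpred M (\<lambda>e. e 0 = F (e 1)) \<Longrightarrow> dterm M (\<lambda>e. F (e 0))"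
  unfolding dterm_def by auto

lemma dterm2_closed:
  assumes "dterm M (\<lambda>e. F (e 0) (e 1))" "x \<in> M" "y \<in> M"
  shows "F x y \<in> M"
proof -
  have "range (case_nat x (\<lambda>_. y)) \<subseteq> M" using assms by (fastforce split: nat.splits)
  then show ?thesis using assms(1) unfolding dterm_def by (auto dest!: spec[of _ "case_nat x (\<lambda>_. y)"])
qed

subsection \<open>Choice and recursion\<close>

text \<open>The axiom of choice is stated for disjoint families, so the candidates for
  \<open>x\<close> are tagged as the pairs \<open>(x, y)\<close>. Outside \<open>A\<close> the
  function takes the default \<open>num 0\<close>, which makes it total and definable on
  \<open>M\<close>.\<close>

lemma small_choice:
  assumes A: "small A" and B: "small B" and R: "dpred M (\<lambda>e. R (e 0) (e 1))"
    and ex: "\<And>x. x \<in> A \<Longrightarrow> \<exists>y\<in>B. R x y"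
  obtains F where "\<And>x. x \<in> A \<Longrightarrow> F x \<in> B \<and> R x (F x)" "dterm M (\<lambda>e. F (e 0))"
proof -
  define c where "c x = set_of {z \<in> M. \<exists>y\<in>B. R x y \<and> z = pair x y}" for x
  have Rst: "dterm M s \<Longrightarrow> dterm M t \<Longrightarrow> dpred M (\<lambda>e. R (s e) (t e))" for s t
    using dpred_subst2[OF R] .
  have AM: "x \<in> M" if "x \<in> A" for x using small_subset[OF A that] .
  have BM: "y \<in> M" if "y \<in> B" for y using small_subset[OF B that] .
  have sc: "small {z \<in> M. \<exists>y\<in>B. R x y \<and> z = pair x y}" if "x \<in> M" for x
  proof -
    have "small {z \<in> product {x} B. \<exists>y\<in>B. R x y \<and> z = pair x y}"
      using that by (intro small_sep small_product small_finite B dintros Rst) auto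
    moreover have "{z \<in> product {x} B. \<exists>y\<in>B. R x y \<and> z = pair x y} = {z \<in> M. \<exists>y\<in>B. R x y \<and> z = pair x y}"
      unfolding product_def using that BM by auto
    ultimately show ?thesis by simp
  qed
  have "dterm M (\<lambda>e. set_of {z \<in> M. \<exists>y\<in>B. R (e 0) y \<and> z = pair (e 0) y})"
    by (intro dterm_Collect sc dintros B Rst) auto
  then have "small (c ` A)" unfolding c_def[symmetric] by (rule small_image[OF A])
  then obtain a where a: "a \<in> M" "c ` A = elts a" by (rule smallE)
  have ec: "z \<epsilon> c x \<longleftrightarrow> (\<exists>y\<in>B. R x y \<and> z = pair x y)" if "x \<in> A" for x z
  proof -
    have "elts (c x) = {z \<in> M. \<exists>y\<in>B. R x y \<and> z = pair x y}"
      unfolding c_def using small_set_of[OF sc[OF AM[OF that]]] by simp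
    then show ?thesis using AM[OF that] BM by (auto simp: set_eq_iff)
  qed
  have ea: "u \<epsilon> a \<longleftrightarrow> (\<exists>x\<in>A. u = c x)" for u using a(2) by (auto simp: set_eq_iff)
  have cM: "c x \<in> M" if "x \<in> A" for x using that ea trans[OF a(1)] by blast
  have 1: "\<forall>u\<in>M. u \<epsilon> a \<longrightarrow> \<not> is_empty M u"
    using ex AM BM unfolding is_empty_def ea by (auto simp: ec) (metis pair_closed)
  have 2: "\<forall>u\<in>M. \<forall>v\<in>M. u \<epsilon> a \<and> v \<epsilon> a \<and> u \<noteq> v \<longrightarrow> \<not> (\<exists>z\<in>M. z \<epsilon> u \<and> z \<epsilon> v)"
    unfolding ea using AM BM by (auto simp: ec pair_inject)
  obtain d where d: "d \<in> M" "\<And>u. u \<in> M \<Longrightarrow> u \<epsilon> a \<Longrightarrow> \<exists>!y. y \<in> M \<and> y \<epsilon> u \<and> y \<epsilon> d"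
    using ZFC_axioms(6)[unfolded choice_ax_def, THEN bspec, OF a(1)] 1 2 by blast
  have uniq: "\<exists>!y. y \<in> B \<and> R x y \<and> pair x y \<epsilon> d" if x: "x \<in> A" for x
  proof -
    obtain w where w: "w \<epsilon> c x" "w \<epsilon> d" "\<And>w'. w' \<in> M \<Longrightarrow> w' \<epsilon> c x \<Longrightarrow> w' \<epsilon> d \<Longrightarrow> w' = w"
      using d(2)[OF cM[OF x]] x ea by blast
    then obtain y where y: "y \<in> B" "R x y" "w = pair x y" by (auto simp: ec x)
    show ?thesis
    proof (rule ex1I[of _ y])
      fix y' assume y': "y' \<in> B \<and> R x y' \<and> pair x y' \<epsilon> d"
      then have "pair x y' = pair x y" using w(3)[of "pair x y'"] y AM[OF x] BM by (auto simp: ec x)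
      then show "y' = y" using y' y AM[OF x] BM by (simp add: pair_inject)
    qed (use y w in auto)
  qed
  define F where "F x = (if x \<in> A then THE y. y \<in> B \<and> R x y \<and> pair x y \<epsilon> d else num 0)" for x
  have F: "F x \<in> B \<and> R x (F x) \<and> pair x (F x) \<epsilon> d" if "x \<in> A" for x
    using theI'[OF uniq[OF that]] that by (simp add: F_def)
  have "dpred M (\<lambda>e. (e 1 \<in> A \<and> e 0 \<in> B \<and> R (e 1) (e 0) \<and> pair (e 1) (e 0) \<epsilon> d) \<or> (e 1 \<notin> A \<and> e 0 = num 0))"
    by (intro dintros Rst A B d(1) num_closed)
  then have "dpred M (\<lambda>e. e 0 = F (e 1))"
  proof (rule dpred_cong)
    have "y = F x \<longleftrightarrow> (x \<in> A \<and> y \<in> B \<and> R x y \<and> pair x y \<epsilon> d) \<or> (x \<notin> A \<and> y = num 0)" for x y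
    proof (cases "x \<in> A")
      case True
      then show ?thesis using F[OF True] uniq[OF True] by blast
    qed (simp add: F_def)
    then show "e 0 = F (e 1) \<longleftrightarrow> (e 1 \<in> A \<and> e 0 \<in> B \<and> R (e 1) (e 0) \<and> pair (e 1) (e 0) \<epsilon> d) \<or>
        (e 1 \<notin> A \<and> e 0 = num 0)" for e :: "nat \<Rightarrow> 'u" .
  qed
  moreover have "F x \<in> M" if "x \<in> M" for x
    using F[of x] BM by (cases "x \<in> A") (auto simp: F_def)
  ultimately have "dterm M (\<lambda>e. F (e 0))" by (intro dterm1I)
  then show thesis using F that by blast
qed

definition omega :: "'u set" where
  "omega = range num"

lemma num_in_omega [simp]: "num n \<in> omega"
  by (simp add: omega_def)

lemma omegaE: "x \<in> omega \<Longrightarrow> (\<And>n. x = num n \<Longrightarrow> thesis) \<Longrightarrow> thesis"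
  by (auto simp: omega_def)

text \<open>Written as a comprehension over \<open>M\<close> so that \<open>dterm_Collect\<close>
  applies. The successor of a natural \<open>n\<close> is \<open>adjoin n n\<close>.\<close>

definition adjoin :: "'u \<Rightarrow> 'u \<Rightarrow> 'u" where
  "adjoin x y = set_of {w \<in> M. w \<epsilon> x \<or> w = y}"

lemma adjoin: "x \<in> M \<Longrightarrow> y \<in> M \<Longrightarrow> adjoin x y \<in> M \<and> elts (adjoin x y) = insert y (elts x)"
proof -
  assume xy: "x \<in> M" "y \<in> M"
  then obtain c where "c \<in> M" "elts c = insert y (elts x)" using ex_insert by blast
  moreover have "{w \<in> M. w \<epsilon> x \<or> w = y} = insert y (elts x)" using trans[OF xy(1)] xy by auto
  ultimately show ?thesis unfolding adjoin_def by (metis set_of_elts)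
qed

lemma dterm_adjoin:
  assumes "dterm M s" "dterm M t"
  shows "dterm M (\<lambda>e. adjoin (s e) (t e))"
proof (rule dterm_subst2[of M adjoin])
  show "dterm M (\<lambda>e. adjoin (e 0) (e 1))"
  proof (unfold adjoin_def, rule dterm_Collect)
    fix e :: "nat \<Rightarrow> 'u" assume "range e \<subseteq> M"
    then have xy: "e 0 \<in> M" "e 1 \<in> M" by auto
    then have "elts (adjoin (e 0) (e 1)) = {w \<in> M. w \<epsilon> e 0 \<or> w = e 1}"
      using trans[OF xy(1)] by (auto simp: adjoin simp del: in_elts) (simp_all add: trans)
    then show "small {w \<in> M. w \<epsilon> e 0 \<or> w = e 1}" using adjoin[OF xy] small_elts by metis
  next
    show "dpred M (\<lambda>e. e 0 \<epsilon> e (Suc 0) \<or> e 0 = e (Suc 1))" by (intro dintros)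
  qed
qed fact+

lemma adjoin_num [simp]: "adjoin (num n) (num n) = (num (Suc n) :: 'u)"
proof -
  have "elts (adjoin (num n) (num n)) = elts (num (Suc n) :: 'u)"
    by (simp add: adjoin elts_num lessThan_Suc)
  then show ?thesis by simp
qed

lemma small_omega: "small omega"
proof -
  obtain a where a: "a \<in> M" "\<exists>x\<in>M. is_empty M x \<and> x \<epsilon> a"
      "\<And>x. x \<in> M \<Longrightarrow> x \<epsilon> a \<Longrightarrow> \<exists>y\<in>M. is_succ M x y \<and> y \<epsilon> a"
    using ZFC_axioms(5) unfolding infinity_ax_def by blast
  have "num n \<epsilon> a" for n
  proof (induction n)
    case 0
    obtain x where x: "x \<in> M" "is_empty M x" "x \<epsilon> a" using a(2) by blast
    then have "elts x = elts (num 0)" by (simp add: is_empty_iff elts_num)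
    then show ?case using x by simp
  next
    case (Suc n)
    then obtain y where "y \<in> M" "is_succ M (num n) y" "y \<epsilon> a" using a(3) num_closed by blast
    then show ?case by (metis elts_inject adjoin is_succ_iff num_closed adjoin_num)
  qed
  then have "omega = {x \<in> elts a. is_natural M x}"
    using trans[OF a(1)] is_natural_iff by (auto simp: omega_def)
  moreover have "small {x \<in> elts a. is_natural M x}"
    using a(1) unfolding is_natural_def is_ordinal_def is_transitive_def
      subset_in_def is_succ_def is_empty_def
    by (intro small_sep small_elts dintros)
  ultimately show ?thesis by simp
qed

text \<open>
  The graph of the recursion is definable because a pair \<open>(n, y)\<close> belongs to it iff it belongs to
  every set closed under the first \<open>n\<close> recursion steps; the finite approximation is such a set.
\<close>

lemma omega_recursion:
  assumes y0: "y0 \<in> M" and H: "dterm M (\<lambda>e. H (e 0) (e 1))"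
  obtains F where "F (num 0) = y0" "\<And>n. F (num (Suc n)) = H (num n) (F (num n))"
    "dterm M (\<lambda>e. F (e 0))"
proof -
  have Hst: "dterm M s \<Longrightarrow> dterm M t \<Longrightarrow> dterm M (\<lambda>e. H (s e) (t e))" for s t
    using dterm_subst2[OF H] .
  \<comment> \<open>The recursion is first carried out in HOL; \<open>graph\<close> below shows that
    \<open>M\<close> defines the same function.\<close>
  define f where "f = rec_nat y0 (\<lambda>n. H (num n))"
  have fM: "f n \<in> M" for n
    by (induction n) (simp_all add: f_def y0 dterm2_closed[OF H])
  define F where "F x = (if x \<in> omega then f (THE n. x = num n) else num 0)" for x
  have F: "F (num n) = f n" for n by (simp add: F_def)
  define closed where "closed g x \<longleftrightarrow> pair (num 0) y0 \<epsilon> g \<and>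
    (\<forall>k\<in>elts x. \<forall>z\<in>M. pair k z \<epsilon> g \<longrightarrow> pair (adjoin k k) (H k z) \<epsilon> g)" for g x
  have graph: "(\<forall>g\<in>M. closed g (num n) \<longrightarrow> pair (num n) y \<epsilon> g) \<longleftrightarrow> y = f n" if "y \<in> M" for n y
  proof
    assume *: "\<forall>g\<in>M. closed g (num n) \<longrightarrow> pair (num n) y \<epsilon> g"
    have "(\<lambda>k. pair (num k) (f k)) ` {..n} \<subseteq> M" using fM by auto
    then obtain g where g: "g \<in> M" "elts g = (\<lambda>k. pair (num k) (f k)) ` {..n}"
      using ex_finite_set[of "(\<lambda>k. pair (num k) (f k)) ` {..n}"] by blast
    have gi: "w \<epsilon> g \<longleftrightarrow> (\<exists>k\<le>n. w = pair (num k) (f k))" for w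
      using g(2) by (auto simp: set_eq_iff)
    have "closed g (num n)"
      unfolding closed_def
    proof (intro conjI ballI impI)
      show "pair (num 0) y0 \<epsilon> g" unfolding gi by (intro exI[of _ 0]) (simp add: f_def)
      fix k z assume k: "k \<in> elts (num n)" "z \<in> M" "pair k z \<epsilon> g"
      then obtain m where m: "k = num m" "m < n" by (auto simp: elts_num)
      then have "z = f m" using k fM unfolding gi by (auto simp: pair_inject)
      then show "pair (adjoin k k) (H k z) \<epsilon> g"
        unfolding gi using m by (intro exI[of _ "Suc m"]) (simp add: f_def)
    qed
    then have "pair (num n) y \<epsilon> g" using * g by blast
    then show "y = f n" using that fM unfolding gi by (auto simp: pair_inject)
  next
    assume y: "y = f n"
    have "pair (num m) (f m) \<epsilon> g" if "closed g (num n)" "m \<le> n" for g m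
      using that(2)
    proof (induction m)
      case 0
      then show ?case using that(1) by (simp add: closed_def f_def)
    next
      case (Suc m)
      then have "pair (adjoin (num m) (num m)) (H (num m) (f m)) \<epsilon> g"
        using that(1) fM unfolding closed_def by (simp add: elts_num)
      then show ?case by (simp add: f_def)
    qed
    then show "\<forall>g\<in>M. closed g (num n) \<longrightarrow> pair (num n) y \<epsilon> g" using y by blast
  qed
  have "dpred M (\<lambda>e. (e 1 \<in> omega \<and> (\<forall>g\<in>M. closed g (e 1) \<longrightarrow> pair (e 1) (e 0) \<epsilon> g)) \<or>
      (e 1 \<notin> omega \<and> e 0 = num 0))"
    unfolding closed_def by (intro dintros Hst dterm_adjoin small_omega y0 num_closed)
  then have "dpred M (\<lambda>e. e 0 = F (e 1))"
  proof (rule dpred_cong)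
    fix e :: "nat \<Rightarrow> 'u" assume "range e \<subseteq> M"
    then have "e 0 \<in> M" by auto
    then show "e 0 = F (e 1) \<longleftrightarrow> (e 1 \<in> omega \<and> (\<forall>g\<in>M. closed g (e 1) \<longrightarrow> pair (e 1) (e 0) \<epsilon> g)) \<or>
      (e 1 \<notin> omega \<and> e 0 = num 0)"
    proof (cases "e 1 \<in> omega")
      case True
      then obtain n where n: "e 1 = num n" by (rule omegaE)
      show ?thesis unfolding n graph[OF \<open>e 0 \<in> M\<close>] F by simp
    qed (simp add: F_def)
  qed
  moreover have "F x \<in> M" for x using fM by (simp add: F_def)
  ultimately have "dterm M (\<lambda>e. F (e 0))" by (intro dterm1I)
  then show thesis using that[of F] F by (simp add: f_def)
qed

subsection \<open>Transitive sets and check names\<close>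

text \<open>Transitive closures exist by membership induction, replacement collecting the closures
  of the elements. Minimality is built into \<open>tcl\<close> to make the closure unique, as
  replacement requires. Adjoining \<open>x\<close> to its closure gives the set sought.\<close>

lemma ex_transitive_set:
  assumes "x \<in> M"
  obtains c where "c \<in> M" "x \<epsilon> c" "\<And>y. y \<epsilon> c \<Longrightarrow> elts y \<subseteq> elts c"
proof -
  define tcl where "tcl x c \<longleftrightarrow> elts x \<subseteq> elts c \<and> (\<forall>y\<in>elts c. elts y \<subseteq> elts c) \<and>
    (\<forall>d\<in>M. elts x \<subseteq> elts d \<and> (\<forall>y\<in>elts d. elts y \<subseteq> elts d) \<longrightarrow> elts c \<subseteq> elts d)" for x c
  have tcl_unique: "c = d" if "tcl x c" "tcl x d" "c \<in> M" "d \<in> M" for x c d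
    using that unfolding tcl_def elts_inject[symmetric] by blast
  have "\<exists>c\<in>M. tcl x c" if "x \<in> M" for x
    using that
  proof (induction x rule: eps_induct)
    case (step x)
    have yM: "y \<in> M" if "y \<epsilon> x" for y using trans step.prems that by blast
    have 1: "dpred M (\<lambda>e. tcl (e 0) (e 1))" unfolding tcl_def by (intro dintros)
    have "\<exists>!c. c \<in> M \<and> tcl y c" if "y \<in> elts x" for y
      using step.IH[of y] yM[of y] that tcl_unique by (metis in_elts)
    from small_replace[OF small_elts[OF step.prems] 1 this]
    have "small {c \<in> M. \<exists>y\<in>elts x. tcl y c}" .
    from small_Un[OF small_elts[OF step.prems] small_Union[OF this]]
    obtain d where d: "d \<in> M" "elts d = elts x \<union> (\<Union>c\<in>{c \<in> M. \<exists>y\<in>elts x. tcl y c}. elts c)"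
      unfolding small_def by blast
    have di: "z \<epsilon> d \<longleftrightarrow> z \<epsilon> x \<or> (\<exists>c\<in>M. \<exists>y. y \<epsilon> x \<and> tcl y c \<and> z \<epsilon> c)" for z
      unfolding in_elts[symmetric, of z d] d(2) by (simp add: Bex_def) blast
    have "tcl x d"
      unfolding tcl_def
    proof (intro conjI ballI impI)
      show "elts x \<subseteq> elts d" using d by auto
      fix z assume "z \<in> elts d"
      then consider "z \<epsilon> x" | c y where "c \<in> M" "y \<epsilon> x" "tcl y c" "z \<epsilon> c" using di by auto
      then show "elts z \<subseteq> elts d"
      proof cases
        case 1
        then obtain c where c: "c \<in> M" "tcl z c" using step.IH yM by blast
        then have "elts z \<subseteq> elts c" by (simp only: tcl_def)
        moreover have "elts c \<subseteq> elts d" using 1 c di by auto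
        ultimately show ?thesis by blast
      next
        case 2
        then have "elts z \<subseteq> elts c" unfolding tcl_def by simp
        moreover have "elts c \<subseteq> elts d" using 2 di by auto
        ultimately show ?thesis by blast
      qed
    next
      fix b assume b: "b \<in> M" "elts x \<subseteq> elts b \<and> (\<forall>y\<in>elts b. elts y \<subseteq> elts b)"
      have "elts c \<subseteq> elts b" if "c \<in> M" "y \<epsilon> x" "tcl y c" for c y
        using that b unfolding tcl_def by (meson in_elts subsetD)
      then have "(\<Union>c\<in>{c \<in> M. \<exists>y\<in>elts x. tcl y c}. elts c) \<subseteq> elts b"
        by (intro UN_least) (simp add: Bex_def, blast)
      then show "elts d \<subseteq> elts b" using b(2) unfolding d(2) by simp
    qed
    then show ?case using d by blast
  qed
  then obtain c where c: "c \<in> M" "tcl x c" using assms by blast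
  have cx: "elts x \<subseteq> elts c" "\<And>y. y \<in> elts c \<Longrightarrow> elts y \<subseteq> elts c"
    using c(2) unfolding tcl_def by simp_all
  obtain c' where c': "c' \<in> M" "elts c' = insert x (elts c)" using ex_insert[OF c(1) assms] by blast
  then show thesis
  proof (intro that[of c'])
    show "x \<epsilon> c'" unfolding in_elts[symmetric, of x c'] c'(2) by simp
    fix y assume "y \<epsilon> c'"
    then have "y \<in> insert x (elts c)" unfolding in_elts[symmetric, of y c'] c'(2) .
    then show "elts y \<subseteq> elts c'" unfolding c'(2) using cx by auto
  qed
qed

end

text \<open>The condition \<open>num 0\<close> is the empty one, hence the weakest, and lies in
  every generic filter. The recursion runs in the universe; that its values stay in \<open>M\<close>
  is proved next.\<close>

function check :: "'u::set_universe \<Rightarrow> 'u" where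
  "check x = set_of ((\<lambda>y. pair (check y) (num 0)) ` elts x)"
  by auto
termination by (relation "{(x, y). x \<epsilon> y}") (auto simp: mem_wf)

declare check.simps [simp del]

context zfc
begin

text \<open>The recursion has to be simulated inside \<open>M\<close>. A \<open>good\<close> set is
  a partial function in \<open>M\<close> that obeys the recursion on a domain closed under elements;
  by membership induction its values are check names. The second induction, within a transitive set
  around \<open>x\<close>, shows that every element is reached by such an approximation.\<close>

lemma check:
  assumes "x \<in> M"
  shows check_closed: "check x \<in> M"
    and elts_check: "elts (check x) = (\<lambda>y. pair (check y) (num 0)) ` elts x"
proof -
  define good where "good g \<longleftrightarrow> (\<forall>w\<in>elts g. \<exists>y\<in>M. \<exists>s\<in>M. w = pair y s \<and>
    (\<forall>z\<in>elts y. \<exists>t\<in>M. pair z t \<epsilon> g) \<and>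
    (\<forall>v\<in>M. v \<epsilon> s \<longleftrightarrow> (\<exists>z\<in>elts y. \<exists>t\<in>M. pair z t \<epsilon> g \<and> v = pair t (num 0))))" for g
  have goodD: "(\<forall>z\<in>elts y. \<exists>t\<in>M. pair z t \<epsilon> g) \<and>
      (\<forall>v\<in>M. v \<epsilon> s \<longleftrightarrow> (\<exists>z\<in>elts y. \<exists>t\<in>M. pair z t \<epsilon> g \<and> v = pair t (num 0)))"
    if g: "good g" and w: "pair y s \<epsilon> g" and ys: "y \<in> M" "s \<in> M" for g y s
  proof -
    from w have "pair y s \<in> elts g" by simp
    from bspec[OF g[unfolded good_def] this] obtain y' s' where
      1: "y' \<in> M" "s' \<in> M" "pair y s = pair y' s'" and 2: "(\<forall>z\<in>elts y'. \<exists>t\<in>M. pair z t \<epsilon> g) \<and>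
        (\<forall>v\<in>M. v \<epsilon> s' \<longleftrightarrow> (\<exists>z\<in>elts y'. \<exists>t\<in>M. pair z t \<epsilon> g \<and> v = pair t (num 0)))"
      by blast
    from 1 ys have "y' = y" "s' = s" by (simp_all add: pair_inject)
    with 2 show ?thesis by simp
  qed
  have good1: "(\<exists>t\<in>M. pair z t \<epsilon> g)" if "good g" "pair y s \<epsilon> g" "z \<epsilon> y" "y \<in> M" "s \<in> M" for g y s z
    using goodD[OF that(1,2,4,5)] that(3) by simp
  have good2: "v \<epsilon> s \<longleftrightarrow> (\<exists>z\<in>elts y. \<exists>t\<in>M. pair z t \<epsilon> g \<and> v = pair t (num 0))"
    if "good g" "pair y s \<epsilon> g" "y \<in> M" "s \<in> M" for g y s v
  proof (cases "v \<in> M")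
    case True
    then show ?thesis using goodD[OF that] by simp
  next
    case False
    then show ?thesis using trans[OF that(4), of v] by auto
  qed
  have sound: "s = check y \<and> elts s = (\<lambda>y. pair (check y) (num 0)) ` elts y"
    if "good g" "pair y s \<epsilon> g" "y \<in> M" "s \<in> M" for g y s
    using that(2-)
  proof (induction y arbitrary: s rule: eps_induct)
    case (step y)
    have IH: "t = check z" if "z \<epsilon> y" "pair z t \<epsilon> g" "t \<in> M" for z t
      using step.IH[OF that(1,2)] trans[OF step.prems(2) that(1)] that(3) by blast
    have ch: "pair z (check z) \<epsilon> g \<and> check z \<in> M" if "z \<epsilon> y" for z
      using good1[OF \<open>good g\<close> step.prems(1) that step.prems(2,3)] IH[OF that] by auto
    have "(\<exists>t\<in>M. pair z t \<epsilon> g \<and> v = pair t (num 0)) \<longleftrightarrow> v = pair (check z) (num 0)"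
      if "z \<in> elts y" for z v
      using ch[of z] IH[of z] that by auto
    then have "v \<epsilon> s \<longleftrightarrow> (\<exists>z\<in>elts y. v = pair (check z) (num 0))" for v
      unfolding good2[OF \<open>good g\<close> step.prems] by (intro bex_cong refl) simp
    then have "elts s = (\<lambda>y. pair (check y) (num 0)) ` elts y" by (auto simp: set_eq_iff)
    then show ?case unfolding check.simps[of y] by (metis set_of_elts)
  qed
  define R where "R y s \<longleftrightarrow> (\<exists>g\<in>M. good g \<and> pair y s \<epsilon> g)" for y s
  have R: "dpred M (\<lambda>e. R (e 0) (e 1))"
    unfolding R_def good_def by (intro dintros num_closed)
  have Rst: "dterm M s \<Longrightarrow> dterm M t \<Longrightarrow> dpred M (\<lambda>e. R (s e) (t e))" for s t
    using dpred_subst2[OF R] .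
  obtain c where c: "c \<in> M" "x \<epsilon> c" "\<And>y. y \<epsilon> c \<Longrightarrow> elts y \<subseteq> elts c"
    using ex_transitive_set[OF assms] by blast
  define D where "D = {w \<in> elts c. \<exists>s\<in>M. R w s}"
  have "small D" unfolding D_def by (intro small_sep small_elts c dintros Rst)
  have DM: "w \<in> M" if "w \<in> D" for w using small_subset[OF \<open>small D\<close> that] .
  have RD: "R w s \<longleftrightarrow> s = check w" if "w \<in> D" "s \<in> M" for w s
    using that sound DM unfolding D_def R_def by blast
  have ech: "check w \<in> M \<and> elts (check w) = (\<lambda>y. pair (check y) (num 0)) ` elts w"
    if w: "w \<in> D" for w
  proof -
    obtain s g where s: "s \<in> M" "g \<in> M" "good g" "pair w s \<epsilon> g" using w unfolding D_def R_def by blast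
    then show ?thesis using sound[OF s(3,4) DM[OF w] s(1)] by blast
  qed
  then have DcM: "check w \<in> M" if "w \<in> D" for w using that by blast
  have Dtrans: "z \<in> D" if w: "w \<in> D" and z: "z \<epsilon> w" for z w
  proof -
    obtain s g where s: "s \<in> M" "g \<in> M" "good g" "pair w s \<epsilon> g" using w unfolding D_def R_def by blast
    then obtain t where "t \<in> M" "pair z t \<epsilon> g" using good1[OF s(3,4) z DM[OF w] s(1)] by blast
    moreover have "z \<epsilon> c" using c(3)[of w] w z unfolding D_def by auto
    ultimately show ?thesis using s unfolding D_def R_def by auto
  qed
  have "w \<in> D" if "w \<epsilon> c" for w
    using that
  proof (induction w rule: eps_induct)
    case (step w)
    have wM: "w \<in> M" using trans c(1) step.prems by blast
    have zD: "z \<in> D" if "z \<epsilon> w" for z using step c(3)[of w] that by auto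
    have 1: "dpred M (\<lambda>e. \<exists>s\<in>M. R (e 0) s \<and> e 1 = pair (e 0) s)"
      by (intro dintros Rst)
    have "\<exists>!v. v \<in> M \<and> (\<exists>s\<in>M. R z s \<and> v = pair z s)" if "z \<in> D" for z
      using RD[OF that] DcM[OF that] DM[OF that] by (intro ex1I[of _ "pair z (check z)"]) auto
    from small_replace[OF \<open>small D\<close> 1 this]
    have "small {v \<in> M. \<exists>z\<in>D. \<exists>s\<in>M. R z s \<and> v = pair z s}" .
    moreover have "{v \<in> M. \<exists>z\<in>D. \<exists>s\<in>M. R z s \<and> v = pair z s} = (\<lambda>z. pair z (check z)) ` D"
      using RD DM DcM by auto
    ultimately have sg: "small ((\<lambda>z. pair z (check z)) ` D)" by simp
    have 1: "dpred M (\<lambda>e. \<exists>s\<in>M. R (e 0) s \<and> e 1 = pair s (num 0))"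
      by (intro dintros Rst num_closed)
    have "\<exists>!v. v \<in> M \<and> (\<exists>s\<in>M. R z s \<and> v = pair s (num 0))" if "z \<in> elts w" for z
      using that RD[OF zD] DcM[OF zD] by (intro ex1I[of _ "pair (check z) (num 0)"]) auto
    from small_replace[OF small_elts[OF wM] 1 this]
    have "small {v \<in> M. \<exists>z\<in>elts w. \<exists>s\<in>M. R z s \<and> v = pair s (num 0)}" .
    moreover have "{v \<in> M. \<exists>z\<in>elts w. \<exists>s\<in>M. R z s \<and> v = pair s (num 0)} =
        (\<lambda>z. pair (check z) (num 0)) ` elts w"
      using RD[OF zD] DcM[OF zD] by auto
    ultimately obtain s where s: "s \<in> M" "elts s = (\<lambda>z. pair (check z) (num 0)) ` elts w"
      unfolding small_def by auto
    \<comment> \<open>All approximations agree with \<open>check\<close>, so their union over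
      \<open>D\<close> is again one. It already covers the elements of \<open>w\<close>, and the
      pair for \<open>w\<close> can be added.\<close>
    obtain g where g: "g \<in> M" "elts g = insert (pair w s) ((\<lambda>z. pair z (check z)) ` D)"
      using small_Un[OF small_finite[of "{pair w s}"] sg] wM s unfolding small_def by auto
    have gi: "v \<epsilon> g \<longleftrightarrow> v = pair w s \<or> (\<exists>z\<in>D. v = pair z (check z))" for v
      using g(2) by (auto simp: set_eq_iff)
    have sw: "s = check w" unfolding check.simps[of w] by (metis s(2) set_of_elts)
    have pg: "pair z t \<epsilon> g \<longleftrightarrow> (z = w \<or> z \<in> D) \<and> t = check z" if "z \<in> M" "t \<in> M" for z t
      unfolding gi using that wM s DM DcM sw by (auto simp: pair_inject)
    have "good g"
      unfolding good_def
    proof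
      fix v assume "v \<in> elts g"
      then obtain z where z: "v = pair z (check z)" "z = w \<or> z \<in> D"
        using sw by (auto simp: gi)
      have zM: "z \<in> M" "check z \<in> M" using z wM s sw DM DcM by auto
      have uD: "u \<in> D" if "u \<epsilon> z" for u using z(2) zD Dtrans that by blast
      have ez: "elts (check z) = (\<lambda>y. pair (check y) (num 0)) ` elts z"
        using z(2) ech s(2) sw by auto
      show "\<exists>y\<in>M. \<exists>s\<in>M. v = pair y s \<and> (\<forall>z\<in>elts y. \<exists>t\<in>M. pair z t \<epsilon> g) \<and>
          (\<forall>v\<in>M. v \<epsilon> s \<longleftrightarrow> (\<exists>z\<in>elts y. \<exists>t\<in>M. pair z t \<epsilon> g \<and> v = pair t (num 0)))"
      proof (rule bexI[OF _ zM(1)], rule bexI[OF _ zM(2)], intro conjI ballI z(1))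
        fix u assume "u \<in> elts z"
        then show "\<exists>t\<in>M. pair u t \<epsilon> g" using uD DM DcM pg by auto
      next
        fix v
        have "v \<epsilon> check z \<longleftrightarrow> (\<exists>u\<in>elts z. v = pair (check u) (num 0))"
          using ez by (auto simp: set_eq_iff)
        also have "\<dots> \<longleftrightarrow> (\<exists>u\<in>elts z. \<exists>t\<in>M. pair u t \<epsilon> g \<and> v = pair t (num 0))"
          using uD DM DcM pg by (intro bex_cong refl) auto
        finally show "v \<epsilon> check z \<longleftrightarrow> (\<exists>u\<in>elts z. \<exists>t\<in>M. pair u t \<epsilon> g \<and> v = pair t (num 0))" .
      qed
    qed
    moreover have "pair w s \<epsilon> g" using gi by blast
    ultimately have "R w s" using g(1) unfolding R_def by blast
    then show ?case using s(1) step.prems unfolding D_def by auto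
  qed
  then have "x \<in> D" using c(2) by blast
  then show "check x \<in> M" "elts (check x) = (\<lambda>y. pair (check y) (num 0)) ` elts x"
    using ech by blast+
qed

end

subsection \<open>Forcing\<close>

text \<open>
  The only forcing relations needed concern statements \<open>x \<in> t\<close> and \<open>x = t\<close> with \<open>x\<close> in the ground
  model. The recursive clauses for these are positive, so over a set \<open>C\<close> of names the relation is
  the least fixed point of a monotone operator, and exists in \<open>M\<close> without any recursion theorem.
\<close>

definition forces_mem :: "'u::set_universe set \<Rightarrow> 'u set \<Rightarrow> ('u \<Rightarrow> 'u \<Rightarrow> 'u \<Rightarrow> bool) \<Rightarrow> 'u \<Rightarrow> 'u \<Rightarrow> 'u \<Rightarrow> bool" where
  "forces_mem P C E r x t \<longleftrightarrow> (\<forall>r1\<in>P. elts r \<subseteq> elts r1 \<longrightarrow> (\<exists>r2\<in>P. elts r1 \<subseteq> elts r2 \<and>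
     (\<exists>t'\<in>C. \<exists>p\<in>P. pair t' p \<epsilon> t \<and> elts p \<subseteq> elts r2 \<and> E r2 x t')))"

text \<open>The two conjuncts are the inclusions of \<open>x\<close> in \<open>t\<close> and of
  \<open>t\<close> in \<open>x\<close>, the second expressed by density below a condition that puts
  \<open>t'\<close> into \<open>t\<close>. Inclusion of conditions points towards the stronger
  one.\<close>

definition eq_clause :: "'u::set_universe set \<Rightarrow> 'u set \<Rightarrow> ('u \<Rightarrow> 'u \<Rightarrow> 'u \<Rightarrow> bool) \<Rightarrow> 'u \<Rightarrow> 'u \<Rightarrow> 'u \<Rightarrow> bool" where
  "eq_clause P C E r x t \<longleftrightarrow> (\<forall>y\<in>elts x. forces_mem P C E r y t) \<and>
     (\<forall>t'\<in>C. \<forall>p\<in>P. pair t' p \<epsilon> t \<longrightarrow> (\<forall>r1\<in>P. elts r \<subseteq> elts r1 \<and> elts p \<subseteq> elts r1 \<longrightarrow>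
        (\<exists>r2\<in>P. elts r1 \<subseteq> elts r2 \<and> (\<exists>y\<in>elts x. E r2 y t'))))"

text \<open>Codes a ternary relation as an element of the universe, so that \<open>M\<close> can
  quantify over relations when it forms the least fixed point.\<close>

definition rel3 :: "'u::set_universe \<Rightarrow> 'u \<Rightarrow> 'u \<Rightarrow> 'u \<Rightarrow> bool" where
  "rel3 K r x t \<longleftrightarrow> pair r (pair x t) \<epsilon> K"

lemma forces_mem_mono:
  assumes "\<And>r x t. E r x t \<Longrightarrow> E' r x t" "forces_mem P C E r x t"
  shows "forces_mem P C E' r x t"
  using assms(2) unfolding forces_mem_def by (meson assms(1))

lemma eq_clause_mono:
  assumes "\<And>r x t. E r x t \<Longrightarrow> E' r x t" "eq_clause P C E r x t"
  shows "eq_clause P C E' r x t"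
  using assms(2) forces_mem_mono[of E E', OF assms(1)] unfolding eq_clause_def by (meson assms(1))

lemma forces_mem_stronger:
  "forces_mem P C E r x t \<Longrightarrow> elts r \<subseteq> elts r' \<Longrightarrow> forces_mem P C E r' x t"
  unfolding forces_mem_def by (meson order_trans)

lemma eq_clause_stronger:
  "eq_clause P C E r x t \<Longrightarrow> elts r \<subseteq> elts r' \<Longrightarrow> eq_clause P C E r' x t"
  using forces_mem_stronger[of P C E r _ t r'] unfolding eq_clause_def by (meson order_trans)

context zfc
begin

lemma dpred_rel3: "dterm M k \<Longrightarrow> dterm M r \<Longrightarrow> dterm M x \<Longrightarrow> dterm M t \<Longrightarrow>
    dpred M (\<lambda>e. rel3 (k e) (r e) (x e) (t e))"
  unfolding rel3_def by (intro dintros)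

lemma ex_forces_eq:
  assumes P: "small P" and C: "small C"
  obtains K where "K \<in> M" "\<And>r x t. r \<in> P \<Longrightarrow> x \<in> C \<Longrightarrow> t \<in> C \<Longrightarrow>
    rel3 K r x t \<longleftrightarrow> eq_clause P C (rel3 K) r x t"
proof -
  note PM = small_subset[OF P] and CM = small_subset[OF C]
  define D where "D = product P (product C C)"
  have "small D" unfolding D_def by (intro small_product P C)
  define closed where "closed K \<longleftrightarrow> (\<forall>r\<in>P. \<forall>x\<in>C. \<forall>t\<in>C. eq_clause P C (rel3 K) r x t \<longrightarrow> rel3 K r x t)" for K
  have "small {d \<in> D. \<forall>K\<in>M. closed K \<longrightarrow> d \<epsilon> K}"
    unfolding closed_def eq_clause_def forces_mem_def
    by (intro small_sep \<open>small D\<close> dpred_rel3 dintros P C)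
  then obtain K where K: "K \<in> M" "elts K = {d \<in> D. \<forall>K\<in>M. closed K \<longrightarrow> d \<epsilon> K}"
    by (auto simp: small_def)
  have K_le: "rel3 K r x t \<Longrightarrow> rel3 K' r x t" if "K' \<in> M" "closed K'" for K' r x t
    using that K(2) unfolding rel3_def by (metis (no_types, lifting) in_elts mem_Collect_eq)
  have KI: "rel3 K r x t" if rxt: "r \<in> P" "x \<in> C" "t \<in> C" "eq_clause P C (rel3 K) r x t" for r x t
  proof -
    have "pair r (pair x t) \<epsilon> K'" if K': "K' \<in> M" "closed K'" for K'
    proof -
      have "eq_clause P C (rel3 K') r x t" by (rule eq_clause_mono[of "rel3 K", OF K_le[OF K'] rxt(4)])
      then show ?thesis using K'(2) rxt(1-3) unfolding closed_def rel3_def[symmetric] by blast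
    qed
    moreover have "pair r (pair x t) \<in> D" using that unfolding D_def product_def by blast
    ultimately have "pair r (pair x t) \<in> elts K" unfolding K(2) by blast
    then show ?thesis by (simp add: rel3_def)
  qed
  \<comment> \<open>\<open>L\<close> is the operator applied once to \<open>K\<close>. It lies below
    \<open>K\<close>, so by monotonicity it is closed as well, and minimality of \<open>K\<close>
    gives the remaining half of the fixed-point equation.\<close>
  have "small {d \<in> D. \<exists>r\<in>P. \<exists>x\<in>C. \<exists>t\<in>C. d = pair r (pair x t) \<and> eq_clause P C (rel3 K) r x t}"
    unfolding eq_clause_def forces_mem_def
    by (intro small_sep \<open>small D\<close> dpred_rel3 dintros P C K(1))
  then obtain L where L: "L \<in> M"
    "elts L = {d \<in> D. \<exists>r\<in>P. \<exists>x\<in>C. \<exists>t\<in>C. d = pair r (pair x t) \<and> eq_clause P C (rel3 K) r x t}"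
    by (auto simp: small_def)
  have rel3_L: "rel3 L r x t \<Longrightarrow> \<exists>r'\<in>P. \<exists>x'\<in>C. \<exists>t'\<in>C. pair r (pair x t) = pair r' (pair x' t') \<and>
      eq_clause P C (rel3 K) r' x' t'" for r x t
    unfolding rel3_def in_elts[symmetric, of _ L] L(2) by blast
  have L_le: "rel3 L r x t \<Longrightarrow> rel3 K r x t" for r x t
    using rel3_L[of r x t] KI unfolding rel3_def by metis
  have "closed L"
    unfolding closed_def
  proof (intro ballI impI)
    fix r x t assume rxt: "r \<in> P" "x \<in> C" "t \<in> C" "eq_clause P C (rel3 L) r x t"
    then have "eq_clause P C (rel3 K) r x t" using eq_clause_mono[of "rel3 L" "rel3 K", OF L_le] by blast
    moreover have "pair r (pair x t) \<in> D" using rxt unfolding D_def product_def by blast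
    ultimately have "pair r (pair x t) \<in> elts L" unfolding L(2) using rxt by blast
    then show "rel3 L r x t" by (simp add: rel3_def)
  qed
  then have "eq_clause P C (rel3 K) r x t" if "rel3 K r x t" "r \<in> P" "x \<in> C" "t \<in> C" for r x t
    using rel3_L[OF K_le[OF L(1) _ that(1)]] that PM CM by (auto simp: pair_inject)
  then show thesis using that[OF K(1)] KI by blast
qed

end

section \<open>Generic filters, evaluation of names and the truth lemma\<close>

locale generic = zfc M for M :: "'u::set_universe set" +
  fixes P G N :: "'u set" and val :: "'u \<Rightarrow> 'u"
  assumes small_P: "small P" and empty_P: "num 0 \<in> P"
    and generic_filter: "generic_filter M P G"
    and eps_val: "t \<in> names M P \<Longrightarrow>
      y \<epsilon> val t \<longleftrightarrow> (\<exists>s\<in>names M P. \<exists>p\<in>G. \<exists>z. z \<epsilon> t \<and> is_pair M s p z \<and> y = val s)"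
    and N: "N = val ` names M P"
begin

lemma P_M: "p \<in> P \<Longrightarrow> p \<in> M"
  using small_subset[OF small_P] .

lemma G_P: "p \<in> G \<Longrightarrow> p \<in> P"
  using generic_filter unfolding generic_filter_def by blast

lemma G_weaker: "q \<in> G \<Longrightarrow> p \<in> P \<Longrightarrow> elts p \<subseteq> elts q \<Longrightarrow> p \<in> G"
  using generic_filter P_M unfolding generic_filter_def by (simp add: subset_in_iff)

lemma G_directed:
  assumes "p \<in> G" "q \<in> G"
  obtains r where "r \<in> G" "elts p \<subseteq> elts r" "elts q \<subseteq> elts r"
  using generic_filter assms subset_in_iff[OF P_M[OF G_P]] unfolding generic_filter_def by metis

lemma empty_G: "num 0 \<in> G"
proof -
  obtain p where "p \<in> G" using generic_filter unfolding generic_filter_def by blast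
  then show ?thesis using G_weaker[OF _ empty_P] by (simp add: elts_num)
qed

lemma generic_meets:
  assumes "dpred M (\<lambda>e. Q (e 0))" "\<And>p. p \<in> P \<Longrightarrow> \<exists>q\<in>P. elts p \<subseteq> elts q \<and> Q q"
  shows "\<exists>q\<in>G. Q q"
proof -
  obtain D where D: "D \<in> M" "elts D = {q \<in> P. Q q}"
    using small_sep[OF small_P assms(1)] by (auto simp: small_def)
  have Di: "q \<epsilon> D \<longleftrightarrow> q \<in> P \<and> Q q" for q unfolding in_elts[symmetric, of q D] D(2) by simp
  have "is_dense M P D"
    unfolding is_dense_def using assms(2) P_M by (auto simp: Di subset_in_iff) blast
  then show ?thesis using generic_filter D(1) unfolding generic_filter_def by (auto simp: Di)
qed

text \<open>Genericity speaks of sets that are dense everywhere, so the conditions incompatible with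
  \<open>r\<close> are added. Since \<open>G\<close> is directed and contains \<open>r\<close>, it
  meets the enlarged set inside the original one.\<close>

lemma generic_meets_below:
  assumes Q: "dpred M (\<lambda>e. Q (e 0))" and r: "r \<in> G"
    and dense: "\<And>p. p \<in> P \<Longrightarrow> elts r \<subseteq> elts p \<Longrightarrow> \<exists>q\<in>P. elts p \<subseteq> elts q \<and> Q q"
  shows "\<exists>q\<in>G. elts r \<subseteq> elts q \<and> Q q"
proof -
  have "\<exists>q\<in>G. (elts r \<subseteq> elts q \<and> Q q) \<or> (\<forall>p\<in>P. \<not> (elts r \<subseteq> elts p \<and> elts q \<subseteq> elts p))"
  proof (rule generic_meets)
    show "dpred M (\<lambda>e. (elts r \<subseteq> elts (e 0) \<and> Q (e 0)) \<or> (\<forall>p\<in>P. \<not> (elts r \<subseteq> elts p \<and> elts (e 0) \<subseteq> elts p)))"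
      using r G_P P_M by (intro dintros dpred_subst1[OF Q] small_P) blast+
    fix p assume "p \<in> P"
    show "\<exists>q\<in>P. elts p \<subseteq> elts q \<and>
        ((elts r \<subseteq> elts q \<and> Q q) \<or> (\<forall>p\<in>P. \<not> (elts r \<subseteq> elts p \<and> elts q \<subseteq> elts p)))"
    proof (cases "\<exists>q\<in>P. elts r \<subseteq> elts q \<and> elts p \<subseteq> elts q")
      case True
      then obtain q where "q \<in> P" "elts r \<subseteq> elts q" "elts p \<subseteq> elts q" by blast
      then show ?thesis using dense[of q] by (meson order_trans)
    next
      case False
      then show ?thesis using \<open>p \<in> P\<close> by blast
    qed
  qed
  then obtain q where q: "q \<in> G"
    "(elts r \<subseteq> elts q \<and> Q q) \<or> (\<forall>p\<in>P. \<not> (elts r \<subseteq> elts p \<and> elts q \<subseteq> elts p))" by blast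
  obtain p where "p \<in> G" "elts r \<subseteq> elts p" "elts q \<subseteq> elts p" using G_directed[OF r q(1)] by blast
  then show ?thesis using q G_P by blast
qed

lemma names_M: "t \<in> names M P \<Longrightarrow> t \<in> M"
  by (erule names.cases) simp

lemma names_iff: "t \<in> names M P \<longleftrightarrow> t \<in> M \<and> (\<forall>z. z \<epsilon> t \<longrightarrow> (\<exists>s\<in>names M P. \<exists>p\<in>P. z = pair s p))"
proof
  assume t: "t \<in> names M P"
  then show "t \<in> M \<and> (\<forall>z. z \<epsilon> t \<longrightarrow> (\<exists>s\<in>names M P. \<exists>p\<in>P. z = pair s p))"
  proof cases
    case name
    have "\<exists>s\<in>names M P. \<exists>p\<in>P. z = pair s p" if z: "z \<epsilon> t" for z
    proof -
      obtain s p where "s \<in> names M P" "p \<in> P" "is_pair M s p z" using name(2)[OF z] by blast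
      moreover from this have "z = pair s p"
        using is_pair_iff[of s p z] names_M P_M trans[OF name(1) z] by blast
      ultimately show ?thesis by blast
    qed
    then show ?thesis using name(1) by blast
  qed
next
  assume t: "t \<in> M \<and> (\<forall>z. z \<epsilon> t \<longrightarrow> (\<exists>s\<in>names M P. \<exists>p\<in>P. z = pair s p))"
  show "t \<in> names M P"
  proof (rule names.name)
    show "t \<in> M" using t by blast
    fix z assume z: "z \<epsilon> t"
    then obtain s p where "s \<in> names M P" "p \<in> P" "z = pair s p" using t by blast
    moreover from this have "is_pair M s p z" using names_M P_M by (simp add: is_pair_iff)
    ultimately show "\<exists>s p. s \<in> names M P \<and> p \<in> P \<and> is_pair M s p z" by blast
  qed
qed

lemma names_pair:
  assumes "t \<in> names M P" "pair s p \<epsilon> t" "s \<in> M" "p \<in> M"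
  shows "s \<in> names M P \<and> p \<in> P"
proof -
  obtain s' p' where "s' \<in> names M P" "p' \<in> P" "pair s p = pair s' p'"
    using assms(1,2) names_iff[of t] by blast
  then show ?thesis using assms(3,4) names_M P_M by (simp add: pair_inject)
qed

lemma names_induct [consumes 1, case_names name]:
  assumes "t \<in> names M P"
    and "\<And>t. t \<in> names M P \<Longrightarrow> (\<And>s p. s \<in> names M P \<Longrightarrow> p \<in> P \<Longrightarrow> pair s p \<epsilon> t \<Longrightarrow> Q s) \<Longrightarrow> Q t"
  shows "Q t"
  using assms(1)
proof (induction rule: names.induct)
  case (name t)
  have "t \<in> names M P"
    using name by (intro names.name) blast+
  moreover have "Q s" if s: "s \<in> names M P" "p \<in> P" "pair s p \<epsilon> t" for s p
  proof -
    obtain s' p' where *: "s' \<in> names M P" "Q s'" "p' \<in> P" "is_pair M s' p' (pair s p)"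
      using name(2)[OF s(3)] by blast
    then have "pair s p = pair s' p'"
      using is_pair_iff[of s' p' "pair s p"] names_M P_M s by (meson pair_closed)
    then show ?thesis using * s names_M P_M by (simp add: pair_inject)
  qed
  ultimately show ?case using assms(2) by blast
qed

lemma elts_val:
  assumes "t \<in> names M P"
  shows "y \<epsilon> val t \<longleftrightarrow> (\<exists>s\<in>names M P. \<exists>p\<in>G. pair s p \<epsilon> t \<and> y = val s)"
proof -
  have "(\<exists>z. z \<epsilon> t \<and> is_pair M s p z \<and> y = val s) \<longleftrightarrow> pair s p \<epsilon> t \<and> y = val s"
    if "s \<in> names M P" "p \<in> G" for s p
    using is_pair_iff[of s p] names_M[OF that(1)] P_M[OF G_P[OF that(2)]] trans[OF names_M[OF assms]]
    by (metis pair_closed)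
  then show ?thesis unfolding eps_val[OF assms] by blast
qed

lemma M_subset_N: "M \<subseteq> N"
proof
  fix x assume "x \<in> M"
  then have "check x \<in> names M P \<and> val (check x) = x"
  proof (induction x rule: eps_induct)
    case (step x)
    have yM: "y \<in> M" if "y \<epsilon> x" for y using trans[OF step.prems that] .
    have ech: "z \<epsilon> check x \<longleftrightarrow> (\<exists>y. y \<epsilon> x \<and> z = pair (check y) (num 0))" for z
      unfolding in_elts[symmetric, of z] elts_check[OF step.prems] by auto
    have n: "check x \<in> names M P"
      unfolding names_iff[of "check x"] ech using check_closed[OF step.prems] step.IH yM empty_P by blast
    have "y \<epsilon> val (check x) \<longleftrightarrow> y \<epsilon> x" for y
    proof
      assume "y \<epsilon> val (check x)"
      then obtain s p z where "s \<in> names M P" "p \<in> G" "z \<epsilon> x" "pair s p = pair (check z) (num 0)" "y = val s"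
        unfolding elts_val[OF n] ech by blast
      then show "y \<epsilon> x"
        using pair_inject[OF names_M P_M[OF G_P] check_closed[OF yM] num_closed] step.IH yM by auto
    next
      assume "y \<epsilon> x"
      then show "y \<epsilon> val (check x)"
        unfolding elts_val[OF n] ech using step.IH yM empty_G by metis
    qed
    then show ?case using n by (simp add: mem_extensional)
  qed
  then show "x \<in> N" unfolding N by force
qed

lemma N_fin_class: "fin_class N"
proof
  show "y \<in> N" if "x \<in> N" "y \<epsilon> x" for x y
    using that elts_val unfolding N by blast
  have "num 0 \<in> N" using M_subset_N num_closed by blast
  then show "\<exists>z\<in>N. elts z = {}" by (intro bexI[of _ "num 0"]) (simp add: elts_num)
  fix a b assume "a \<in> N" "b \<in> N"
  then obtain s t where st: "s \<in> names M P" "a = val s" "t \<in> names M P" "b = val t"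
    unfolding N by blast
  then have "pair t (num 0) \<in> M" "s \<in> M" "t \<in> M" using names_M by simp_all
  \<comment> \<open>The added pair contributes \<open>val t\<close> unconditionally, because the
    empty condition belongs to \<open>G\<close>.\<close>
  then obtain c where c: "c \<in> M" "elts c = insert (pair t (num 0)) (elts s)" using ex_insert by blast
  have ci: "z \<epsilon> c \<longleftrightarrow> z = pair t (num 0) \<or> z \<epsilon> s" for z
    unfolding in_elts[symmetric, of z c] c(2) by simp
  have n: "c \<in> names M P"
    using names_iff[of c] names_iff[of s] c(1) st empty_P by (auto simp: ci)
  have "y \<epsilon> val c \<longleftrightarrow> y = b \<or> y \<epsilon> a" for y
  proof -
    have "pair s' p = pair t (num 0) \<longleftrightarrow> s' = t \<and> p = num 0" if "s' \<in> names M P" "p \<in> G" for s' p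
      using that names_M P_M G_P \<open>t \<in> M\<close> by (intro pair_inject) auto
    then show ?thesis
      unfolding elts_val[OF n] st(2,4) elts_val[OF st(1)] ci using st(3) empty_G by metis
  qed
  then have "elts (val c) = insert b (elts a)" by auto
  then show "\<exists>c\<in>N. elts c = insert b (elts a)" using n unfolding N by blast
qed

text \<open>Induction on the name, inside a transitive set \<open>C\<close> that keeps all subnames
  and elements in the domain of \<open>K\<close>. If \<open>r\<close> forces equality, genericity
  below \<open>r\<close> realises both density clauses. Conversely, a condition that does not force
  equality has an extension that forces a concrete violation, so \<open>G\<close> decides the
  question, and a violation would contradict \<open>val t = x\<close>.\<close>

lemma forces_eq_truth:
  assumes C: "small C" and Ctrans: "\<And>x. x \<in> C \<Longrightarrow> elts x \<subseteq> C" and K: "K \<in> M"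
    and fixp: "\<And>r x t. r \<in> P \<Longrightarrow> x \<in> C \<Longrightarrow> t \<in> C \<Longrightarrow> rel3 K r x t \<longleftrightarrow> eq_clause P C (rel3 K) r x t"
    and t: "t \<in> names M P" and "t \<in> C" "x \<in> C"
  shows "val t = x \<longleftrightarrow> (\<exists>r\<in>G. rel3 K r x t)"
  using t \<open>t \<in> C\<close> \<open>x \<in> C\<close>
proof (induction t arbitrary: x rule: names_induct)
  case (name t)
  note CM = small_subset[OF C]
  have tM: "t \<in> M" and xM: "x \<in> M" using CM name.prems by auto
  have xC: "y \<in> C" if "y \<epsilon> x" for y using Ctrans[OF name.prems(2)] that by auto
  have tC: "s \<in> C" if sp: "pair s p \<epsilon> t" "s \<in> M" "p \<in> M" for s p
  proof -
    obtain b where "b \<epsilon> pair s p" "s \<epsilon> b" using pair_components[OF sp(2,3)] by blast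
    then show ?thesis using Ctrans sp(1) name.prems(1) by (meson in_elts subsetD)
  qed
  have IH: "val s = y \<longleftrightarrow> (\<exists>r\<in>G. rel3 K r y s)" if "s \<in> names M P" "p \<in> P" "pair s p \<epsilon> t" "y \<epsilon> x" for s p y
    using name.IH[OF that(1-3) tC xC] that names_M P_M by blast
  have mono: "rel3 K r' y s" if "rel3 K r y s" "r \<in> P" "r' \<in> P" "elts r \<subseteq> elts r'" "y \<in> C" "s \<in> C" for r r' y s
    using that fixp eq_clause_stronger by blast
  show ?case
  proof
    assume "\<exists>r\<in>G. rel3 K r x t"
    then obtain r where r: "r \<in> G" "rel3 K r x t" by blast
    then have cl: "eq_clause P C (rel3 K) r x t" using fixp name.prems G_P by blast
    have "y \<epsilon> val t \<longleftrightarrow> y \<epsilon> x" for y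
    proof
      assume "y \<epsilon> x"
      then have "forces_mem P C (rel3 K) r y t" using cl unfolding eq_clause_def by simp
      then have "\<exists>q\<in>G. elts r \<subseteq> elts q \<and> (\<exists>t'\<in>C. \<exists>p\<in>P. pair t' p \<epsilon> t \<and> elts p \<subseteq> elts q \<and> rel3 K q y t')"
        using trans[OF xM \<open>y \<epsilon> x\<close>] unfolding forces_mem_def
        by (intro generic_meets_below dpred_rel3 dintros C small_P K tM r(1)) auto
      then obtain q t' p where q: "q \<in> G" "t' \<in> C" "p \<in> P" "pair t' p \<epsilon> t" "elts p \<subseteq> elts q" "rel3 K q y t'"
        by blast
      then have "t' \<in> names M P" using names_pair[OF name.hyps] CM P_M by blast
      moreover have "p \<in> G" using G_weaker q by blast
      moreover have "val t' = y" using IH[of t' p y] q \<open>t' \<in> names M P\<close> \<open>y \<epsilon> x\<close> by blast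
      ultimately show "y \<epsilon> val t" unfolding elts_val[OF name.hyps] using q by blast
    next
      assume "y \<epsilon> val t"
      then obtain s p where s: "s \<in> names M P" "p \<in> G" "pair s p \<epsilon> t" "y = val s"
        unfolding elts_val[OF name.hyps] by blast
      obtain r1 where r1: "r1 \<in> G" "elts r \<subseteq> elts r1" "elts p \<subseteq> elts r1"
        using G_directed[OF r(1) s(2)] by blast
      have sC: "s \<in> C" using tC s names_M P_M G_P by blast
      have "\<exists>q\<in>G. elts r1 \<subseteq> elts q \<and> (\<exists>y\<in>elts x. rel3 K q y s)"
      proof (intro generic_meets_below dpred_rel3 dintros K xM r1(1))
        show "s \<in> M" using s names_M by blast
        fix p' assume "p' \<in> P" "elts r1 \<subseteq> elts p'"
        then show "\<exists>q\<in>P. elts p' \<subseteq> elts q \<and> (\<exists>y\<in>elts x. rel3 K q y s)"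
          using cl sC s G_P r1 unfolding eq_clause_def by (meson order_trans)
      qed
      then obtain q z where "q \<in> G" "z \<epsilon> x" "rel3 K q z s" by auto
      then show "y \<epsilon> x" using IH[OF s(1) _ s(3)] s G_P by blast
    qed
    then show "val t = x" by (rule mem_extensional)
  next
    assume val: "val t = x"
    \<comment> \<open>The two possible violations: \<open>Q1\<close> keeps some element of
      \<open>x\<close> out of \<open>t\<close>, and \<open>Q2\<close> keeps some element, put into
      \<open>t\<close> by a part of \<open>r\<close>, different from all elements of
      \<open>x\<close>.\<close>
    define Q1 where "Q1 r \<longleftrightarrow> (\<exists>y\<in>elts x. \<forall>r2\<in>P. elts r \<subseteq> elts r2 \<longrightarrow>
      \<not> (\<exists>t'\<in>C. \<exists>p\<in>P. pair t' p \<epsilon> t \<and> elts p \<subseteq> elts r2 \<and> rel3 K r2 y t'))" for r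
    define Q2 where "Q2 r \<longleftrightarrow> (\<exists>t'\<in>C. \<exists>p\<in>P. pair t' p \<epsilon> t \<and> elts p \<subseteq> elts r \<and>
      (\<forall>r2\<in>P. elts r \<subseteq> elts r2 \<longrightarrow> \<not> (\<exists>y\<in>elts x. rel3 K r2 y t')))" for r
    have "\<exists>r\<in>G. rel3 K r x t \<or> Q1 r \<or> Q2 r"
    proof (rule generic_meets)
      show "dpred M (\<lambda>e. rel3 K (e 0) x t \<or> Q1 (e 0) \<or> Q2 (e 0))"
        unfolding Q1_def Q2_def by (intro dpred_rel3 dintros K xM tM C small_P)
      fix p assume p: "p \<in> P"
      show "\<exists>q\<in>P. elts p \<subseteq> elts q \<and> (rel3 K q x t \<or> Q1 q \<or> Q2 q)"
      proof (cases "rel3 K p x t")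
        case True
        then show ?thesis using p by blast
      next
        case False
        then have "\<not> eq_clause P C (rel3 K) p x t" using fixp p name.prems by blast
        then consider y where "y \<in> elts x" "\<not> forces_mem P C (rel3 K) p y t" |
          t' p' r1 where "t' \<in> C" "p' \<in> P" "pair t' p' \<epsilon> t" "r1 \<in> P" "elts p \<subseteq> elts r1" "elts p' \<subseteq> elts r1"
            "\<not> (\<exists>r2\<in>P. elts r1 \<subseteq> elts r2 \<and> (\<exists>y\<in>elts x. rel3 K r2 y t'))"
          unfolding eq_clause_def by blast
        then show ?thesis
        proof cases
          case 1
          then obtain q where q: "q \<in> P" "elts p \<subseteq> elts q" "\<not> (\<exists>r2\<in>P. elts q \<subseteq> elts r2 \<and>
              (\<exists>t'\<in>C. \<exists>p\<in>P. pair t' p \<epsilon> t \<and> elts p \<subseteq> elts r2 \<and> rel3 K r2 y t'))"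
            unfolding forces_mem_def by blast
          then have "Q1 q" unfolding Q1_def using 1(1) by blast
          then show ?thesis using q by blast
        next
          case 2
          then have "Q2 r1" unfolding Q2_def by blast
          then show ?thesis using 2 by blast
        qed
      qed
    qed
    then obtain r where r: "r \<in> G" "rel3 K r x t \<or> Q1 r \<or> Q2 r" by blast
    have "\<not> Q1 r"
    proof
      assume "Q1 r"
      then obtain y where y: "y \<epsilon> x" "\<And>r2 t' p. r2 \<in> P \<Longrightarrow> elts r \<subseteq> elts r2 \<Longrightarrow>
         t' \<in> C \<Longrightarrow> p \<in> P \<Longrightarrow> pair t' p \<epsilon> t \<Longrightarrow> elts p \<subseteq> elts r2 \<Longrightarrow> \<not> rel3 K r2 y t'"
        unfolding Q1_def by auto
      then obtain s p where s: "s \<in> names M P" "p \<in> G" "pair s p \<epsilon> t" "val s = y"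
        using elts_val[OF name.hyps, of y] val by blast
      have sC: "s \<in> C" using tC s names_M P_M G_P by blast
      obtain r' where r': "r' \<in> G" "rel3 K r' y s" using IH[OF s(1) G_P[OF s(2)] s(3) y(1)] s(4) by blast
      obtain q where q: "q \<in> G" "elts r \<subseteq> elts q" "elts p \<subseteq> elts q" using G_directed[OF r(1) s(2)] by blast
      obtain q' where q': "q' \<in> G" "elts q \<subseteq> elts q'" "elts r' \<subseteq> elts q'" using G_directed[OF q(1) r'(1)] by blast
      have "rel3 K q' y s" using mono[OF r'(2)] r' q' G_P xC[OF y(1)] sC by blast
      then show False using y(2)[of q' s p] q q' s sC G_P by blast
    qed
    moreover have "\<not> Q2 r"
    proof
      assume "Q2 r"
      then obtain t' p where t': "t' \<in> C" "p \<in> P" "pair t' p \<epsilon> t" "elts p \<subseteq> elts r"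
        "\<And>r2 y. r2 \<in> P \<Longrightarrow> elts r \<subseteq> elts r2 \<Longrightarrow> y \<epsilon> x \<Longrightarrow> \<not> rel3 K r2 y t'"
        unfolding Q2_def by auto
      then have n: "t' \<in> names M P" using names_pair[OF name.hyps] CM P_M by blast
      moreover have "p \<in> G" using G_weaker[OF r(1)] t' by blast
      ultimately have v: "val t' \<epsilon> x" using elts_val[OF name.hyps] t' val by blast
      then obtain r' where r': "r' \<in> G" "rel3 K r' (val t') t'" using IH[OF n t'(2,3) v] by blast
      obtain q where q: "q \<in> G" "elts r \<subseteq> elts q" "elts r' \<subseteq> elts q" using G_directed[OF r(1) r'(1)] by blast
      have "rel3 K q (val t') t'" using mono[OF r'(2)] r' q G_P xC[OF v] t'(1) by blast
      then show False using t'(5)[of q "val t'"] q v G_P by blast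
    qed
    ultimately show "\<exists>r\<in>G. rel3 K r x t" using r by blast
  qed
qed

text \<open>\<open>F r x s\<close> reads as: \<open>r\<close> forces \<open>x\<close> into
  \<open>s\<close>. The last clause yields one condition for all points of \<open>W\<close>
  simultaneously, even when \<open>W\<close> is infinite; this is what makes forced interiors large
  enough. Requiring \<open>s\<close> in the domain of \<open>u\<close> and \<open>x\<close> in
  \<open>X\<close> keeps all arguments in one transitive set.\<close>

lemma forcing_theorem:
  assumes u: "u \<in> names M P" and X: "X \<in> M"
  obtains F where "dpred M (\<lambda>e. F (e 0) (e 1) (e 2))"
    "\<And>r r' x s. F r x s \<Longrightarrow> elts r \<subseteq> elts r' \<Longrightarrow> F r' x s"
    "\<And>r x s p. r \<in> G \<Longrightarrow> x \<epsilon> X \<Longrightarrow> s \<in> M \<Longrightarrow> p \<in> M \<Longrightarrow> pair s p \<epsilon> u \<Longrightarrow> F r x s \<Longrightarrow> x \<epsilon> val s"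
    "\<And>W s p. W \<in> M \<Longrightarrow> elts W \<subseteq> elts X \<Longrightarrow> s \<in> M \<Longrightarrow> p \<in> M \<Longrightarrow> pair s p \<epsilon> u \<Longrightarrow> elts W \<subseteq> elts (val s) \<Longrightarrow>
       \<exists>r\<in>G. \<forall>x\<in>elts W. F r x s"
proof -
  have uM: "u \<in> M" using u names_M by blast
  obtain c where c: "c \<in> M" "pair u X \<epsilon> c" "\<And>y. y \<epsilon> c \<Longrightarrow> elts y \<subseteq> elts c"
    using ex_transitive_set[OF pair_closed[OF uM X]] by blast
  define C where "C = elts c"
  have C: "small C" unfolding C_def using c by simp
  have Ctrans: "elts x \<subseteq> C" if "x \<in> C" for x using c(3) that unfolding C_def by simp
  have pC: "a \<in> C \<and> b \<in> C" if "pair a b \<in> C" "a \<in> M" "b \<in> M" for a b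
    using pair_components[OF that(2,3)] Ctrans that(1) by (meson in_elts subsetD)
  have uC: "u \<in> C" "X \<in> C" using pC[OF _ uM X] c(2) unfolding C_def by auto
  have sC: "s \<in> C" if "pair s p \<epsilon> u" "s \<in> M" "p \<in> M" for s p
    using pC[OF _ that(2,3)] that(1) Ctrans[OF uC(1)] by auto
  have sC': "s \<in> C" if "pair s p \<epsilon> t" "t \<in> C" "s \<in> M" "p \<in> M" for s p t
    using pC[OF _ that(3,4)] that(1) Ctrans[OF that(2)] by auto
  obtain K where K: "K \<in> M" and fixp: "\<And>r x t. r \<in> P \<Longrightarrow> x \<in> C \<Longrightarrow> t \<in> C \<Longrightarrow>
    rel3 K r x t \<longleftrightarrow> eq_clause P C (rel3 K) r x t"
    using ex_forces_eq[OF small_P C] by blast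
  have truth: "val t = x \<longleftrightarrow> (\<exists>r\<in>G. rel3 K r x t)" if "t \<in> names M P" "t \<in> C" "x \<in> C" for t x
    using forces_eq_truth[OF C Ctrans K fixp that] by blast
  have mono: "rel3 K r' y s" if "rel3 K r y s" "r \<in> P" "r' \<in> P" "elts r \<subseteq> elts r'" "y \<in> C" "s \<in> C" for r r' y s
    using that fixp eq_clause_stronger by blast
  define F where "F = forces_mem P C (rel3 K)"
  show thesis
  proof (rule that[of F])
    show "dpred M (\<lambda>e. F (e 0) (e 1) (e 2))"
      unfolding F_def forces_mem_def by (intro dpred_rel3 dintros K C small_P)
    show "F r' x s" if "F r x s" "elts r \<subseteq> elts r'" for r r' x s
      using that forces_mem_stronger unfolding F_def by blast
  next
    fix r x s p assume a: "r \<in> G" "x \<epsilon> X" "s \<in> M" "p \<in> M" "pair s p \<epsilon> u" "F r x s"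
    have s: "s \<in> names M P" "s \<in> C" using names_pair[OF u a(5,3,4)] sC a by auto
    have "\<exists>q\<in>G. elts r \<subseteq> elts q \<and> (\<exists>t'\<in>C. \<exists>p\<in>P. pair t' p \<epsilon> s \<and> elts p \<subseteq> elts q \<and> rel3 K q x t')"
      using a(6) trans[OF X a(2)] unfolding F_def forces_mem_def
      by (intro generic_meets_below dpred_rel3 dintros C small_P K a(1,3)) auto
    then obtain q t' p' where q: "q \<in> G" "t' \<in> C" "p' \<in> P" "pair t' p' \<epsilon> s" "elts p' \<subseteq> elts q" "rel3 K q x t'"
      by blast
    have t': "t' \<in> names M P" using names_pair[OF s(1) q(4)] small_subset[OF C q(2)] P_M q by blast
    have "x \<in> C" using Ctrans[OF uC(2)] a(2) by auto
    then have "val t' = x" using truth[OF t' q(2)] q by blast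
    moreover have "p' \<in> G" using G_weaker q by blast
    ultimately show "x \<epsilon> val s" unfolding elts_val[OF s(1)] using t' q by blast
  next
    fix W s p assume a: "W \<in> M" "elts W \<subseteq> elts X" "s \<in> M" "p \<in> M" "pair s p \<epsilon> u" "elts W \<subseteq> elts (val s)"
    have s: "s \<in> names M P" "s \<in> C" using names_pair[OF u a(5,3,4)] sC a by auto
    \<comment> \<open>\<open>Q r\<close> says that \<open>r\<close> forces some point of
      \<open>W\<close> out of \<open>s\<close>. A condition not forcing all of \<open>W\<close> into
      \<open>s\<close> fails at a single point and extends to one with \<open>Q\<close>, so the size
      of \<open>W\<close> does not matter.\<close>
    define Q where "Q r \<longleftrightarrow> (\<exists>x\<in>elts W. \<forall>r1\<in>P. elts r \<subseteq> elts r1 \<longrightarrow>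
      \<not> (\<exists>t'\<in>C. \<exists>p\<in>P. pair t' p \<epsilon> s \<and> elts p \<subseteq> elts r1 \<and> rel3 K r1 x t'))" for r
    have "\<exists>r\<in>G. (\<forall>x\<in>elts W. F r x s) \<or> Q r"
    proof (rule generic_meets)
      show "dpred M (\<lambda>e. (\<forall>x\<in>elts W. F (e 0) x s) \<or> Q (e 0))"
        unfolding F_def forces_mem_def Q_def by (intro dpred_rel3 dintros K C small_P a)
      fix q assume q: "q \<in> P"
      show "\<exists>r\<in>P. elts q \<subseteq> elts r \<and> ((\<forall>x\<in>elts W. F r x s) \<or> Q r)"
      proof (cases "\<forall>x\<in>elts W. F q x s")
        case True
        then show ?thesis using q by blast
      next
        case False
        then obtain x where x: "x \<in> elts W" "\<not> F q x s" by blast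
        then obtain r where r: "r \<in> P" "elts q \<subseteq> elts r" "\<not> (\<exists>r2\<in>P. elts r \<subseteq> elts r2 \<and>
              (\<exists>t'\<in>C. \<exists>p\<in>P. pair t' p \<epsilon> s \<and> elts p \<subseteq> elts r2 \<and> rel3 K r2 x t'))"
            unfolding F_def forces_mem_def by blast
        then have "Q r" unfolding Q_def using x(1) by blast
        then show ?thesis using r by blast
      qed
    qed
    then obtain r where r: "r \<in> G" "(\<forall>x\<in>elts W. F r x s) \<or> Q r" by blast
    have "\<not> Q r"
    proof
      assume "Q r"
      then obtain x where x: "x \<in> elts W" "\<And>r1 t' p. r1 \<in> P \<Longrightarrow> elts r \<subseteq> elts r1 \<Longrightarrow> t' \<in> C \<Longrightarrow> p \<in> P \<Longrightarrow>
          pair t' p \<epsilon> s \<Longrightarrow> elts p \<subseteq> elts r1 \<Longrightarrow> \<not> rel3 K r1 x t'"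
        unfolding Q_def by blast
      then have "x \<epsilon> val s" using a(6) by auto
      then obtain t' p' where t': "t' \<in> names M P" "p' \<in> G" "pair t' p' \<epsilon> s" "val t' = x"
        unfolding elts_val[OF s(1)] by blast
      have t'C: "t' \<in> C" using sC'[OF t'(3) s(2)] names_M P_M G_P t' by blast
      have xC: "x \<in> C" using x(1) a(2) Ctrans[OF uC(2)] by auto
      obtain r' where r': "r' \<in> G" "rel3 K r' x t'" using truth[OF t'(1) t'C xC] t'(4) by blast
      obtain q where q: "q \<in> G" "elts r \<subseteq> elts q" "elts p' \<subseteq> elts q" using G_directed[OF r(1) t'(2)] by blast
      obtain q' where q': "q' \<in> G" "elts q \<subseteq> elts q'" "elts r' \<subseteq> elts q'" using G_directed[OF q(1) r'(1)] by blast
      have "rel3 K q' x t'" using mono[OF r'(2)] r' q' G_P xC t'C by blast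
      then show False using x(2)[of q' t' p'] q q' t' t'C G_P by blast
    qed
    then show "\<exists>r\<in>G. \<forall>x\<in>elts W. F r x s" using r by blast
  qed
qed

end

subsection \<open>A selection principle for gamma spaces\<close>

context zfc
begin

lemma dpred_finite_Collect:
  assumes "dterm M t" "dpred M (\<lambda>e. Q (\<lambda>n. e (Suc n)) (e 0))"
  shows "dpred M (\<lambda>e. finite {x \<in> elts (t e). Q e x})"
proof -
  have "dpred M (\<lambda>e. \<exists>b\<in>M. finite (elts b) \<and> (\<forall>x\<in>M. x \<epsilon> b \<longleftrightarrow> x \<epsilon> t e \<and> Q e x))"
    using dpred_rename[OF assms(2), of "case_nat 0 (\<lambda>n. Suc (Suc n))"]
      dterm_rename[OF assms(1), of "\<lambda>n. Suc (Suc n)"]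
    by (intro dpred_ex dpred_conj dpred_finite dpred_all dpred_iff dpred_mem dterm_var) auto
  then show ?thesis
  proof (rule dpred_cong)
    fix e :: "nat \<Rightarrow> 'u" assume e: "range e \<subseteq> M"
    then have tM: "t e \<in> M" using assms(1) unfolding dterm_def by blast
    let ?S = "{x \<in> elts (t e). Q e x}"
    have SM: "?S \<subseteq> M" using trans[OF tM] by auto
    have "elts b = ?S \<longleftrightarrow> (\<forall>x\<in>M. x \<epsilon> b \<longleftrightarrow> x \<epsilon> t e \<and> Q e x)" if "b \<in> M" for b
    proof -
      have "x \<epsilon> b \<Longrightarrow> x \<in> M" "x \<epsilon> t e \<Longrightarrow> x \<in> M" for x using trans[OF that] trans[OF tM] by blast+
      then show ?thesis by (auto simp: set_eq_iff)
    qed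
    moreover have "finite ?S \<longleftrightarrow> (\<exists>b\<in>M. finite (elts b) \<and> elts b = ?S)"
    proof
      assume "finite ?S"
      then show "\<exists>b\<in>M. finite (elts b) \<and> elts b = ?S" using ex_finite_set[OF _ SM] by (metis (no_types, lifting))
    next
      assume "\<exists>b\<in>M. finite (elts b) \<and> elts b = ?S"
      then obtain b where "finite (elts b)" "elts b = ?S" by blast
      then show "finite ?S" by (simp only:)
    qed
    ultimately show "finite ?S \<longleftrightarrow> (\<exists>b\<in>M. finite (elts b) \<and> (\<forall>x\<in>M. x \<epsilon> b \<longleftrightarrow> x \<epsilon> t e \<and> Q e x))"
      by simp
  qed
qed

end

lemma finite_image_fibers:
  assumes "finite (f ` A)" "\<And>y. y \<in> f ` A \<Longrightarrow> finite {x \<in> A. f x = y}"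
  shows "finite A"
proof -
  have "A = (\<Union>y\<in>f ` A. {x \<in> A. f x = y})" by auto
  then show ?thesis using assms by (metis (no_types, lifting) finite_UN)
qed

locale ground_gamma_space = zfc M for M :: "'u::set_universe set" +
  fixes X T :: 'u
  assumes X: "X \<in> M" and T: "T \<in> M" and topology: "is_topology M X T"
    and gamma: "gamma_space M (\<lambda>U. U \<epsilon> T) X"
begin

lemma T_M: "U \<epsilon> T \<Longrightarrow> U \<in> M"
  using trans[OF T] .

lemma X_M: "x \<epsilon> X \<Longrightarrow> x \<in> M"
  using trans[OF X] .

lemma X_open: "X \<epsilon> T"
  using topology unfolding is_topology_def by blast

lemma open_subset: "U \<epsilon> T \<Longrightarrow> elts U \<subseteq> elts X"
  using topology T_M[of U] subset_in_iff[of U X] unfolding is_topology_def by blast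

lemma open_inter:
  assumes "U \<epsilon> T" "V \<epsilon> T"
  obtains W where "W \<epsilon> T" "elts W = elts U \<inter> elts V"
proof -
  have "small {x \<in> elts U. x \<epsilon> V}"
    using T_M assms by (intro small_sep small_elts dintros) auto
  moreover have "{x \<in> elts U. x \<epsilon> V} = elts U \<inter> elts V" by auto
  ultimately obtain W where W: "W \<in> M" "elts W = elts U \<inter> elts V" unfolding small_def by metis
  then have "is_inter M U V W" using is_inter_iff[OF T_M[OF assms(1)] W(1)] by blast
  then have "W \<epsilon> T" using topology assms T_M W(1) unfolding is_topology_def by blast
  then show thesis using W that by blast
qed

lemma open_Union:
  assumes "small A" "A \<subseteq> elts T"
  obtains W where "W \<epsilon> T" "elts W = (\<Union>U\<in>A. elts U)"
proof -
  obtain a where a: "a \<in> M" "A = elts a" using assms(1) by (rule smallE)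
  obtain W where W: "W \<in> M" "elts W = (\<Union>U\<in>A. elts U)" using small_Union[OF assms(1)] by (auto simp: small_def)
  then have "is_union M a W" using is_union_iff[OF a(1) elts_subset[OF W(1)]] a(2) by simp
  moreover have "subset_in M a T" using assms(2) a by (simp add: subset_in_iff)
  ultimately have "W \<epsilon> T" using topology a(1) W(1) unfolding is_topology_def by blast
  then show thesis using W that by blast
qed

lemma open_finite_Inter:
  assumes "finite A" "\<And>a. a \<in> A \<Longrightarrow> \<exists>U. U \<epsilon> T \<and> elts U = {x \<in> elts X. Q a x}"
  shows "\<exists>U. U \<epsilon> T \<and> elts U = {x \<in> elts X. \<forall>a\<in>A. Q a x}"
  using assms
proof (induction A rule: finite_induct)
  case empty
  then show ?case using X_open by auto
next
  case (insert a A)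
  then obtain U V where UV: "U \<epsilon> T" "elts U = {x \<in> elts X. Q a x}"
    "V \<epsilon> T" "elts V = {x \<in> elts X. \<forall>a\<in>A. Q a x}" by blast
  then obtain W where "W \<epsilon> T" "elts W = elts U \<inter> elts V" using open_inter by blast
  then show ?case using UV by (intro exI[of _ W]) auto
qed

text \<open>The only place where the gamma hypothesis on \<open>X\<close> enters; afterwards covers
  are small HOL sets and finiteness is that of HOL.\<close>

lemma gamma_subcover:
  assumes W: "small \<W>" "\<W> \<subseteq> elts T - {X}"
    and omega: "\<And>F. finite F \<Longrightarrow> F \<subseteq> elts X \<Longrightarrow> \<exists>U\<in>\<W>. F \<subseteq> elts U"
  obtains \<V> where "small \<V>" "\<V> \<subseteq> \<W>" "infinite \<V>" "\<And>x. x \<epsilon> X \<Longrightarrow> finite {V \<in> \<V>. \<not> x \<epsilon> V}"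
proof -
  obtain w where w: "w \<in> M" "\<W> = elts w" using W(1) by (rule smallE)
  have wT: "U \<epsilon> T \<and> U \<noteq> X" if "U \<epsilon> w" for U using that W(2) w(2) by auto
  have "omega_cover M (\<lambda>U. U \<epsilon> T) X w"
    unfolding omega_cover_def open_cover_def
  proof (intro conjI ballI impI)
    show "U \<epsilon> T" if "U \<epsilon> w" for U using wT that by blast
    have "\<exists>U\<in>elts w. x \<epsilon> U" if "x \<epsilon> X" for x using omega[of "{x}"] that w(2) by auto
    then have "elts X = (\<Union>y\<in>elts w. elts y)" using wT open_subset by fastforce
    then show "is_union M w X" using is_union_iff[OF w(1) elts_subset[OF X]] by blast
    show "\<not> subset_in M X U" if "U \<epsilon> w" for U
      using wT[OF that] open_subset[of U] subset_in_iff[OF X] by (metis elts_inject subset_antisym)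
    fix F assume "F \<in> M" "is_finite M F \<and> subset_in M F X"
    then have "finite (elts F)" "elts F \<subseteq> elts X" by (simp_all add: is_finite_iff subset_in_iff)
    then show "\<exists>U\<in>M. U \<epsilon> w \<and> subset_in M F U"
      using omega[of "elts F"] w trans[OF w(1)] \<open>F \<in> M\<close> by (auto simp: subset_in_iff)
  qed
  then obtain v where v: "v \<in> M" "subset_in M v w" "gamma_cover M (\<lambda>U. U \<epsilon> T) X v"
    using gamma w(1) unfolding gamma_space_def by blast
  show thesis
  proof (rule that[of "elts v"])
    show "small (elts v)" "elts v \<subseteq> \<W>" using v w by (simp_all add: subset_in_iff)
    show "infinite (elts v)" using v(1,3) unfolding gamma_cover_def by (simp add: is_finite_iff)
    fix x assume x: "x \<epsilon> X"
    then obtain F where F: "F \<in> M" "is_finite M F" "\<forall>U\<in>M. U \<epsilon> F \<longleftrightarrow> U \<epsilon> v \<and> \<not> x \<epsilon> U"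
      using v(3) X_M unfolding gamma_cover_def by blast
    have "{V \<in> elts v. \<not> x \<epsilon> V} \<subseteq> elts F" using F(3) trans[OF v(1)] by auto
    then show "finite {V \<in> elts v. \<not> x \<epsilon> V}"
      using F(1,2) is_finite_iff finite_subset by blast
  qed
qed

text \<open>A gamma subcover of all proper open sets is thinned out to an injective sequence.
  Injectivity turns "all but finitely many members" into "all but finitely many indices".\<close>

lemma ex_gamma_sequence:
  assumes omega: "\<And>F. finite F \<Longrightarrow> F \<subseteq> elts X \<Longrightarrow> \<exists>U. U \<epsilon> T \<and> U \<noteq> X \<and> F \<subseteq> elts U"
  obtains V where "dterm M (\<lambda>e. V (e 0))" "\<And>n. V (num n) \<epsilon> T \<and> V (num n) \<noteq> X"
    "\<And>x. x \<epsilon> X \<Longrightarrow> finite {n. \<not> x \<epsilon> V (num n)}"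
proof -
  have "small {U \<in> elts T. U \<noteq> X}" by (intro small_sep small_elts dintros T X)
  then obtain \<V> where \<V>: "small \<V>" "\<V> \<subseteq> {U \<in> elts T. U \<noteq> X}" "infinite \<V>"
    "\<And>x. x \<epsilon> X \<Longrightarrow> finite {V \<in> \<V>. \<not> x \<epsilon> V}"
    by (rule gamma_subcover[of "{U \<in> elts T. U \<noteq> X}"]) (use omega in auto)
  define A where "A = {E \<in> {b \<in> M. elts b \<subseteq> \<V>}. finite (elts E)}"
  have "small A" unfolding A_def by (intro small_sep small_Pow \<V> dintros)
  moreover have "dpred M (\<lambda>e. \<not> e 1 \<epsilon> e 0)" by (intro dintros)
  moreover have "\<exists>y\<in>\<V>. \<not> y \<epsilon> E" if "E \<in> A" for E
  proof -
    have "\<not> \<V> \<subseteq> elts E" using that \<V>(3) finite_subset unfolding A_def by blast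
    then show ?thesis by auto
  qed
  ultimately obtain c where c: "\<And>E. E \<in> A \<Longrightarrow> c E \<in> \<V> \<and> \<not> c E \<epsilon> E" "dterm M (\<lambda>e. c (e 0))"
    using small_choice[OF _ \<V>(1), of A "\<lambda>x y. \<not> y \<epsilon> x"] by blast
  note cT = dterm_subst1[OF c(2)]
  obtain E where E: "E (num 0) = num 0" "\<And>n. E (num (Suc n)) = adjoin (E (num n)) (c (E (num n)))"
    "dterm M (\<lambda>e. E (e 0))"
    using omega_recursion[of "num 0" "\<lambda>n y. adjoin y (c y)"] cT dterm_adjoin dterm_var num_closed
    by blast
  have EA: "E (num n) \<in> A" for n
  proof (induction n)
    case 0
    then show ?case unfolding A_def by (simp add: E elts_num)
  next
    case (Suc n)
    then have "c (E (num n)) \<in> M" using c \<V>(1) small_subset by blast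
    then show ?case using Suc c(1)[OF Suc] adjoin[of "E (num n)" "c (E (num n))"]
      unfolding A_def E by auto
  qed
  define V where "V x = c (E x)" for x
  have V\<V>: "V (num n) \<in> \<V>" for n unfolding V_def using c(1)[OF EA] by blast
  have VE: "V (num m) \<epsilon> E (num n)" if "m < n" for m n
    using that
  proof (induction n)
    case (Suc n)
    have "E (num n) \<in> M" "V (num n) \<in> M" using EA A_def V\<V> \<V>(1) small_subset by blast+
    then have "elts (E (num (Suc n))) = insert (V (num n)) (elts (E (num n)))"
      unfolding E V_def by (simp add: adjoin)
    then show ?case using Suc less_Suc_eq by (metis in_elts insert_iff)
  qed simp
  have "V (num m) \<noteq> V (num n)" if "m < n" for m n
    using VE[OF that] c(1)[OF EA[of n]] unfolding V_def by metis
  then have inj: "inj (\<lambda>n. V (num n))" by (metis injI linorder_neqE_nat)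
  show thesis
  proof (rule that[of V])
    show "dterm M (\<lambda>e. V (e 0))" unfolding V_def by (intro cT E)
    show "V (num n) \<epsilon> T \<and> V (num n) \<noteq> X" for n using V\<V> \<V>(2) by auto
    fix x assume "x \<epsilon> X"
    have "(\<lambda>n. V (num n)) ` {n. \<not> x \<epsilon> V (num n)} \<subseteq> {V \<in> \<V>. \<not> x \<epsilon> V}" using V\<V> by auto
    then have "finite ((\<lambda>n. V (num n)) ` {n. \<not> x \<epsilon> V (num n)})"
      using \<V>(4)[OF \<open>x \<epsilon> X\<close>] finite_subset by blast
    then show "finite {n. \<not> x \<epsilon> V (num n)}"
      by (rule finite_imageD) (use inj in \<open>simp add: inj_on_def\<close>)
  qed
qed

text \<open>
  The selection principle of Gerlits and Nagy. Refining by the fixed sequence \<open>V\<close> forces a gamma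
  subcover to use each level only finitely often; this replaces the usual removal of points, which
  would need them to be closed.
\<close>

lemma selection:
  assumes V: "dterm M (\<lambda>e. V (e 0))" "\<And>n. V (num n) \<epsilon> T \<and> V (num n) \<noteq> X"
    and Z: "small Z" and O: "dpred M (\<lambda>e. O' (e 0) (e 1))" and L: "dpred M (\<lambda>e. L (e 0) (e 1))"
    and L_fun: "\<And>w m n. L w (num m) \<Longrightarrow> L w (num n) \<Longrightarrow> w \<in> Z \<Longrightarrow> m = n"
    and O_open: "\<And>w. w \<in> Z \<Longrightarrow> \<exists>U. U \<epsilon> T \<and> elts U = {x \<in> elts X. O' w x}"
    and cover: "\<And>F. finite F \<Longrightarrow> F \<subseteq> elts X \<Longrightarrow>
       \<exists>w\<in>Z. \<exists>n. L w (num n) \<and> F \<subseteq> elts (V (num n)) \<and> (\<forall>x\<in>F. O' w x)"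
  obtains Y where "small Y" "Y \<subseteq> Z" "infinite Y" "\<And>n. finite {w \<in> Y. L w (num n)}"
    "\<And>x. x \<epsilon> X \<Longrightarrow> finite {w \<in> Y. \<not> O' w x}"
proof -
  note VT = dterm_subst1[OF V(1)] and OT = dpred_subst2[OF O] and LT = dpred_subst2[OF L]
  \<comment> \<open>\<open>R W w\<close> says that index \<open>w\<close> accounts for
    \<open>W\<close> at one of its levels. Members of the refined cover lie inside some
    \<open>V n\<close>, hence are proper even if the set given by \<open>O'\<close> is all of
    \<open>X\<close>.\<close>
  define R where "R W w \<longleftrightarrow> (\<exists>n\<in>omega. L w n \<and> elts W \<subseteq> elts (V n) \<and> (\<forall>x\<in>elts W. O' w x))" for W w
  have R: "dpred M (\<lambda>e. R (e 0) (e 1))"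
    unfolding R_def by (intro VT OT LT dintros small_omega)
  note RT = dpred_subst2[OF R]
  define \<W> where "\<W> = {W \<in> elts T. \<exists>w\<in>Z. R W w}"
  have "small \<W>" unfolding \<W>_def by (intro small_sep small_elts T RT dintros Z)
  moreover have "\<W> \<subseteq> elts T - {X}"
  proof -
    have False if "X \<in> \<W>"
    proof -
      obtain n where "elts X \<subseteq> elts (V (num n))"
        using \<open>X \<in> \<W>\<close> unfolding \<W>_def R_def omega_def by blast
      then show False using V(2)[of n] open_subset[of "V (num n)"] by (metis elts_inject subset_antisym)
    qed
    then show ?thesis unfolding \<W>_def by auto
  qed
  moreover have "\<exists>U\<in>\<W>. F \<subseteq> elts U" if F: "finite F" "F \<subseteq> elts X" for F
  proof -
    obtain w n where w: "w \<in> Z" "L w (num n)" "F \<subseteq> elts (V (num n))" "\<forall>x\<in>F. O' w x"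
      using cover[OF F] by blast
    obtain U where U: "U \<epsilon> T" "elts U = {x \<in> elts X. O' w x}" using O_open[OF w(1)] by blast
    obtain W where W: "W \<epsilon> T" "elts W = elts U \<inter> elts (V (num n))" using open_inter[OF U(1)] V(2) by blast
    have "R W w" unfolding R_def using w(2) W(2) U(2) by (intro bexI[of _ "num n"]) auto
    then have "W \<in> \<W>" unfolding \<W>_def using W(1) w(1) by auto
    moreover have "F \<subseteq> elts W" unfolding W(2) U(2) using F(2) w(3,4) by auto
    ultimately show ?thesis by blast
  qed
  ultimately obtain \<V> where \<V>: "small \<V>" "\<V> \<subseteq> \<W>" "infinite \<V>" "\<And>x. x \<epsilon> X \<Longrightarrow> finite {V \<in> \<V>. \<not> x \<epsilon> V}"
    using gamma_subcover[of \<W>] by blast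
  have "\<And>W. W \<in> \<V> \<Longrightarrow> \<exists>w\<in>Z. R W w" using \<V>(2) unfolding \<W>_def by blast
  then obtain f where f: "\<And>W. W \<in> \<V> \<Longrightarrow> f W \<in> Z \<and> R W (f W)" "dterm M (\<lambda>e. f (e 0))"
    using small_choice[OF \<V>(1) Z R] by blast
  \<comment> \<open>A point outside \<open>V n\<close> is missed by every \<open>W\<close> inside
    \<open>V n\<close>, and a gamma cover has only finitely many such members. Both the infinity of
    the selected indices and the finiteness of each level follow.\<close>
  have below: "finite {W \<in> \<V>. elts W \<subseteq> elts (V (num n))}" for n
  proof -
    obtain x where x: "x \<epsilon> X" "\<not> x \<epsilon> V (num n)"
      using V(2)[of n] open_subset[of "V (num n)"] by (metis elts_inject in_elts subsetI subset_antisym)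
    have "{W \<in> \<V>. elts W \<subseteq> elts (V (num n))} \<subseteq> {V \<in> \<V>. \<not> x \<epsilon> V}" using x(2) by auto
    then show ?thesis using \<V>(4)[OF x(1)] finite_subset by blast
  qed
  have level: "elts W \<subseteq> elts (V (num n))" if W: "W \<in> \<V>" "L (f W) (num n)" for W n
  proof -
    obtain k where "k \<in> omega" "L (f W) k" "elts W \<subseteq> elts (V k)" using f(1)[OF W(1)] unfolding R_def by blast
    then show ?thesis using L_fun[OF _ W(2)] f(1)[OF W(1)] by (auto elim!: omegaE)
  qed
  show thesis
  proof (rule that[of "f ` \<V>"])
    show "small (f ` \<V>)" by (rule small_image[OF \<V>(1) f(2)])
    show "f ` \<V> \<subseteq> Z" using f(1) by blast
    show "infinite (f ` \<V>)"
    proof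
      assume "finite (f ` \<V>)"
      then have "finite \<V>"
      proof (rule finite_image_fibers)
        fix y assume "y \<in> f ` \<V>"
        then obtain W where "W \<in> \<V>" "y = f W" by blast
        then obtain n where n: "L y (num n)" using f(1) unfolding R_def by (metis omegaE)
        have "{x \<in> \<V>. f x = y} \<subseteq> {W \<in> \<V>. elts W \<subseteq> elts (V (num n))}" using level n by blast
        then show "finite {x \<in> \<V>. f x = y}" using below finite_subset by blast
      qed
      then show False using \<V>(3) by blast
    qed
    show "finite {w \<in> f ` \<V>. L w (num n)}" for n
    proof -
      have "{w \<in> f ` \<V>. L w (num n)} \<subseteq> f ` {W \<in> \<V>. elts W \<subseteq> elts (V (num n))}" using level by blast
      then show ?thesis using below finite_subset by blast
    qed
    show "finite {w \<in> f ` \<V>. \<not> O' w x}" if "x \<epsilon> X" for x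
    proof -
      have "O' (f W) x" if "W \<in> \<V>" "x \<epsilon> W" for W
        using f(1)[OF that(1)] that(2) unfolding R_def by auto
      then have "{w \<in> f ` \<V>. \<not> O' w x} \<subseteq> f ` {W \<in> \<V>. \<not> x \<epsilon> W}" by blast
      then show ?thesis using \<V>(4)[OF that] finite_subset by blast
    qed
  qed
qed

end

subsection \<open>The Cohen poset\<close>

context zfc
begin

definition two :: "'u set" where
  "two = {num 0, num 1}"

lemma small_two: "small two" and finite_two: "finite two"
  unfolding two_def by (auto intro: small_finite)

definition coords :: "'u \<Rightarrow> 'u set" where
  "coords I = product (elts I) omega"

lemma small_coords: "I \<in> M \<Longrightarrow> small (coords I)"
  unfolding coords_def by (intro small_product small_omega) simp

lemma cohen_iff:
  assumes I: "I \<in> M"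
  shows "p \<in> cohen_forcing M I \<longleftrightarrow> p \<in> M \<and> finite (elts p) \<and> elts p \<subseteq> product (coords I) two \<and>
    (\<forall>d\<in>M. \<forall>a\<in>M. \<forall>b\<in>M. pair d a \<epsilon> p \<and> pair d b \<epsilon> p \<longrightarrow> a = b)"
proof (cases "p \<in> M")
  case p: True
  have two: "(is_empty M e \<or> (\<exists>c\<in>M. is_empty M c \<and> is_succ M c e)) \<longleftrightarrow> e \<in> two" if e: "e \<in> M" for e
  proof -
    have em: "is_empty M c \<longleftrightarrow> c = num 0" if "c \<in> M" for c
    proof -
      have "elts c = {} \<longleftrightarrow> elts c = elts (num 0)" by (simp add: elts_num)
      then show ?thesis using that by (simp add: is_empty_iff)
    qed
    have "is_succ M (num 0) e \<longleftrightarrow> elts e = elts (num 1)"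
      using e by (simp add: is_succ_iff elts_num lessThan_Suc)
    then have "is_succ M (num 0) e \<longleftrightarrow> e = num 1" by simp
    then show ?thesis using e unfolding two_def by (auto simp: em)
  qed
  have twoM: "e \<in> M" if "e \<in> two" for e using small_subset[OF small_two that] .
  have IM: "i \<in> M" if "i \<epsilon> I" for i using trans[OF I that] .
  have om: "n \<in> M \<and> is_natural M n \<longleftrightarrow> n \<in> omega" for n
    using is_natural_iff unfolding omega_def by auto
  have "(\<exists>i\<in>M. \<exists>n\<in>M. \<exists>d\<in>M. \<exists>e\<in>M. i \<epsilon> I \<and> is_natural M n \<and> is_pair M i n d \<and>
          (is_empty M e \<or> (\<exists>c\<in>M. is_empty M c \<and> is_succ M c e)) \<and> is_pair M d e z)
      \<longleftrightarrow> z \<in> product (coords I) two" (is "?L \<longleftrightarrow> ?R") if z: "z \<in> M" for z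
  proof
    assume ?L
    then obtain i n d e where *: "i \<in> M" "n \<in> M" "d \<in> M" "e \<in> M" "i \<epsilon> I" "is_natural M n"
      "is_pair M i n d" "e \<in> two" "is_pair M d e z" using two by blast
    then have "d = pair i n" "z = pair d e" "n \<in> omega" using z is_pair_iff om by blast+
    then show ?R using * unfolding product_def coords_def by auto
  next
    assume ?R
    then obtain i n e where *: "i \<epsilon> I" "n \<in> omega" "e \<in> two" "z = pair (pair i n) e"
      unfolding product_def coords_def by auto
    then have "i \<in> M" "n \<in> M" "e \<in> M" using IM om twoM by blast+
    moreover from this have "pair i n \<in> M" "is_pair M i n (pair i n)" "is_pair M (pair i n) e z"
      using *(4) by (simp_all add: is_pair_iff)
    ultimately show ?L using *(1-3) two om by blast
  qed
  moreover have "z \<epsilon> p \<Longrightarrow> z \<in> M" for z using trans[OF p] .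
  ultimately have "(\<forall>z\<in>M. z \<epsilon> p \<longrightarrow> (\<exists>i\<in>M. \<exists>n\<in>M. \<exists>d\<in>M. \<exists>e\<in>M. i \<epsilon> I \<and> is_natural M n \<and> is_pair M i n d \<and>
          (is_empty M e \<or> (\<exists>c\<in>M. is_empty M c \<and> is_succ M c e)) \<and> is_pair M d e z))
      \<longleftrightarrow> elts p \<subseteq> product (coords I) two" by (auto simp: subset_iff)
  then show ?thesis
    unfolding cohen_forcing_def using p by (simp add: is_finite_iff maps_to_iff)
qed (simp add: cohen_forcing_def)

lemma small_cohen:
  assumes I: "I \<in> M"
  shows "small (cohen_forcing M I)"
proof -
  have "small {p \<in> {b \<in> M. elts b \<subseteq> product (coords I) two}. finite (elts p) \<and>
    (\<forall>d\<in>M. \<forall>a\<in>M. \<forall>b\<in>M. pair d a \<epsilon> p \<and> pair d b \<epsilon> p \<longrightarrow> a = b)}"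
    by (intro small_sep small_Pow small_product small_coords small_two I dintros)
  moreover have "{p \<in> {b \<in> M. elts b \<subseteq> product (coords I) two}. finite (elts p) \<and>
    (\<forall>d\<in>M. \<forall>a\<in>M. \<forall>b\<in>M. pair d a \<epsilon> p \<and> pair d b \<epsilon> p \<longrightarrow> a = b)} = cohen_forcing M I"
    using cohen_iff[OF I] by blast
  ultimately show ?thesis by simp
qed

lemma empty_cohen: "I \<in> M \<Longrightarrow> num 0 \<in> cohen_forcing M I"
  by (simp add: cohen_iff elts_num eps_num)

end

context zfc
begin

definition cdom :: "'u \<Rightarrow> 'u \<Rightarrow> bool" where
  "cdom p d \<longleftrightarrow> (\<exists>a\<in>two. pair d a \<epsilon> p)"

lemma dpred_cdom: "dterm M s \<Longrightarrow> dterm M t \<Longrightarrow> dpred M (\<lambda>e. cdom (s e) (t e))"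
proof (rule dpred_subst2[of M cdom])
  show "dpred M (\<lambda>e. cdom (e 0) (e 1))" unfolding cdom_def by (intro dintros small_two)
qed

lemma two_M: "a \<in> two \<Longrightarrow> a \<in> M"
  using small_subset[OF small_two] .

lemma cohen_elem:
  assumes "I \<in> M" "p \<in> cohen_forcing M I" "z \<epsilon> p"
  obtains d a where "d \<in> coords I" "a \<in> two" "z = pair d a" "cdom p d"
proof -
  have "z \<in> product (coords I) two" using assms cohen_iff[OF assms(1), of p] by auto
  then show thesis using that assms(3) unfolding product_def cdom_def by blast
qed

lemma finite_cdom:
  assumes I: "I \<in> M" and p: "p \<in> cohen_forcing M I"
  shows "finite {d \<in> coords I. cdom p d}"
proof -
  note CM = small_subset[OF small_coords[OF I]]
  define f where "f z = (SOME d. d \<in> M \<and> (\<exists>a\<in>M. z = pair d a))" for z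
  have f: "f (pair d a) = d" if "d \<in> M" "a \<in> M" for d a
    unfolding f_def by (rule some_equality) (use that in \<open>auto simp: pair_inject\<close>)
  have "{d \<in> coords I. cdom p d} \<subseteq> f ` elts p"
  proof
    fix d assume "d \<in> {d \<in> coords I. cdom p d}"
    then obtain a where "d \<in> M" "a \<in> M" "pair d a \<in> elts p" using CM two_M unfolding cdom_def by auto
    then show "d \<in> f ` elts p" using f by (metis imageI)
  qed
  moreover have "finite (elts p)" using p cohen_iff[OF I] by blast
  ultimately show ?thesis using finite_subset by blast
qed

text \<open>A condition is a set of pairs with coordinate in \<open>B\<close> and one of two values.
  This bound keeps every stage of the closure argument finite.\<close>

lemma finite_cohen_below:
  assumes I: "I \<in> M" and B: "finite B"
  shows "finite {q \<in> cohen_forcing M I. \<forall>d\<in>coords I. cdom q d \<longrightarrow> d \<in> B}"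
proof (rule finite_imageD[of elts])
  have "elts ` {q \<in> cohen_forcing M I. \<forall>d\<in>coords I. cdom q d \<longrightarrow> d \<in> B} \<subseteq>
      Pow ((\<lambda>(d, a). pair d a) ` (B \<times> two))"
  proof clarify
    fix q z assume q: "q \<in> cohen_forcing M I" "\<forall>d\<in>coords I. cdom q d \<longrightarrow> d \<in> B" "z \<in> elts q"
    then obtain d a where "d \<in> coords I" "a \<in> two" "z = pair d a" "cdom q d"
      using cohen_elem[OF I q(1), of z] by auto
    then show "z \<in> (\<lambda>(d, a). pair d a) ` (B \<times> two)" using q(2) by auto
  qed
  then show "finite (elts ` {q \<in> cohen_forcing M I. \<forall>d\<in>coords I. cdom q d \<longrightarrow> d \<in> B})"
    using B finite_two by (meson finite_Pow_iff finite_SigmaI finite_imageI finite_subset)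
qed (simp add: inj_on_def)

text \<open>An arbitrary HOL predicate \<open>Q\<close> is admissible, because the restriction is a
  finite subset of \<open>M\<close> and therefore an element of \<open>M\<close>.\<close>

lemma cohen_restrict:
  assumes I: "I \<in> M" and p: "p \<in> cohen_forcing M I"
  obtains q where "q \<in> cohen_forcing M I" "\<And>z. z \<epsilon> q \<longleftrightarrow> z \<epsilon> p \<and> (\<exists>d\<in>coords I. \<exists>a\<in>two. z = pair d a \<and> Q d)"
proof -
  have p': "p \<in> M" "finite (elts p)" "elts p \<subseteq> product (coords I) two"
    "\<And>d a b. d \<in> M \<Longrightarrow> a \<in> M \<Longrightarrow> b \<in> M \<Longrightarrow> pair d a \<epsilon> p \<Longrightarrow> pair d b \<epsilon> p \<Longrightarrow> a = b"
    using p unfolding cohen_iff[OF I] by blast+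
  define S where "S = {z \<in> elts p. \<exists>d\<in>coords I. \<exists>a\<in>two. z = pair d a \<and> Q d}"
  have "finite S" unfolding S_def by (rule finite_subset[OF _ p'(2)]) auto
  moreover have "S \<subseteq> M" unfolding S_def using trans[OF p'(1)] by auto
  ultimately obtain q where q: "q \<in> M" "elts q = S" using ex_finite_set by blast
  have qi: "z \<epsilon> q \<longleftrightarrow> z \<epsilon> p \<and> (\<exists>d\<in>coords I. \<exists>a\<in>two. z = pair d a \<and> Q d)" for z
    unfolding in_elts[symmetric, of z q] q(2) S_def by simp
  have "finite (elts q)" "elts q \<subseteq> product (coords I) two"
    using q(2) \<open>finite S\<close> p'(3) unfolding S_def by auto
  then have "q \<in> cohen_forcing M I"
    unfolding cohen_iff[OF I] using q(1) p'(4) qi by blast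
  then show thesis using qi that by blast
qed

lemma cohen_union:
  assumes I: "I \<in> M" and p: "p \<in> cohen_forcing M I" and r: "r \<in> cohen_forcing M I"
    and agree: "\<And>d a b. d \<in> coords I \<Longrightarrow> a \<in> two \<Longrightarrow> b \<in> two \<Longrightarrow> pair d a \<epsilon> p \<Longrightarrow> pair d b \<epsilon> r \<Longrightarrow> a = b"
  shows "\<exists>s\<in>cohen_forcing M I. elts p \<subseteq> elts s \<and> elts r \<subseteq> elts s"
proof -
  note CM = small_subset[OF small_coords[OF I]]
  have p': "p \<in> M" "finite (elts p)" "elts p \<subseteq> product (coords I) two"
    "\<And>d a b. d \<in> M \<Longrightarrow> a \<in> M \<Longrightarrow> b \<in> M \<Longrightarrow> pair d a \<epsilon> p \<Longrightarrow> pair d b \<epsilon> p \<Longrightarrow> a = b"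
    using p unfolding cohen_iff[OF I] by blast+
  have r': "r \<in> M" "finite (elts r)" "elts r \<subseteq> product (coords I) two"
    "\<And>d a b. d \<in> M \<Longrightarrow> a \<in> M \<Longrightarrow> b \<in> M \<Longrightarrow> pair d a \<epsilon> r \<Longrightarrow> pair d b \<epsilon> r \<Longrightarrow> a = b"
    using r unfolding cohen_iff[OF I] by blast+
  have "finite (elts p \<union> elts r)" "elts p \<union> elts r \<subseteq> M"
    using p'(2) r'(2) elts_subset p'(1) r'(1) by auto
  then obtain s where s: "s \<in> M" "elts s = elts p \<union> elts r" using ex_finite_set by blast
  have si: "z \<epsilon> s \<longleftrightarrow> z \<epsilon> p \<or> z \<epsilon> r" for z
    unfolding in_elts[symmetric, of z s] s(2) by simp
  have dom: "d \<in> coords I \<and> a \<in> two" if "pair d a \<epsilon> x" "x = p \<or> x = r" "d \<in> M" "a \<in> M" for d a x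
  proof -
    have "pair d a \<in> product (coords I) two" using that(1,2) p'(3) r'(3) by auto
    then obtain d' a' where da: "d' \<in> coords I" "a' \<in> two" "pair d a = pair d' a'" unfolding product_def by blast
    then have "d' \<in> M" "a' \<in> M" using CM two_M by blast+
    then have "d = d'" "a = a'" using da(3) that(3,4) by (simp_all add: pair_inject)
    then show ?thesis using da by blast
  qed
  have "a = b" if d: "d \<in> M" "a \<in> M" "b \<in> M" "pair d a \<epsilon> s" "pair d b \<epsilon> s" for d a b
  proof -
    have da: "d \<in> coords I" "a \<in> two" using dom[of d a] d si by blast+
    have db: "b \<in> two" using dom[of d b] d si by blast
    show ?thesis using d(4,5) p'(4)[OF d(1-3)] r'(4)[OF d(1-3)] agree[OF da db] agree[OF da(1) db da(2)]
      unfolding si by blast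
  qed
  moreover have "finite (elts s)" "elts s \<subseteq> product (coords I) two" using s(2) p'(2,3) r'(2,3) by auto
  ultimately have "s \<in> cohen_forcing M I" unfolding cohen_iff[OF I] using s(1) by blast
  then show ?thesis using s(2) by blast
qed

lemma finite_pair_section:
  assumes "finite {w \<in> W. \<exists>z\<in>Z. w = pair z k}" "Z \<subseteq> M" "k \<in> M"
  shows "finite {z \<in> Z. pair z k \<in> W}"
proof (rule finite_imageD[of "\<lambda>z. pair z k"])
  show "finite ((\<lambda>z. pair z k) ` {z \<in> Z. pair z k \<in> W})"
    by (rule finite_subset[OF _ assms(1)]) auto
  show "inj_on (\<lambda>z. pair z k) {z \<in> Z. pair z k \<in> W}"
    using assms(2,3) by (auto simp: inj_on_def pair_inject subset_iff)
qed

end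

subsection \<open>Selecting a name\<close>

text \<open>
  Every condition \<open>q\<close> has its own gamma cover of indices \<open>Y q\<close>. Closing a finite set of coordinates
  under the conditions that occur in these covers takes \<open>\<omega>\<close> steps \<open>B n\<close>, each of them finite.
  Conditions supported on \<open>\<Union>n. B n\<close> only see indices whose conditions are supported there as well,
  so diagonalising over this countable part of the poset suffices even when \<open>I\<close> is uncountable.
\<close>

lemma (in ground_gamma_space) cohen_selection:
  fixes I Z q0 rc O'
  defines "P \<equiv> cohen_forcing M I"
  assumes I: "I \<in> M" and Z: "small Z" and rc: "dterm M (\<lambda>e. rc (e 0))"
    and rc_P: "\<And>z. z \<in> Z \<Longrightarrow> rc z \<in> P" and O: "dpred M (\<lambda>e. O' (e 0) (e 1))"
    and O_open: "\<And>z. z \<in> Z \<Longrightarrow> \<exists>U. U \<epsilon> T \<and> elts U = {x \<in> elts X. O' z x}"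
    and q0: "q0 \<in> P"
    and omega: "\<And>F. finite F \<Longrightarrow> F \<subseteq> elts X \<Longrightarrow> \<exists>U. U \<epsilon> T \<and> U \<noteq> X \<and> F \<subseteq> elts U"
    and dense: "\<And>q F. q \<in> P \<Longrightarrow> elts q0 \<subseteq> elts q \<Longrightarrow> finite F \<Longrightarrow> F \<subseteq> elts X \<Longrightarrow>
      \<exists>z\<in>Z. elts q \<subseteq> elts (rc z) \<and> (\<forall>x\<in>F. O' z x)"
  obtains S where "small S" "S \<subseteq> Z" "\<And>x. x \<epsilon> X \<Longrightarrow> finite {z \<in> S. \<not> O' z x}"
    "\<And>p F. p \<in> P \<Longrightarrow> elts q0 \<subseteq> elts p \<Longrightarrow> finite F \<Longrightarrow> F \<subseteq> elts X \<Longrightarrow>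
      \<exists>z\<in>S. (\<forall>x\<in>F. O' z x) \<and> (\<exists>p'\<in>P. elts p \<subseteq> elts p' \<and> elts (rc z) \<subseteq> elts p')"
proof -
  note rcT = dterm_subst1[OF rc] and OT = dpred_subst2[OF O]
  note ZM = small_subset[OF Z]
  define C where "C = coords I"
  have C: "small C" and P: "small P" unfolding C_def P_def using small_coords small_cohen I by blast+
  note CM = small_subset[OF C] and PM = small_subset[OF P]
  have omM: "n \<in> M" if "n \<in> omega" for n using that by (auto elim!: omegaE)
  obtain V where V: "dterm M (\<lambda>e. V (e 0))" "\<And>n. V (num n) \<epsilon> T \<and> V (num n) \<noteq> X"
    "\<And>x. x \<epsilon> X \<Longrightarrow> finite {n. \<not> x \<epsilon> V (num n)}"
    using ex_gamma_sequence[OF omega] by blast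
  have V_ex: "\<exists>n. F \<subseteq> elts (V (num n))" if F: "finite F" "F \<subseteq> elts X" for F
  proof -
    have "finite (\<Union>x\<in>F. {n. \<not> x \<epsilon> V (num n)})" using F V(3) by auto
    then obtain n where "n \<notin> (\<Union>x\<in>F. {n. \<not> x \<epsilon> V (num n)})" using ex_new_if_finite infinite_UNIV_nat by blast
    then have "F \<subseteq> elts (V (num n))" by auto
    then show ?thesis by blast
  qed
  define A where "A = {q \<in> P. elts q0 \<subseteq> elts q}"
  have A: "small A" unfolding A_def using q0 PM by (intro small_sep P dintros)

  \<comment> \<open>Each \<open>z\<close> is offered at every level: the first selection runs over
    pairs \<open>(z, n)\<close>, and \<open>L1\<close> reads off the level.\<close>
  define O1 where "O1 w x \<longleftrightarrow> (\<exists>z\<in>Z. \<exists>n\<in>omega. w = pair z n \<and> O' z x)" for w x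
  define L1 where "L1 w n \<longleftrightarrow> (\<exists>z\<in>Z. w = pair z n)" for w n
  have O1_pair: "O1 (pair z n) x \<longleftrightarrow> O' z x" if "z \<in> Z" "n \<in> omega" for z n x
    using that ZM omM unfolding O1_def by (auto simp: pair_inject)
  have O1: "dpred M (\<lambda>e. O1 (e 0) (e 1))" unfolding O1_def by (intro OT dintros Z small_omega)
  have L1: "dpred M (\<lambda>e. L1 (e 0) (e 1))" unfolding L1_def by (intro dintros Z)
  note O1T = dpred_subst2[OF O1] and L1T = dpred_subst2[OF L1]
  define Y1 where "Y1 q = {w \<in> product Z omega. \<exists>z\<in>Z. \<exists>n\<in>omega. w = pair z n \<and> elts q \<subseteq> elts (rc z)}" for q
  \<comment> \<open>The outcome of the selection for \<open>q\<close> is written as a definable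
    relation, so that choice in \<open>M\<close> can pick a cover for all \<open>q\<close> at
    once.\<close>
  define R where "R q Y \<longleftrightarrow> (\<forall>w\<in>elts Y. \<exists>z\<in>Z. \<exists>n\<in>omega. w = pair z n \<and> elts q \<subseteq> elts (rc z)) \<and>
    \<not> finite (elts Y) \<and> (\<forall>n\<in>omega. finite {w \<in> elts Y. L1 w n}) \<and>
    (\<forall>x\<in>elts X. finite {w \<in> elts Y. \<not> O1 w x})" for q Y
  have R: "dpred M (\<lambda>e. R (e 0) (e 1))"
    unfolding R_def by (intro dpred_finite_Collect rcT O1T L1T dintros Z small_omega X)
  have ex: "\<exists>Y\<in>{Y \<in> M. elts Y \<subseteq> product Z omega}. R q Y" if q: "q \<in> A" for q
  proof -
    have qP: "q \<in> P" "q \<in> M" "elts q0 \<subseteq> elts q" using q PM unfolding A_def by blast+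
    obtain Y where Y: "small Y" "Y \<subseteq> Y1 q" "infinite Y" "\<And>n. finite {w \<in> Y. L1 w (num n)}"
      "\<And>x. x \<epsilon> X \<Longrightarrow> finite {w \<in> Y. \<not> O1 w x}"
    proof (rule selection[OF V(1,2) _ O1 L1, of "Y1 q"])
      show "small (Y1 q)"
        unfolding Y1_def by (intro small_sep small_product Z small_omega rcT dintros qP)
      show "m = n" if "L1 w (num m)" "L1 w (num n)" for w m n
        using that ZM unfolding L1_def by (auto simp: pair_inject)
      show "\<exists>U. U \<epsilon> T \<and> elts U = {x \<in> elts X. O1 w x}" if "w \<in> Y1 q" for w
        using that O_open O1_pair unfolding Y1_def by fastforce
      fix F assume F: "finite F" "F \<subseteq> elts X"
      obtain z where z: "z \<in> Z" "elts q \<subseteq> elts (rc z)" "\<forall>x\<in>F. O' z x" using dense[OF qP(1,3) F] by blast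
      obtain n where n: "F \<subseteq> elts (V (num n))" using V_ex[OF F] by blast
      have "pair z (num n) \<in> Y1 q" unfolding Y1_def product_def using z num_in_omega by blast
      moreover have "L1 (pair z (num n)) (num n)" unfolding L1_def using z by blast
      ultimately show "\<exists>w\<in>Y1 q. \<exists>n. L1 w (num n) \<and> F \<subseteq> elts (V (num n)) \<and> (\<forall>x\<in>F. O1 w x)"
        using n z O1_pair[OF z(1) num_in_omega] by blast
    qed blast
    obtain y where y: "y \<in> M" "Y = elts y" using Y(1) by (rule smallE)
    have "R q y"
      unfolding R_def
    proof (intro conjI ballI)
      show "\<exists>z\<in>Z. \<exists>n\<in>omega. w = pair z n \<and> elts q \<subseteq> elts (rc z)" if "w \<in> elts y" for w
        using that Y(2) unfolding y(2) Y1_def by blast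
      show "infinite (elts y)" using Y(3) unfolding y(2) .
      show "finite {w \<in> elts y. L1 w n}" if "n \<in> omega" for n
        using that Y(4) unfolding y(2) omega_def by blast
      show "finite {w \<in> elts y. \<not> O1 w x}" if "x \<in> elts X" for x
        using Y(5)[of x] that unfolding y(2) by simp
    qed
    moreover have "elts y \<subseteq> product Z omega" using Y(2) unfolding y(2) Y1_def by blast
    ultimately show ?thesis using y(1) by blast
  qed
  obtain Yf where Yf': "\<And>q. q \<in> A \<Longrightarrow> Yf q \<in> {Y \<in> M. elts Y \<subseteq> product Z omega} \<and> R q (Yf q)"
      "dterm M (\<lambda>e. Yf (e 0))"
  proof (rule small_choice[OF A small_Pow[OF small_product[OF Z small_omega]] R ex])
    fix F assume "\<And>q. q \<in> A \<Longrightarrow> F q \<in> {Y \<in> M. elts Y \<subseteq> product Z omega} \<and> R q (F q)"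
      "dterm M (\<lambda>e. F (e 0))"
    then show thesis by (rule that)
  qed
  then have Yf: "\<And>q. q \<in> A \<Longrightarrow> R q (Yf q)" "dterm M (\<lambda>e. Yf (e 0))" by simp_all
  note YfT = dterm_subst1[OF Yf(2)]
  have Yf_finite: "finite {z \<in> Z. pair z (num k) \<epsilon> Yf q}" if "q \<in> A" for q k
    using finite_pair_section[of "elts (Yf q)" Z "num k"] Yf(1)[OF that] ZM
    unfolding R_def L1_def by auto

  \<comment> \<open>Stage \<open>n\<close> adds the supports of indices that occur on levels up to
    \<open>n\<close> in covers of conditions supported so far. Each stage thus stays finite, while
    every level is reached eventually.\<close>
  define H where "H n B d \<longleftrightarrow> d \<epsilon> B \<or> (d \<in> C \<and> (\<exists>q\<in>A. (\<forall>d'\<in>C. cdom q d' \<longrightarrow> d' \<epsilon> B) \<and>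
    (\<exists>k\<in>omega. (k \<epsilon> n \<or> k = n) \<and> (\<exists>z\<in>Z. pair z k \<epsilon> Yf q \<and> cdom (rc z) d))))" for n B d
  have "dterm M (\<lambda>e. set_of {d \<in> M. H (e 0) (e 1) d})"
  proof (rule dterm_Collect)
    show "dpred M (\<lambda>e. H (e (Suc 0)) (e (Suc 1)) (e 0))"
      unfolding H_def by (intro dpred_cdom YfT rcT dintros A C Z small_omega)
    fix e :: "nat \<Rightarrow> 'u" assume "range e \<subseteq> M"
    then have e: "e 0 \<in> M" "e 1 \<in> M" by auto
    have "small {d \<in> elts (e 1) \<union> C. H (e 0) (e 1) d}"
      unfolding H_def by (intro small_sep small_Un small_elts dpred_cdom YfT rcT dintros A C Z small_omega e)
    moreover have "{d \<in> elts (e 1) \<union> C. H (e 0) (e 1) d} = {d \<in> M. H (e 0) (e 1) d}"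
      unfolding H_def using CM trans[OF e(2)] by auto
    ultimately show "small {d \<in> M. H (e 0) (e 1) d}" by simp
  qed
  moreover obtain B0 where B0: "B0 \<in> M" "elts B0 = {d \<in> C. cdom q0 d}"
  proof -
    have "finite {d \<in> C. cdom q0 d}" using finite_cdom[OF I] q0 unfolding C_def P_def by blast
    moreover have "{d \<in> C. cdom q0 d} \<subseteq> M" using CM by blast
    ultimately show thesis using ex_finite_set that by blast
  qed
  ultimately obtain B where B: "B (num 0) = B0"
    "\<And>n. B (num (Suc n)) = set_of {d \<in> M. H (num n) (B (num n)) d}" "dterm M (\<lambda>e. B (e 0))"
    using omega_recursion[of B0 "\<lambda>n B. set_of {d \<in> M. H n B d}"] by blast
  note BT = dterm_subst1[OF B(3)]
  have BM: "B (num n) \<in> M" for n using dterm_closed[OF B(3)] by simp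
  define Q where "Q n = {q \<in> A. \<forall>d\<in>C. cdom q d \<longrightarrow> d \<epsilon> B (num n)}" for n
  have Q_P: "Q n \<subseteq> {q \<in> P. \<forall>d\<in>C. cdom q d \<longrightarrow> d \<in> elts (B (num n))}" for n unfolding Q_def A_def by auto
  have Q_finite: "finite (Q n)" if "finite (elts (B (num n)))" for n
    using finite_subset[OF Q_P] finite_cohen_below[OF I that] unfolding P_def C_def by blast
  have B_finite: "finite (elts (B (num n))) \<and> (\<forall>d. d \<epsilon> B (num (Suc n)) \<longleftrightarrow> H (num n) (B (num n)) d)" for n
  proof -
    have step: "d \<epsilon> B (num (Suc n)) \<longleftrightarrow> H (num n) (B (num n)) d" if fin: "finite (elts (B (num n)))" for n d
    proof -
      have "small {d \<in> elts (B (num n)) \<union> C. H (num n) (B (num n)) d}"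
        unfolding H_def by (intro small_sep small_Un small_elts dpred_cdom YfT rcT dintros A C Z small_omega BM num_closed)
      moreover have "{d \<in> elts (B (num n)) \<union> C. H (num n) (B (num n)) d} = {d \<in> M. H (num n) (B (num n)) d}"
        unfolding H_def using CM trans[OF BM] by auto
      ultimately have "elts (B (num (Suc n))) = {d \<in> M. H (num n) (B (num n)) d}"
        unfolding B(2) using small_set_of by metis
      moreover have "H (num n) (B (num n)) d \<Longrightarrow> d \<in> M" unfolding H_def using CM trans[OF BM] by blast
      ultimately show ?thesis unfolding in_elts[symmetric, of d] by blast
    qed
    have "finite (elts (B (num n)))"
    proof (induction n)
      case 0
      have "finite {d \<in> C. cdom q0 d}" using finite_cdom[OF I] q0 unfolding C_def P_def by blast
      then show ?case unfolding B(1) B0(2) .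
    next
      case (Suc n)
      have "finite {d \<in> C. cdom (rc z) d}" if "z \<in> Z" for z
        using finite_cdom[OF I] rc_P[OF that] unfolding C_def P_def by blast
      then have "finite (elts (B (num n)) \<union> (\<Union>q\<in>Q n. \<Union>k\<in>{..n}. \<Union>z\<in>{z \<in> Z. pair z (num k) \<epsilon> Yf q}. {d \<in> C. cdom (rc z) d}))"
        using Q_finite[OF Suc] Suc Yf_finite unfolding Q_def by auto
      moreover have "elts (B (num (Suc n))) \<subseteq> elts (B (num n)) \<union>
        (\<Union>q\<in>Q n. \<Union>k\<in>{..n}. \<Union>z\<in>{z \<in> Z. pair z (num k) \<epsilon> Yf q}. {d \<in> C. cdom (rc z) d})"
      proof
        fix d assume "d \<in> elts (B (num (Suc n)))"
        then have "H (num n) (B (num n)) d" using step[OF Suc] by simp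
        then consider "d \<epsilon> B (num n)" | q k z where "d \<in> C" "q \<in> A" "\<forall>d'\<in>C. cdom q d' \<longrightarrow> d' \<epsilon> B (num n)"
          "k \<in> omega" "k \<epsilon> num n \<or> k = num n" "z \<in> Z" "pair z k \<epsilon> Yf q" "cdom (rc z) d"
          unfolding H_def by blast
        then show "d \<in> elts (B (num n)) \<union>
          (\<Union>q\<in>Q n. \<Union>k\<in>{..n}. \<Union>z\<in>{z \<in> Z. pair z (num k) \<epsilon> Yf q}. {d \<in> C. cdom (rc z) d})"
        proof cases
          case 2
          then obtain m where m: "k = num m" by (auto elim!: omegaE)
          then have "m \<le> n" using 2(5) by auto
          moreover have "q \<in> Q n" using 2 unfolding Q_def by blast
          ultimately show ?thesis using 2 m by blast
        qed simp
      qed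
      ultimately show ?case using finite_subset by blast
    qed
    then show ?thesis using step by blast
  qed
  have B_mono: "elts (B (num m)) \<subseteq> elts (B (num n))" if "m \<le> n" for m n
    using that
  proof (induction n rule: dec_induct)
    case (step n)
    have "elts (B (num n)) \<subseteq> elts (B (num (Suc n)))" using B_finite[of n] unfolding H_def by auto
    then show ?case using step by blast
  qed simp
  have B_mono': "d \<epsilon> B (num n)" if "d \<epsilon> B (num m)" "m \<le> n" for d m n
    using subsetD[OF B_mono[OF that(2)], of d] that(1) by simp
  have Q_mono: "Q m \<subseteq> Q n" if "m \<le> n" for m n
    using B_mono'[OF _ that] unfolding Q_def by blast
  have rc_B: "d \<epsilon> B (num (Suc (max n k)))"
    if q: "q \<in> Q n" and z: "z \<in> Z" "pair z (num k) \<epsilon> Yf q" and d: "d \<in> C" "cdom (rc z) d" for q n k z d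
  proof -
    have "q \<in> Q (max n k)" using q Q_mono[of n "max n k"] by auto
    then have "q \<in> A" "\<forall>d'\<in>C. cdom q d' \<longrightarrow> d' \<epsilon> B (num (max n k))" unfolding Q_def by blast+
    moreover have "(num k :: 'u) \<epsilon> num (max n k) \<or> (num k :: 'u) = num (max n k)" by auto
    ultimately have "H (num (max n k)) (B (num (max n k))) d"
      unfolding H_def using z d num_in_omega by blast
    then show ?thesis using B_finite by blast
  qed

  \<comment> \<open>For the second selection an index is a finite set \<open>b\<close> tagged with a
    level; its open set is the intersection of the sets belonging to the members of
    \<open>b\<close>.\<close>
  define E where "E = {b \<in> {b \<in> M. elts b \<subseteq> Z}. finite (elts b)}"
  have E: "small E" unfolding E_def by (intro small_sep small_Pow Z dintros)
  note EM = small_subset[OF E]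
  define O2 where "O2 w x \<longleftrightarrow> (\<exists>b\<in>E. \<exists>n\<in>omega. w = pair b n \<and> (\<forall>z\<in>elts b. O' z x))" for w x
  define L2 where "L2 w n \<longleftrightarrow> (\<exists>b\<in>E. w = pair b n)" for w n
  have O2: "dpred M (\<lambda>e. O2 (e 0) (e 1))" unfolding O2_def by (intro OT dintros E small_omega)
  have L2: "dpred M (\<lambda>e. L2 (e 0) (e 1))" unfolding L2_def by (intro dintros E)
  have O2_pair: "O2 (pair b n) x \<longleftrightarrow> (\<forall>z\<in>elts b. O' z x)" if "b \<in> E" "n \<in> omega" for b n x
    using that EM omM unfolding O2_def by (auto simp: pair_inject)
  \<comment> \<open>At level \<open>n\<close>, \<open>b\<close> has to serve each of the finitely
    many conditions supported in \<open>B n\<close>. Confining the support of \<open>rc z\<close> to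
    some \<open>B m\<close> is what later yields compatibility with unrestricted conditions.\<close>
  define good where "good b n \<longleftrightarrow> (\<forall>q\<in>A. (\<forall>d\<in>C. cdom q d \<longrightarrow> d \<epsilon> B n) \<longrightarrow>
    (\<exists>z\<in>elts b. elts q \<subseteq> elts (rc z) \<and> (\<exists>m\<in>omega. \<forall>d\<in>C. cdom (rc z) d \<longrightarrow> d \<epsilon> B m)))" for b n
  define Z2 where "Z2 = {w \<in> product E omega. \<exists>b\<in>E. \<exists>n\<in>omega. w = pair b n \<and> good b n}"
  obtain Y where Y: "small Y" "Y \<subseteq> Z2" "infinite Y" "\<And>n. finite {w \<in> Y. L2 w (num n)}"
    "\<And>x. x \<epsilon> X \<Longrightarrow> finite {w \<in> Y. \<not> O2 w x}"
  proof (rule selection[OF V(1,2) _ O2 L2, of Z2])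
    show "small Z2" unfolding Z2_def good_def
      by (intro small_sep small_product E small_omega dpred_cdom rcT BT dintros A C)
    show "m = n" if "L2 w (num m)" "L2 w (num n)" for w m n
      using that EM unfolding L2_def by (auto simp: pair_inject)
    show "\<exists>U. U \<epsilon> T \<and> elts U = {x \<in> elts X. O2 w x}" if w: "w \<in> Z2" for w
    proof -
      obtain b n where b: "b \<in> E" "n \<in> omega" "w = pair b n" using w unfolding Z2_def by blast
      have "\<exists>U. U \<epsilon> T \<and> elts U = {x \<in> elts X. \<forall>z\<in>elts b. O' z x}"
        by (rule open_finite_Inter) (use b(1) O_open in \<open>auto simp: E_def\<close>)
      then show ?thesis unfolding b(3) O2_pair[OF b(1,2)] .
    qed
    fix F assume F: "finite F" "F \<subseteq> elts X"
    obtain n where n: "F \<subseteq> elts (V (num n))" using V_ex[OF F] by blast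
    \<comment> \<open>The cover chosen for \<open>q\<close> is infinite and only finitely many of
      its indices miss a point of \<open>F\<close>, so some index captures \<open>F\<close>; its
      support is confined by \<open>rc_B\<close>.\<close>
    have "\<exists>z\<in>Z. elts q \<subseteq> elts (rc z) \<and> (\<forall>x\<in>F. O' z x) \<and> (\<exists>m\<in>omega. \<forall>d\<in>C. cdom (rc z) d \<longrightarrow> d \<epsilon> B m)"
      if q: "q \<in> Q n" for q
    proof -
      have R: "R q (Yf q)" using Yf(1) q unfolding Q_def by blast
      have "finite (\<Union>x\<in>F. {w \<in> elts (Yf q). \<not> O1 w x})" using R F unfolding R_def by auto
      moreover have "infinite (elts (Yf q))" using R unfolding R_def by blast
      ultimately obtain w where w: "w \<in> elts (Yf q)" "w \<notin> (\<Union>x\<in>F. {w \<in> elts (Yf q). \<not> O1 w x})"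
        by (meson finite_subset subsetI)
      then obtain z k where z: "z \<in> Z" "k \<in> omega" "w = pair z k" "elts q \<subseteq> elts (rc z)"
        using R unfolding R_def by blast
      then obtain k' where k': "k = num k'" by (auto elim!: omegaE)
      have "\<forall>x\<in>F. O' z x" using w O1_pair[OF z(1,2)] unfolding z(3) by blast
      moreover have "\<forall>d\<in>C. cdom (rc z) d \<longrightarrow> d \<epsilon> B (num (Suc (max n k')))"
        using rc_B[OF q z(1)] w(1) unfolding z(3) k' by auto
      ultimately show ?thesis using z num_in_omega by blast
    qed
    then obtain g where g: "\<And>q. q \<in> Q n \<Longrightarrow> g q \<in> Z \<and> elts q \<subseteq> elts (rc (g q)) \<and> (\<forall>x\<in>F. O' (g q) x) \<and>
      (\<exists>m\<in>omega. \<forall>d\<in>C. cdom (rc (g q)) d \<longrightarrow> d \<epsilon> B m)" by metis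
    have "finite (g ` Q n)" "g ` Q n \<subseteq> M" using Q_finite B_finite g ZM by auto
    then obtain b where b: "b \<in> M" "elts b = g ` Q n" using ex_finite_set by blast
    have bE: "b \<in> E" unfolding E_def using b g \<open>finite (g ` Q n)\<close> by auto
    have "good b (num n)"
      unfolding good_def
    proof (intro ballI impI)
      fix q assume "q \<in> A" "\<forall>d\<in>C. cdom q d \<longrightarrow> d \<epsilon> B (num n)"
      then have "q \<in> Q n" unfolding Q_def by blast
      then show "\<exists>z\<in>elts b. elts q \<subseteq> elts (rc z) \<and> (\<exists>m\<in>omega. \<forall>d\<in>C. cdom (rc z) d \<longrightarrow> d \<epsilon> B m)"
        unfolding b(2) using g by blast
    qed
    then have "pair b (num n) \<in> Z2" unfolding Z2_def product_def using bE num_in_omega by blast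
    moreover have "L2 (pair b (num n)) (num n)" unfolding L2_def using bE by blast
    moreover have "\<forall>x\<in>F. O2 (pair b (num n)) x" unfolding O2_pair[OF bE num_in_omega] b(2) using g by blast
    ultimately show "\<exists>w\<in>Z2. \<exists>n. L2 w (num n) \<and> F \<subseteq> elts (V (num n)) \<and> (\<forall>x\<in>F. O2 w x)"
      using n by blast
  qed blast

  define S where "S = {z \<in> Z. \<exists>w\<in>Y. \<exists>b\<in>E. \<exists>n\<in>omega. w = pair b n \<and> z \<epsilon> b}"
  show thesis
  proof (rule that[of S])
    show "small S" unfolding S_def by (intro small_sep Z dintros Y E small_omega)
    show "S \<subseteq> Z" unfolding S_def by blast
    show "finite {z \<in> S. \<not> O' z x}" if x: "x \<epsilon> X" for x
    proof -
      have "finite {z. \<exists>b\<in>E. \<exists>n\<in>omega. w = pair b n \<and> z \<epsilon> b}" for w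
      proof (cases "\<exists>b\<in>E. \<exists>n\<in>omega. w = pair b n")
        case True
        then obtain b n where b: "b \<in> E" "n \<in> omega" "w = pair b n" by blast
        have "{z. \<exists>b\<in>E. \<exists>n\<in>omega. w = pair b n \<and> z \<epsilon> b} \<subseteq> elts b"
          using b EM omM by (auto simp: pair_inject)
        then show ?thesis using b(1) finite_subset unfolding E_def by blast
      next
        case False
        then have "{z. \<exists>b\<in>E. \<exists>n\<in>omega. w = pair b n \<and> z \<epsilon> b} = {}" by blast
        then show ?thesis by (metis finite.emptyI)
      qed
      then have "finite (\<Union>w\<in>{w \<in> Y. \<not> O2 w x}. {z. \<exists>b\<in>E. \<exists>n\<in>omega. w = pair b n \<and> z \<epsilon> b})"
        using Y(5)[OF x] by blast
      moreover have "{z \<in> S. \<not> O' z x} \<subseteq> (\<Union>w\<in>{w \<in> Y. \<not> O2 w x}. {z. \<exists>b\<in>E. \<exists>n\<in>omega. w = pair b n \<and> z \<epsilon> b})"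
      proof
        fix z assume "z \<in> {z \<in> S. \<not> O' z x}"
        then obtain b n where b: "b \<in> E" "n \<in> omega" "pair b n \<in> Y" "z \<epsilon> b" "\<not> O' z x"
          unfolding S_def by blast
        then have "\<not> O2 (pair b n) x" using O2_pair[OF b(1,2)] by auto
        then show "z \<in> (\<Union>w\<in>{w \<in> Y. \<not> O2 w x}. {z. \<exists>b\<in>E. \<exists>n\<in>omega. w = pair b n \<and> z \<epsilon> b})"
          using b by blast
      qed
      ultimately show ?thesis using finite_subset by blast
    qed
  next
    fix p F assume p: "p \<in> P" "elts q0 \<subseteq> elts p" and F: "finite F" "F \<subseteq> elts X"
    \<comment> \<open>\<open>q\<close> is the restriction of \<open>p\<close> to the union of the
      stages. It still extends \<open>q0\<close>, since \<open>B 0\<close> is the support of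
      \<open>q0\<close>.\<close>
    obtain q where q: "q \<in> P" "\<And>z. z \<epsilon> q \<longleftrightarrow> z \<epsilon> p \<and> (\<exists>d\<in>C. \<exists>a\<in>two. z = pair d a \<and> (\<exists>m. d \<epsilon> B (num m)))"
      using cohen_restrict[OF I, of p "\<lambda>d. \<exists>m. d \<epsilon> B (num m)"] p(1) unfolding P_def C_def by blast
    have "q0 \<in> cohen_forcing M I" using q0 unfolding P_def .
    have "z \<epsilon> q" if z: "z \<epsilon> q0" for z
    proof -
      obtain d a where "d \<in> C" "a \<in> two" "z = pair d a" "cdom q0 d"
        using cohen_elem[OF I \<open>q0 \<in> cohen_forcing M I\<close> z] unfolding C_def by blast
      moreover from this have "d \<epsilon> B (num 0)" unfolding in_elts[symmetric, of d] B(1) B0(2) by blast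
      moreover have "z \<epsilon> p" using z p(2) by auto
      ultimately show ?thesis using q(2) by blast
    qed
    then have qA: "q \<in> A" unfolding A_def using q(1) by auto
    have cdomq: "\<exists>m. d \<epsilon> B (num m)" if d: "d \<in> C" "cdom q d" for d
    proof -
      obtain a where a: "a \<in> two" "pair d a \<epsilon> q" using d(2) unfolding cdom_def by blast
      then obtain d' a' where "d' \<in> C" "a' \<in> two" "pair d a = pair d' a'" "\<exists>m. d' \<epsilon> B (num m)" using q(2) by blast
      then show ?thesis using pair_inject[of d a d' a'] CM two_M a(1) d(1) by blast
    qed
    then obtain lev where lev: "\<And>d. d \<in> C \<Longrightarrow> cdom q d \<Longrightarrow> d \<epsilon> B (num (lev d))" by metis
    have fin: "finite {d \<in> C. cdom q d}" using finite_cdom[OF I] q(1) unfolding P_def C_def by blast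
    \<comment> \<open>The finite support of \<open>q\<close> has appeared by stage \<open>m\<close>;
      the inserted 0 covers an empty support.\<close>
    define m where "m = Max (insert 0 (lev ` {d \<in> C. cdom q d}))"
    have "lev d \<le> m" if "d \<in> C" "cdom q d" for d unfolding m_def using fin that by (intro Max_ge) auto
    then have qQ: "q \<in> Q m" unfolding Q_def using qA lev B_mono' by blast
    \<comment> \<open>Discarding the indices that miss a point of \<open>F\<close> and those on
      levels below \<open>m\<close> removes finitely many. What is left has a level at which
      \<open>q\<close> is among the conditions served.\<close>
    have "finite ((\<Union>x\<in>F. {w \<in> Y. \<not> O2 w x}) \<union> (\<Union>n\<in>{..<m}. {w \<in> Y. L2 w (num n)}))"
      using F Y(4,5) by auto
    then obtain w where w: "w \<in> Y" "w \<notin> (\<Union>x\<in>F. {w \<in> Y. \<not> O2 w x})" "w \<notin> (\<Union>n\<in>{..<m}. {w \<in> Y. L2 w (num n)})"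
      using Y(3) by (metis (no_types, lifting) UnI1 UnI2 finite_subset subsetI)
    then obtain b n where b: "b \<in> E" "w = pair b (num n)" "good b (num n)"
      using Y(2) unfolding Z2_def omega_def by blast
    have "L2 w (num n)" unfolding L2_def using b by blast
    then have "\<not> n < m" using w(1,3) by blast
    then have "m \<le> n" by simp
    then have "q \<in> Q n" using qQ Q_mono by blast
    then obtain z k where z: "z \<epsilon> b" "elts q \<subseteq> elts (rc z)" "k \<in> omega"
        "\<forall>d\<in>C. cdom (rc z) d \<longrightarrow> d \<epsilon> B k"
      using b(3) unfolding good_def Q_def by auto
    obtain k' where k': "k = num k'" using z(3) by (rule omegaE)
    have zZ: "z \<in> Z" using z(1) b(1) unfolding E_def by auto
    have "z \<in> S" unfolding S_def using zZ w(1) b z(1) num_in_omega by blast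
    moreover have "\<forall>x\<in>F. O' z x"
      using w(1,2) O2_pair[OF b(1) num_in_omega] z(1) unfolding b(2) by auto
    \<comment> \<open>The support of \<open>rc z\<close> lies in a stage of \<open>B\<close>, where
      \<open>p\<close> coincides with its restriction \<open>q\<close>, and \<open>rc z\<close>
      extends \<open>q\<close>. Hence \<open>p\<close> and \<open>rc z\<close> agree wherever both
      are defined.\<close>
    moreover have "\<exists>p'\<in>P. elts p \<subseteq> elts p' \<and> elts (rc z) \<subseteq> elts p'"
      unfolding P_def
    proof (rule cohen_union[OF I])
      show "p \<in> cohen_forcing M I" "rc z \<in> cohen_forcing M I" using p rc_P[OF zZ] unfolding P_def by auto
      fix d a a' assume d: "d \<in> coords I" "a \<in> two" "a' \<in> two" "pair d a \<epsilon> p" "pair d a' \<epsilon> rc z"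
      have dC: "d \<in> C" using d(1) unfolding C_def .
      have "cdom (rc z) d" unfolding cdom_def using d by blast
      then have "d \<epsilon> B (num k')" using z(4) dC unfolding k' by blast
      then have "pair d a \<epsilon> q" using q(2) d dC by blast
      then have "pair d a \<epsilon> rc z" using z(2) by auto
      then show "a = a'"
        using rc_P[OF zZ] d(5) CM[OF dC] two_M[OF d(2)] two_M[OF d(3)]
        unfolding P_def cohen_iff[OF I] by blast
    qed
    ultimately show "\<exists>z\<in>S. (\<forall>x\<in>F. O' z x) \<and> (\<exists>p'\<in>P. elts p \<subseteq> elts p' \<and> elts (rc z) \<subseteq> elts p')" by blast
  qed
qed

subsection \<open>The extension\<close>

locale cohen_extension = ground_gamma_space M X T + generic M "cohen_forcing M I" G N val
  for M G N :: "'u::set_universe set" and X T I :: 'u and val :: "'u \<Rightarrow> 'u" +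
  assumes I: "I \<in> M"
begin

text \<open>\<open>refine\<close> condenses two facts about the extension: \<open>val u\<close>
  captures finite sets, and its members are unions of ground-model open sets.\<close>

lemma gamma_subcover_in_extension:
  assumes u: "u \<in> names M (cohen_forcing M I)"
    and proper: "\<And>U. U \<epsilon> val u \<Longrightarrow> \<not> elts X \<subseteq> elts U"
    and refine: "\<And>F. finite F \<Longrightarrow> F \<subseteq> elts X \<Longrightarrow>
      \<exists>U W. U \<epsilon> val u \<and> W \<epsilon> T \<and> F \<subseteq> elts W \<and> elts W \<subseteq> elts U"
  obtains v where "v \<in> names M (cohen_forcing M I)" "elts (val v) \<subseteq> elts (val u)"
    "\<And>F. finite F \<Longrightarrow> F \<subseteq> elts X \<Longrightarrow> \<exists>U. U \<epsilon> val v \<and> F \<subseteq> elts U"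
    "\<And>x. x \<epsilon> X \<Longrightarrow> finite {U \<in> elts (val v). \<not> x \<epsilon> U}"
proof -
  define P where "P = cohen_forcing M I"
  have P: "small P" using small_P unfolding P_def .
  note PM = small_subset[OF P]
  have GP: "p \<in> P" if "p \<in> G" for p using G_P that unfolding P_def .
  have uM: "u \<in> M" using names_M[OF u] .
  \<comment> \<open>The components of a pair lie two membership steps below it, so this double union
    contains every name in the domain of \<open>u\<close>.\<close>
  define C where "C = (\<Union>b\<in>(\<Union>z\<in>elts u. elts z). elts b)"
  have C: "small C" unfolding C_def by (intro small_Union small_elts uM)
  note CM = small_subset[OF C]
  have uC: "s \<in> C" if sp: "pair s p \<epsilon> u" "s \<in> M" "p \<in> M" for s p
  proof -
    obtain b where "b \<epsilon> pair s p" "s \<epsilon> b" using pair_components[OF sp(2,3)] by blast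
    then show ?thesis using sp(1) unfolding C_def by (simp add: Bex_def) blast
  qed
  obtain Fc where Fc: "dpred M (\<lambda>e. Fc (e 0) (e 1) (e 2))"
    and stronger: "\<And>r r' x s. Fc r x s \<Longrightarrow> elts r \<subseteq> elts r' \<Longrightarrow> Fc r' x s"
    and sound: "\<And>r x s p. r \<in> G \<Longrightarrow> x \<epsilon> X \<Longrightarrow> s \<in> M \<Longrightarrow> p \<in> M \<Longrightarrow> pair s p \<epsilon> u \<Longrightarrow> Fc r x s \<Longrightarrow> x \<epsilon> val s"
    and truth: "\<And>W s p. W \<in> M \<Longrightarrow> elts W \<subseteq> elts X \<Longrightarrow> s \<in> M \<Longrightarrow> p \<in> M \<Longrightarrow> pair s p \<epsilon> u \<Longrightarrow>
       elts W \<subseteq> elts (val s) \<Longrightarrow> \<exists>r\<in>G. \<forall>x\<in>elts W. Fc r x s"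
    using forcing_theorem[OF u X] by blast
  note FcT = dpred_subst3[OF Fc]
  \<comment> \<open>That \<open>r\<close> forces \<open>s\<close> into \<open>u\<close> is
    guaranteed in the simplest way: \<open>r\<close> extends a condition \<open>p\<close> attached
    to \<open>s\<close> in \<open>u\<close>.\<close>
  define Z where "Z = {z \<in> product C P. \<exists>s\<in>C. \<exists>r\<in>P. \<exists>p\<in>P. z = pair s r \<and> pair s p \<epsilon> u \<and> elts p \<subseteq> elts r}"
  have Z: "small Z" unfolding Z_def by (intro small_sep small_product C P dintros uM)
  note ZM = small_subset[OF Z]
  have ZE: "\<exists>s\<in>C. \<exists>r\<in>P. \<exists>p\<in>P. z = pair s r \<and> pair s p \<epsilon> u \<and> elts p \<subseteq> elts r" if "z \<in> Z" for z
    using that unfolding Z_def by blast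
  have R: "dpred M (\<lambda>e. \<exists>s\<in>C. e 0 = pair s (e 1))" by (intro dintros C)
  have ex: "\<exists>r\<in>P. \<exists>s\<in>C. z = pair s r" if "z \<in> Z" for z using ZE[OF that] by blast
  \<comment> \<open>The second projection is obtained through choice because this delivers its
    definability; injectivity of pairs makes the choice forced.\<close>
  obtain rc where rc': "\<And>z. z \<in> Z \<Longrightarrow> rc z \<in> P \<and> (\<exists>s\<in>C. z = pair s (rc z))"
    and rc: "dterm M (\<lambda>e. rc (e 0))"
  proof (rule small_choice[OF Z P R ex])
    fix F assume "\<And>z. z \<in> Z \<Longrightarrow> F z \<in> P \<and> (\<exists>s\<in>C. z = pair s (F z))" "dterm M (\<lambda>e. F (e 0))"
    then show thesis by (rule that)
  qed
  note rcT = dterm_subst1[OF rc]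
  have rc_pair: "rc (pair s r) = r" if sr: "pair s r \<in> Z" "s \<in> C" "r \<in> P" for s r
  proof -
    obtain s' where s': "s' \<in> C" "pair s r = pair s' (rc (pair s r))" "rc (pair s r) \<in> P" using rc' sr(1) by blast
    from iffD1[OF pair_inject[OF CM[OF sr(2)] PM[OF sr(3)] CM[OF s'(1)] PM[OF s'(3)]] s'(2)]
    show ?thesis by (elim conjE) (rule sym)
  qed
  have Z_cases: "\<exists>s p. s \<in> C \<and> rc z \<in> P \<and> p \<in> P \<and> z = pair s (rc z) \<and> pair s p \<epsilon> u \<and> elts p \<subseteq> elts (rc z)"
    if z: "z \<in> Z" for z
    using ZE[OF z] rc_pair z by metis
  define O' where "O' z x \<longleftrightarrow> (\<exists>s\<in>C. z = pair s (rc z) \<and> (\<exists>W\<in>elts T. x \<epsilon> W \<and> (\<forall>y\<in>elts W. Fc (rc z) y s)))" for z x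
  have O: "dpred M (\<lambda>e. O' (e 0) (e 1))" unfolding O'_def by (intro FcT rcT dintros C T)
  note OT = dpred_subst2[OF O]
  have O'_iff: "O' (pair s r) x \<longleftrightarrow> (\<exists>W\<in>elts T. x \<epsilon> W \<and> (\<forall>y\<in>elts W. Fc r y s))"
    if "pair s r \<in> Z" "s \<in> C" "r \<in> P" for s r x
    unfolding O'_def rc_pair[OF that] using that CM PM by (auto simp: pair_inject)
  have O_open: "\<exists>U. U \<epsilon> T \<and> elts U = {x \<in> elts X. O' z x}" if z: "z \<in> Z" for z
  proof -
    obtain s where s: "s \<in> C" "rc z \<in> P" "z = pair s (rc z)" using Z_cases[OF z] by blast
    have "small {W \<in> elts T. \<forall>y\<in>elts W. Fc (rc z) y s}"
      using s CM PM by (intro small_sep small_elts T FcT dintros) auto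
    moreover have "{W \<in> elts T. \<forall>y\<in>elts W. Fc (rc z) y s} \<subseteq> elts T" by blast
    ultimately obtain U where U: "U \<epsilon> T" "elts U = (\<Union>W\<in>{W \<in> elts T. \<forall>y\<in>elts W. Fc (rc z) y s}. elts W)"
      by (rule open_Union)
    have "O' z x \<longleftrightarrow> (\<exists>W\<in>elts T. x \<epsilon> W \<and> (\<forall>y\<in>elts W. Fc (rc z) y s))" for x
      using O'_iff[of s "rc z" x] s z by simp
    then have "elts U = {x. O' z x}" unfolding U(2) by auto
    then show ?thesis using U(1) open_subset by blast
  qed
  \<comment> \<open>Finite sets of points are taken as elements of \<open>M\<close>, so that the
    statement decided generically below is definable over \<open>M\<close>.\<close>
  define Fin where "Fin = {f \<in> {f \<in> M. elts f \<subseteq> elts X}. finite (elts f)}"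
  have Fin: "small Fin" unfolding Fin_def by (intro small_sep small_Pow small_elts X dintros)
  have FinE: "\<exists>f\<in>Fin. elts f = F" if F: "finite F" "F \<subseteq> elts X" for F
  proof -
    have "F \<subseteq> M" using F(2) elts_subset[OF X] by blast
    then obtain f where "f \<in> M" "elts f = F" using ex_finite_set[OF F(1)] by blast
    then show ?thesis using F unfolding Fin_def by blast
  qed
  define st where "st q f \<longleftrightarrow> (\<exists>z\<in>Z. elts q \<subseteq> elts (rc z) \<and> (\<forall>x\<in>elts f. O' z x))" for q f
  \<comment> \<open>A condition with no failing extension satisfies the second alternative itself;
    otherwise a failing extension satisfies the first. So the set is dense, and no forcing relation
    for being an omega-cover is involved.\<close>
  have "\<exists>q\<in>G. (\<exists>f\<in>Fin. \<not> st q f) \<or> (\<forall>q'\<in>P. elts q \<subseteq> elts q' \<longrightarrow> (\<forall>f\<in>Fin. st q' f))"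
  proof (rule generic_meets)
    show "dpred M (\<lambda>e. (\<exists>f\<in>Fin. \<not> st (e 0) f) \<or> (\<forall>q'\<in>P. elts (e 0) \<subseteq> elts q' \<longrightarrow> (\<forall>f\<in>Fin. st q' f)))"
      unfolding st_def by (intro OT rcT dintros Fin P Z)
    show "\<exists>q\<in>cohen_forcing M I. elts p \<subseteq> elts q \<and>
      ((\<exists>f\<in>Fin. \<not> st q f) \<or> (\<forall>q'\<in>P. elts q \<subseteq> elts q' \<longrightarrow> (\<forall>f\<in>Fin. st q' f)))"
      if "p \<in> cohen_forcing M I" for p
      using that unfolding P_def by blast
  qed
  then obtain q0 where q0: "q0 \<in> G"
    "(\<exists>f\<in>Fin. \<not> st q0 f) \<or> (\<forall>q'\<in>P. elts q0 \<subseteq> elts q' \<longrightarrow> (\<forall>f\<in>Fin. st q' f))" by blast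
  \<comment> \<open>Failure at \<open>q0\<close> is refuted by the actual cover: a member
    \<open>val s\<close> contains an open \<open>W\<close> around \<open>f\<close>, and a condition
    in \<open>G\<close> below \<open>q0\<close> forces all of \<open>W\<close> into
    \<open>s\<close>.\<close>
  have "st q0 f" if f: "f \<in> Fin" for f
  proof -
    obtain U W where UW: "U \<epsilon> val u" "W \<epsilon> T" "elts f \<subseteq> elts W" "elts W \<subseteq> elts U"
      using refine[of "elts f"] f unfolding Fin_def by blast
    then obtain s p where s: "s \<in> names M (cohen_forcing M I)" "p \<in> G" "pair s p \<epsilon> u" "U = val s"
      using elts_val[OF u] by blast
    have sM: "s \<in> M" "p \<in> P" "p \<in> M" using s names_M GP PM by blast+
    have sC: "s \<in> C" using uC[OF s(3) sM(1,3)] .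
    obtain r where r: "r \<in> G" "\<forall>x\<in>elts W. Fc r x s"
      using truth[OF T_M[OF UW(2)] open_subset[OF UW(2)] sM(1,3) s(3)] UW(4) s(4) by blast
    obtain r1 where r1: "r1 \<in> G" "elts r \<subseteq> elts r1" "elts p \<subseteq> elts r1" using G_directed[OF r(1) s(2)] by blast
    obtain r2 where r2: "r2 \<in> G" "elts r1 \<subseteq> elts r2" "elts q0 \<subseteq> elts r2" using G_directed[OF r1(1) q0(1)] by blast
    have r2P: "r2 \<in> P" using GP[OF r2(1)] .
    have "elts p \<subseteq> elts r2" "elts r \<subseteq> elts r2" using r1 r2 by blast+
    then have z: "pair s r2 \<in> Z" unfolding Z_def product_def using sC r2P sM(2) s(3) by blast
    have "\<forall>y\<in>elts W. Fc r2 y s" using r(2) stronger \<open>elts r \<subseteq> elts r2\<close> by blast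
    then have "O' (pair s r2) x" if "x \<in> elts f" for x
      unfolding O'_iff[OF z sC r2P] using UW(2,3) that by (intro bexI[of _ W]) auto
    then show ?thesis unfolding st_def using z r2(3) rc_pair[OF z sC r2P] by metis
  qed
  then have st: "st q f" if "q \<in> P" "elts q0 \<subseteq> elts q" "f \<in> Fin" for q f using q0(2) that by blast
  obtain S where S: "small S" "S \<subseteq> Z" "\<And>x. x \<epsilon> X \<Longrightarrow> finite {z \<in> S. \<not> O' z x}"
    and dense: "\<And>p F. p \<in> P \<Longrightarrow> elts q0 \<subseteq> elts p \<Longrightarrow> finite F \<Longrightarrow> F \<subseteq> elts X \<Longrightarrow>
      \<exists>z\<in>S. (\<forall>x\<in>F. O' z x) \<and> (\<exists>p'\<in>P. elts p \<subseteq> elts p' \<and> elts (rc z) \<subseteq> elts p')"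
  proof (rule cohen_selection[OF I Z rc _ O O_open])
    show "rc z \<in> cohen_forcing M I" if "z \<in> Z" for z using rc'[OF that] unfolding P_def by blast
    show "q0 \<in> cohen_forcing M I" using GP[OF q0(1)] unfolding P_def .
    show "\<exists>U. U \<epsilon> T \<and> U \<noteq> X \<and> F \<subseteq> elts U" if "finite F" "F \<subseteq> elts X" for F
      using refine[OF that] proper by blast
    show "\<exists>z\<in>Z. elts q \<subseteq> elts (rc z) \<and> (\<forall>x\<in>F. O' z x)"
      if "q \<in> cohen_forcing M I" "elts q0 \<subseteq> elts q" "finite F" "F \<subseteq> elts X" for q F
      using FinE[OF that(3,4)] st[of q] that(1,2) unfolding st_def P_def by blast
  qed (use that in \<open>auto simp: P_def\<close>)
  obtain v where v: "v \<in> M" "S = elts v" using S(1) by (rule smallE)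
  have S_cases: "\<exists>s p. s \<in> C \<and> s \<in> names M (cohen_forcing M I) \<and> rc z \<in> P \<and> p \<in> P \<and> z = pair s (rc z) \<and>
      pair s p \<epsilon> u \<and> elts p \<subseteq> elts (rc z)" if z: "z \<in> S" for z
  proof -
    obtain s p where s: "s \<in> C" "rc z \<in> P" "p \<in> P" "z = pair s (rc z)" "pair s p \<epsilon> u" "elts p \<subseteq> elts (rc z)"
      using Z_cases S(2) z by blast
    then have "s \<in> names M (cohen_forcing M I)" using names_pair[OF u s(5)] CM PM by blast
    then show ?thesis using s by blast
  qed
  have vn: "v \<in> names M (cohen_forcing M I)"
    unfolding names_iff[of v]
  proof (intro conjI allI impI v(1))
    fix z assume "z \<epsilon> v"
    then have "z \<in> S" using v(2) by simp
    then show "\<exists>s\<in>names M (cohen_forcing M I). \<exists>p\<in>cohen_forcing M I. z = pair s p"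
      using S_cases unfolding P_def by blast
  qed
  have val_v: "U \<epsilon> val v \<longleftrightarrow> (\<exists>s\<in>C. \<exists>r\<in>G. pair s r \<in> S \<and> U = val s)" for U
  proof -
    have "s \<in> names M (cohen_forcing M I) \<longleftrightarrow> s \<in> C" if sr: "pair s r \<in> S" "s \<in> M" "r \<in> G" for s r
    proof -
      have rM: "r \<in> M" using GP PM sr(3) by blast
      obtain s' where s': "s' \<in> C" "s' \<in> names M (cohen_forcing M I)" "rc (pair s r) \<in> P"
        "pair s r = pair s' (rc (pair s r))" using S_cases[OF sr(1)] by blast
      have "s = s'" using iffD1[OF pair_inject[OF sr(2) rM CM[OF s'(1)] PM[OF s'(3)]] s'(4)] by (rule conjunct1)
      then show ?thesis using s' by blast
    qed
    moreover have "pair s r \<epsilon> v \<longleftrightarrow> pair s r \<in> S" for s r using v(2) by simp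
    ultimately show ?thesis unfolding elts_val[OF vn] using names_M CM by blast
  qed
  have rc_S: "rc (pair s r) = r" if "pair s r \<in> S" "s \<in> C" "r \<in> G" for s r
    using rc_pair that S(2) GP by blast
  have sound': "x \<epsilon> val s" if sr: "pair s r \<in> S" "s \<in> C" "r \<in> G" and x: "O' (pair s r) x" for s r x
  proof -
    have rP: "r \<in> P" using GP sr(3) .
    have "pair s r \<in> Z" using sr(1) S(2) by blast
    then obtain W where W: "W \<epsilon> T" "x \<epsilon> W" "Fc r x s" using x O'_iff[of s r x] sr(2) rP by auto
    obtain s' p where s': "s' \<in> C" "p \<in> P" "pair s r = pair s' (rc (pair s r))" "pair s' p \<epsilon> u" "rc (pair s r) \<in> P"
      using S_cases[OF sr(1)] by blast
    have "s = s'"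
      using iffD1[OF pair_inject[OF CM[OF sr(2)] PM[OF rP] CM[OF s'(1)] PM[OF s'(5)]] s'(3)] by (rule conjunct1)
    then have "pair s p \<epsilon> u" using s' by blast
    moreover have "x \<epsilon> X" using open_subset[OF W(1)] W(2) by auto
    ultimately show ?thesis using sound[OF sr(3) _ CM[OF sr(2)] PM[OF s'(2)] _ W(3)] by blast
  qed
  show thesis
  proof (rule that[OF vn])
    show "elts (val v) \<subseteq> elts (val u)"
    proof
      fix U assume "U \<in> elts (val v)"
      then obtain s r where s: "s \<in> C" "r \<in> G" "pair s r \<in> S" "U = val s" using val_v by auto
      obtain s' p where s': "s' \<in> C" "s' \<in> names M (cohen_forcing M I)" "p \<in> P"
        "pair s r = pair s' (rc (pair s r))" "pair s' p \<epsilon> u" "rc (pair s r) \<in> P" "elts p \<subseteq> elts (rc (pair s r))"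
        using S_cases[OF s(3)] by blast
      have "s = s'"
        using iffD1[OF pair_inject[OF CM[OF s(1)] PM[OF GP[OF s(2)]] CM[OF s'(1)] PM[OF s'(6)]] s'(4)]
        by (rule conjunct1)
      moreover have "p \<in> G" using G_weaker[OF s(2)] s'(3,7) rc_S[OF s(3,1,2)] unfolding P_def by simp
      ultimately show "U \<in> elts (val u)" using elts_val[OF u, of U] s' s(4) by auto
    qed
    show "\<exists>U. U \<epsilon> val v \<and> F \<subseteq> elts U" if F: "finite F" "F \<subseteq> elts X" for F
    proof -
      obtain f where f: "f \<in> Fin" "elts f = F" using FinE[OF F] by blast
      have fM: "f \<in> M" using f(1) unfolding Fin_def by blast
      \<comment> \<open>The common extensions supplied with \<open>S\<close> make this set dense
        below \<open>q0\<close>. Since \<open>q\<close> extends \<open>rc z\<close>, the pair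
        \<open>z\<close> is active in the evaluation of \<open>v\<close>.\<close>
      have "\<exists>q\<in>G. elts q0 \<subseteq> elts q \<and> (\<exists>z\<in>S. (\<forall>x\<in>elts f. O' z x) \<and> elts (rc z) \<subseteq> elts q)"
      proof (rule generic_meets_below[OF _ q0(1)])
        show "dpred M (\<lambda>e. \<exists>z\<in>S. (\<forall>x\<in>elts f. O' z x) \<and> elts (rc z) \<subseteq> elts (e 0))"
          by (intro OT rcT dintros S(1) fM)
        fix p assume "p \<in> cohen_forcing M I" "elts q0 \<subseteq> elts p"
        then show "\<exists>q\<in>cohen_forcing M I. elts p \<subseteq> elts q \<and> (\<exists>z\<in>S. (\<forall>x\<in>elts f. O' z x) \<and> elts (rc z) \<subseteq> elts q)"
          using dense[of p F] F f(2) unfolding P_def by blast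
      qed
      then obtain q z where q: "q \<in> G" "z \<in> S" "\<forall>x\<in>F. O' z x" "elts (rc z) \<subseteq> elts q"
        unfolding f(2) by blast
      then obtain s where s: "s \<in> C" "rc z \<in> P" "z = pair s (rc z)" using S_cases by blast
      have rG: "rc z \<in> G" using G_weaker[OF q(1) _ q(4)] s(2) unfolding P_def by blast
      have "val s \<epsilon> val v" unfolding val_v using s rG q(2) by metis
      moreover have "x \<epsilon> val s" if "x \<in> F" for x
        using sound'[of s "rc z" x] q(2,3) s rG that by metis
      ultimately show ?thesis by (intro exI[of _ "val s"]) auto
    qed
    show "finite {U \<in> elts (val v). \<not> x \<epsilon> U}" if x: "x \<epsilon> X" for x
    proof -
      \<comment> \<open>A first projection outside \<open>M\<close>; it serves only to bound the
        members of \<open>val v\<close> that miss \<open>x\<close> by the image of a finite set of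
        indices.\<close>
      define g where "g z = (SOME s. s \<in> C \<and> (\<exists>r\<in>P. z = pair s r))" for z
      have g: "g (pair s r) = s" if "s \<in> C" "r \<in> P" for s r
        unfolding g_def by (rule some_equality) (use that CM PM in \<open>auto simp: pair_inject\<close>)
      have "{U \<in> elts (val v). \<not> x \<epsilon> U} \<subseteq> (\<lambda>z. val (g z)) ` {z \<in> S. \<not> O' z x}"
      proof
        fix U assume "U \<in> {U \<in> elts (val v). \<not> x \<epsilon> U}"
        then obtain s r where s: "s \<in> C" "r \<in> G" "pair s r \<in> S" "U = val s" "\<not> x \<epsilon> U" using val_v by auto
        then have "\<not> O' (pair s r) x" using sound' by blast
        moreover have "U = val (g (pair s r))" using g s GP by simp
        ultimately show "U \<in> (\<lambda>z. val (g z)) ` {z \<in> S. \<not> O' z x}" using s(3) by blast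
      qed
      then show ?thesis using S(3)[OF x] finite_subset by blast
    qed
  qed
qed

text \<open>The relativised notions of \<open>N\<close> are translated into HOL statements about
  \<open>val u\<close>, and the subcover is translated back. Closure of \<open>N\<close> under
  finite sets is enough for both directions.\<close>

lemma gamma_space_extension: "gamma_space N (generated_open N X T) X"
  unfolding gamma_space_def
proof (intro ballI impI)
  interpret N: fin_class N by (rule N_fin_class)
  have XN: "X \<in> N" using X M_subset_N by blast
  fix \<U> assume \<U>: "\<U> \<in> N" "omega_cover N (generated_open N X T) X \<U>"
  then obtain u where u: "u \<in> names M (cohen_forcing M I)" "\<U> = val u" unfolding N by blast
  have UN: "U \<in> N" if "U \<epsilon> \<U>" for U using N.trans[OF \<U>(1) that] .
  have opn: "generated_open N X T U" and proper: "\<not> elts X \<subseteq> elts U" if "U \<epsilon> \<U>" for U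
    using \<U>(2) UN[OF that] that N.subset_in_iff[OF XN] unfolding omega_cover_def open_cover_def by blast+
  have open_sub: "elts U \<subseteq> elts X" if "U \<epsilon> \<U>" for U
    using opn[OF that] N.subset_in_iff[OF UN[OF that]] unfolding generated_open_def by blast
  have nbhd: "\<exists>V. V \<epsilon> T \<and> x \<epsilon> V \<and> elts V \<subseteq> elts U" if U: "U \<epsilon> \<U>" "x \<epsilon> U" for U x
  proof -
    obtain V where "V \<in> N" "V \<epsilon> T" "x \<epsilon> V" "subset_in N V U"
      using opn[OF U(1)] U(2) N.trans[OF UN[OF U(1)] U(2)] unfolding generated_open_def by blast
    then show ?thesis using N.subset_in_iff by blast
  qed
  have refine: "\<exists>U W. U \<epsilon> val u \<and> W \<epsilon> T \<and> F \<subseteq> elts W \<and> elts W \<subseteq> elts U" if F: "finite F" "F \<subseteq> elts X" for F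
  proof -
    have "F \<subseteq> N" using F(2) N.elts_subset[OF XN] by blast
    then obtain f where f: "f \<in> N" "elts f = F" using N.ex_finite_set[OF F(1)] by blast
    then have "is_finite N f \<and> subset_in N f X" using F by (simp add: N.is_finite_iff N.subset_in_iff)
    then obtain U where U: "U \<epsilon> \<U>" "F \<subseteq> elts U"
      using \<U>(2) f N.subset_in_iff[OF f(1)] unfolding omega_cover_def by metis
    have "\<exists>V. V \<epsilon> T \<and> x \<epsilon> V \<and> elts V \<subseteq> elts U" if "x \<in> F" for x
      using nbhd[OF U(1), of x] U(2) that by auto
    then obtain V where V: "\<And>x. x \<in> F \<Longrightarrow> V x \<epsilon> T \<and> x \<epsilon> V x \<and> elts (V x) \<subseteq> elts U" by metis
    \<comment> \<open>The neighbourhoods are chosen outside \<open>M\<close>, but a finite set of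
      elements of \<open>M\<close> belongs to \<open>M\<close>. Hence their union is open in the
      ground model.\<close>
    have "small (V ` F)" using F(1) V T_M by (intro small_finite) auto
    moreover have "V ` F \<subseteq> elts T" using V by auto
    ultimately obtain W where W: "W \<epsilon> T" "elts W = (\<Union>U\<in>V ` F. elts U)" by (rule open_Union)
    have "F \<subseteq> elts W" "elts W \<subseteq> elts U" unfolding W(2) using V by auto
    then show ?thesis using U(1) W(1) unfolding u(2) by blast
  qed
  obtain v where v: "v \<in> names M (cohen_forcing M I)" "elts (val v) \<subseteq> elts \<U>"
    "\<And>F. finite F \<Longrightarrow> F \<subseteq> elts X \<Longrightarrow> \<exists>U. U \<epsilon> val v \<and> F \<subseteq> elts U"
    "\<And>x. x \<epsilon> X \<Longrightarrow> finite {U \<in> elts (val v). \<not> x \<epsilon> U}"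
    using gamma_subcover_in_extension[OF u(1) _ refine] proper unfolding u(2) by blast
  have vN: "val v \<in> N" using v(1) unfolding N by blast
  have vU: "U \<epsilon> \<U>" if "U \<epsilon> val v" for U using v(2) that by auto
  have "gamma_cover N (generated_open N X T) X (val v)"
    unfolding gamma_cover_def open_cover_def
  proof (intro conjI ballI impI)
    show "generated_open N X T U" if "U \<epsilon> val v" for U using opn vU that by blast
    show "\<not> subset_in N X U" if "U \<epsilon> val v" for U
      using proper[OF vU[OF that]] N.subset_in_iff[OF XN] by blast
    have "elts X = (\<Union>U\<in>elts (val v). elts U)"
    proof
      show "elts X \<subseteq> (\<Union>U\<in>elts (val v). elts U)"
      proof
        fix x assume "x \<in> elts X"
        then obtain U where "U \<epsilon> val v" "{x} \<subseteq> elts U" using v(3)[of "{x}"] by auto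
        then show "x \<in> (\<Union>U\<in>elts (val v). elts U)" by auto
      qed
      show "(\<Union>U\<in>elts (val v). elts U) \<subseteq> elts X" using open_sub vU by (intro UN_least) simp
    qed
    then show "is_union N (val v) X" using N.is_union_iff[OF vN N.elts_subset[OF XN]] by blast
    \<comment> \<open>One missed point per member would, for a finite family, give a finite set
      contained in no member.\<close>
    have "infinite (elts (val v))"
    proof
      assume fin: "finite (elts (val v))"
      have "\<forall>U\<in>elts (val v). \<exists>x. x \<epsilon> X \<and> \<not> x \<epsilon> U" using proper vU by (auto simp: subset_iff)
      then obtain h where h: "\<And>U. U \<epsilon> val v \<Longrightarrow> h U \<epsilon> X \<and> \<not> h U \<epsilon> U" by (metis in_elts)
      have "h ` elts (val v) \<subseteq> elts X" using h by auto
      then obtain U where U: "U \<epsilon> val v" "h ` elts (val v) \<subseteq> elts U" using v(3) fin by blast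
      from U have "h U \<in> elts U" by (metis imageI in_elts subsetD)
      then show False using h[OF U(1)] by simp
    qed
    then show "\<not> is_finite N (val v)" by (simp add: N.is_finite_iff[OF vN])
    fix x assume "x \<in> N" "x \<epsilon> X"
    have "{U \<in> elts (val v). \<not> x \<epsilon> U} \<subseteq> N" using N.elts_subset[OF vN] by blast
    then obtain F where F: "F \<in> N" "elts F = {U \<in> elts (val v). \<not> x \<epsilon> U}"
      using N.ex_finite_set[OF v(4)[OF \<open>x \<epsilon> X\<close>]] by blast
    have "U \<epsilon> F \<longleftrightarrow> U \<epsilon> val v \<and> \<not> x \<epsilon> U" for U
      unfolding in_elts[symmetric, of U F] F(2) by simp
    moreover have "finite (elts F)" unfolding F(2) by (rule v(4)[OF \<open>x \<epsilon> X\<close>])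
    ultimately show "\<exists>F\<in>N. is_finite N F \<and> (\<forall>U\<in>N. U \<epsilon> F \<longleftrightarrow> U \<epsilon> val v \<and> \<not> x \<epsilon> U)"
      using F(1) N.is_finite_iff by blast
  qed
  moreover have "subset_in N (val v) \<U>" using v(2) N.subset_in_iff[OF vN] by blast
  ultimately show "\<exists>\<V>\<in>N. subset_in N \<V> \<U> \<and> gamma_cover N (generated_open N X T) X \<V>"
    using vN by blast
qed

end

theorem theorem5p1:
  fixes M N G :: "'u::set_universe set" and X T I :: 'u
  assumes "transitive_model_ZFC M"
    and "X \<in> M" and "T \<in> M" and "is_topology M X T"
    and "gamma_space M (\<lambda>U. U \<epsilon> T) X"
    and "I \<in> M" and "\<not> is_empty M I"
    and "generic_extension M (cohen_forcing M I) G N"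
  shows "gamma_space N (generated_open N X T) X"
proof -
  interpret ground_gamma_space M X T
    by unfold_locales fact+
  obtain val where val: "\<forall>t\<in>names M (cohen_forcing M I). \<forall>y. y \<epsilon> val t \<longleftrightarrow>
      (\<exists>s\<in>names M (cohen_forcing M I). \<exists>p\<in>G. \<exists>z. z \<epsilon> t \<and> is_pair M s p z \<and> y = val s)"
    and N: "N = val ` names M (cohen_forcing M I)" and G: "generic_filter M (cohen_forcing M I) G"
    using assms(8) unfolding generic_extension_def by blast
  interpret cohen_extension M G N X T I val
    by unfold_locales (use val N G small_cohen empty_cohen \<open>I \<in> M\<close> in blast)+
  show ?thesis by (rule gamma_space_extension)
qed

end
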